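(* Let $M\subseteq\mathbb{R}^n$ be an oriented, compact, $m$-dimensional Riemannian submanifold, possibly with boundary, with $s:=n-m>0$, and let $U\subseteq M\setminus\partial M$ be an open subset. Then for all $\varepsilon>0$, \[ \mathrm{vol}_n\, T(U,\varepsilon)\le \varepsilon^{s}\sum_{i=0}^{m}\frac{1}{s+i}\,|K_i|(U)\,\varepsilon^{i}. \]
   Context: For a submanifold $U\subseteq\mathbb{R}^n$, the tube $T(U,\varepsilon)$ is the set of points $x\in\mathbb{R}^n$ for which there is a line segment of length at most $\varepsilon$ from $x$ meeting $U$ orthogonally (i.e. $x=q+tv$ with $q\in U$, $v\perp T_qU$, $\|v\|=1$, $0\le t\le\varepsilon$). For $q\in M$, $N_qM=(T_qM)^\perp$ is the normal space, $S(N_qM)$ its unit sphere, and $S(NU)=\{(q,v): q\in U, v\in S(N_qM)\}$ the unit normal sphere bundle, with its natural Riemannian volume form $\omega_{S(NU)}$ (locally the product of the volume form of $U$ and the standard volume form of the unit sphere $S^{s-1}$ in the normal fibre). For $v\in N_qM$, the second fundamental form along $v$ is the symmetric bilinear form $S_v(X,Y)=\langle\nabla_XY,v\rangle$ on $T_qM$ ($\nabla$ the Euclidean covariant derivative, $X,Y$ tangent vector fields extended to a neighbourhood); $S(v)$ is its $m\times m$ matrix in an orthonormal basis of $T_qM$. Define homogeneous polynomials $\psi_i$ on $N_qM$ by $\det(\mathrm{Id}-tS(v))=\sum_{i=0}^m t^i\psi_i(v)$, and the integrals of absolute curvature $|K_i|(U)=\int_{S(NU)}|\psi_i(v)|\,\omega_{S(NU)}$.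 *)

theory Defs
  imports "HOL-Analysis.Analysis"
begin

fun Ck_on :: "nat \<Rightarrow> 'a::euclidean_space set \<Rightarrow> ('a \<Rightarrow> 'b::euclidean_space) \<Rightarrow> bool" where
  "Ck_on 0 V f = continuous_on V f"
| "Ck_on (Suc k) V f =
     ((\<forall>x\<in>V. f differentiable (at x)) \<and>
      (\<forall>u. Ck_on k V (\<lambda>x. frechet_derivative f (at x) u)))"

definition smooth_on :: "'a::euclidean_space set \<Rightarrow> ('a \<Rightarrow> 'b::euclidean_space) \<Rightarrow> bool" where
  "smooth_on V f \<longleftrightarrow> (\<forall>k. Ck_on k V f)"

text \<open>A submanifold chart around p: a diffeomorphism Phi of an open neighbourhood V of p
  onto an open set, straightening M \<inter> V onto a piece of an m-dimensional linear subspace L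
  (a = 0: interior chart), respectively of the half-space {y \<in> L. a \<bullet> y \<ge> 0} of L (a \<noteq> 0).\<close>

definition sm_chart ::
  "nat \<Rightarrow> (real^'n) set \<Rightarrow> real^'n \<Rightarrow> (real^'n) set \<Rightarrow> (real^'n \<Rightarrow> real^'n)
     \<Rightarrow> (real^'n) set \<Rightarrow> real^'n \<Rightarrow> bool" where
  "sm_chart m M p V Phi L a \<longleftrightarrow>
     open V \<and> p \<in> V \<and> smooth_on V Phi \<and> inj_on Phi V \<and> open (Phi ` V) \<and>
     smooth_on (Phi ` V) (inv_into V Phi) \<and>
     subspace L \<and> dim L = m \<and> a \<in> L \<and>
     Phi ` (M \<inter> V) = Phi ` V \<inter> {y \<in> L. a \<bullet> y \<ge> 0}"

definition submanifold :: "nat \<Rightarrow> (real^'n) set \<Rightarrow> bool" where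
  "submanifold m M \<longleftrightarrow> (\<forall>p\<in>M. \<exists>V Phi L a. sm_chart m M p V Phi L a)"

definition sm_interior :: "nat \<Rightarrow> (real^'n) set \<Rightarrow> (real^'n) set" where
  "sm_interior m M = {p \<in> M. \<exists>V Phi L. sm_chart m M p V Phi L 0}"

definition tangent_space :: "nat \<Rightarrow> (real^'n) set \<Rightarrow> real^'n \<Rightarrow> (real^'n) set" where
  "tangent_space m M q =
     {w. \<exists>V Phi L a. sm_chart m M q V Phi L a \<and> frechet_derivative Phi (at q) w \<in> L}"

definition normal_space :: "nat \<Rightarrow> (real^'n) set \<Rightarrow> real^'n \<Rightarrow> (real^'n) set" where
  "normal_space m M q = {v. \<forall>w\<in>tangent_space m M q. v \<bullet> w = 0}"

definition unit_normal_sphere :: "nat \<Rightarrow> (real^'n) set \<Rightarrow> real^'n \<Rightarrow> (real^'n) set" where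
  "unit_normal_sphere m M q = {v \<in> normal_space m M q. norm v = 1}"

definition alt_mform :: "nat \<Rightarrow> ((nat \<Rightarrow> real^'n) \<Rightarrow> real) \<Rightarrow> bool" where
  "alt_mform m w \<longleftrightarrow>
     (\<forall>X Y. (\<forall>i<m. X i = Y i) \<longrightarrow> w X = w Y) \<and>
     (\<forall>X. \<forall>k<m. linear (\<lambda>x. w (X(k := x)))) \<and>
     (\<forall>X i j. i < m \<and> j < m \<and> i \<noteq> j \<and> X i = X j \<longrightarrow> w X = 0)"

definition oriented :: "nat \<Rightarrow> (real^'n) set \<Rightarrow> bool" where
  "oriented m M \<longleftrightarrow>
     (\<exists>w :: real^'n \<Rightarrow> (nat \<Rightarrow> real^'n) \<Rightarrow> real.
        (\<forall>q\<in>M. alt_mform m (w q) \<and>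
                 (\<exists>X. (\<forall>i<m. X i \<in> tangent_space m M q) \<and> w q X \<noteq> 0)) \<and>
        (\<forall>X. continuous_on M (\<lambda>q. w q X)))"

definition tube :: "nat \<Rightarrow> (real^'n) set \<Rightarrow> (real^'n) set \<Rightarrow> real \<Rightarrow> (real^'n) set" where
  "tube m M U \<epsilon> =
     {x. \<exists>q\<in>U. \<exists>v\<in>unit_normal_sphere m M q. \<exists>t. 0 \<le> t \<and> t \<le> \<epsilon> \<and> x = q + t *\<^sub>R v}"

definition second_fundamental_form ::
  "nat \<Rightarrow> (real^'n) set \<Rightarrow> real^'n \<Rightarrow> real^'n \<Rightarrow> real^'n \<Rightarrow> real^'n \<Rightarrow> real" where
  "second_fundamental_form m M q v X Y =
     (THE c. \<forall>Yt W. open W \<and> q \<in> W \<and> smooth_on W Yt \<and>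
                 (\<forall>p\<in>M \<inter> W. Yt p \<in> tangent_space m M p) \<and> Yt q = Y
               \<longrightarrow> frechet_derivative Yt (at q) X \<bullet> v = c)"

definition detm :: "nat \<Rightarrow> (nat \<Rightarrow> nat \<Rightarrow> real) \<Rightarrow> real" where
  "detm m A = (\<Sum>p | p permutes {..<m}. of_int (sign p) * (\<Prod>i<m. A i (p i)))"

definition tangent_onb :: "nat \<Rightarrow> (real^'n) set \<Rightarrow> real^'n \<Rightarrow> nat \<Rightarrow> real^'n" where
  "tangent_onb m M q =
     (SOME e. (\<forall>i<m. e i \<in> tangent_space m M q) \<and>
              (\<forall>i<m. \<forall>j<m. e i \<bullet> e j = (if i = j then 1 else 0)))"

definition sff_matrix :: "nat \<Rightarrow> (real^'n) set \<Rightarrow> real^'n \<Rightarrow> real^'n \<Rightarrow> nat \<Rightarrow> nat \<Rightarrow> real" where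
  "sff_matrix m M q v i j =
     second_fundamental_form m M q v (tangent_onb m M q i) (tangent_onb m M q j)"

definition psi :: "nat \<Rightarrow> (real^'n) set \<Rightarrow> real^'n \<Rightarrow> real^'n \<Rightarrow> nat \<Rightarrow> real" where
  "psi m M q v =
     (THE c. (\<forall>i>m. c i = 0) \<and>
       (\<forall>t. detm m (\<lambda>i j. (if i = j then 1 else 0) - t * sff_matrix m M q v i j)
             = (\<Sum>i\<le>m. t ^ i * c i)))"

section \<open>Hausdorff measure (normalised, = k-dimensional Riemannian volume on k-submanifolds)\<close>

definition unit_ball_vol :: "nat \<Rightarrow> real" where
  "unit_ball_vol k = pi powr (real k / 2) / Gamma (real k / 2 + 1)"

definition hausdorff_pre :: "nat \<Rightarrow> real \<Rightarrow> 'a::metric_space set \<Rightarrow> ennreal" where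
  "hausdorff_pre k \<delta> A =
     (INF C \<in> {C :: nat \<Rightarrow> 'a set. A \<subseteq> (\<Union>i. C i) \<and> (\<forall>i. bounded (C i) \<and> diameter (C i) \<le> \<delta>)}.
        (\<Sum>i. ennreal (if C i = {} then 0 else unit_ball_vol k * (diameter (C i) / 2) ^ k)))"

definition hausdorff_outer :: "nat \<Rightarrow> 'a::metric_space set \<Rightarrow> ennreal" where
  "hausdorff_outer k A = (SUP \<delta> \<in> {0<..}. hausdorff_pre k \<delta> A)"

definition hausdorff_measure :: "nat \<Rightarrow> 'a::metric_space measure" where
  "hausdorff_measure k = measure_of UNIV (sets borel) (hausdorff_outer k)"

text \<open>|K_i|(U) = integral over S(NU) of |psi_i|, where the volume on S(NU) is locally the product
  of the volume of U and the standard volume of the unit sphere S^{s-1} of the normal fibre.\<close>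
definition abs_curv :: "nat \<Rightarrow> (real^'n) set \<Rightarrow> nat \<Rightarrow> (real^'n) set \<Rightarrow> ennreal" where
  "abs_curv m M i U =
     (\<integral>\<^sup>+ q \<in> U.
        (\<integral>\<^sup>+ v \<in> unit_normal_sphere m M q. ennreal \<bar>psi m M q v i\<bar>
            \<partial>(hausdorff_measure (CARD('n) - m - 1)))
      \<partial>(hausdorff_measure m))"

end

theory Submission imports Defs begin

text \<open>In a chart straightening \<open>M\<close> onto a coordinate subspace, the tube is the image of a piece of
  the normal bundle under \<open>(q, w) \<mapsto> q + w\<close>, whose Jacobian is the Jacobian of the parametrisation of
  \<open>M\<close> times that of the normal fibre times \<open>det (Id - S(w))\<close>. Change of variables, the triangle
  inequality \<open>\<bar>det (Id - S(w))\<bar> \<le> (\<Sum>i. \<bar>\<psi>\<^sub>i(w)\<bar>)\<close> and polar coordinates in the fibre bound the volume of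
  the tube by integrals with respect to Lebesgue measure in the parameters. It remains to bound
  these from above by integrals with respect to the Hausdorff measures of \<open>M\<close> and of the normal
  spheres. By the definition through coverings it suffices that the image of the parameter measure
  gives small sets of diameter \<open>d\<close> at most \<open>1 + \<eta>\<close> times the volume of a ball of diameter \<open>d\<close>. This
  is the isodiametric inequality, applied in the nearly isometric linearisation of the
  parametrisation.\<close>

section \<open>Hausdorff measure\<close>

text \<open>Two features of the statement shape the proof. First, neither the tube nor the inner
  integral of \<open>abs_curv\<close>, as a function of the base point, is known to be measurable.
  The tube is therefore enclosed in Borel sets, and the inner integral is only compared pointwise
  with a measurable function below it; this suffices because \<open>nn_integral\<close> of an
  arbitrary function is the supremum over the simple functions below it. Second, \<open>psi\<close>
  is built from \<open>tangent_onb\<close>, a choice made separately at each point, so measurable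
  dependence on the base point cannot be read off from \<open>sff_matrix\<close>. It is recovered in
  a chart, where the \<psi>_i are the coefficients of a polynomial in t whose values are quotients
  of continuous Jacobians. The constant \<epsilon>^(s+i)/(s+i), with s = n - m, is the integral of
  r^(s+i-1) from 0 to \<epsilon>: s - 1 powers of r come from the spheres of radius r in the normal
  space, i powers from the homogeneity of \<psi>_i.\<close>

definition hausdorff_cost :: "nat \<Rightarrow> 'a::metric_space set \<Rightarrow> ennreal" where
  "hausdorff_cost k C = ennreal (if C = {} then 0 else unit_ball_vol k * (diameter C / 2) ^ k)"

text \<open>The case distinction in the cost matters for \<open>k = 0\<close>: the empty set has
  diameter 0 and \<open>0 ^ 0 = 1\<close>, so padding a covering with empty sets would otherwise
  cost \<open>unit_ball_vol 0 = 1\<close> per set.\<close>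

lemma hausdorff_cost_empty [simp]: "hausdorff_cost k {} = 0"
  by (simp add: hausdorff_cost_def)

lemma unit_ball_vol_nonneg [simp]: "unit_ball_vol k \<ge> 0"
  by (auto simp: unit_ball_vol_def intro!: divide_nonneg_pos Gamma_real_pos)

lemma hausdorff_pre_le:
  assumes "A \<subseteq> (\<Union>i. C i)" "\<And>i. bounded (C i)" "\<And>i. diameter (C i) \<le> d"
  shows "hausdorff_pre k d A \<le> (\<Sum>i. hausdorff_cost k (C i))"
  unfolding hausdorff_pre_def hausdorff_cost_def
  by (rule INF_lower) (use assms in auto)

lemma hausdorff_pre_greatest:
  assumes "\<And>C. A \<subseteq> (\<Union>i. C i) \<Longrightarrow> (\<And>i. bounded (C i)) \<Longrightarrow> (\<And>i. diameter (C i) \<le> d)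
             \<Longrightarrow> c \<le> (\<Sum>i. hausdorff_cost k (C i))"
  shows "c \<le> hausdorff_pre k d A"
  unfolding hausdorff_pre_def
  by (rule INF_greatest) (use assms in \<open>auto simp: hausdorff_cost_def\<close>)

lemma hausdorff_pre_less:
  assumes "hausdorff_pre k d A < c"
  obtains C where "A \<subseteq> (\<Union>i. C i)" "\<And>i. bounded (C i)" "\<And>i. diameter (C i) \<le> d"
    "(\<Sum>i. hausdorff_cost k (C i)) < c"
  using hausdorff_pre_greatest[of A d c k] assms by (metis not_le)

lemma hausdorff_pre_mono: "A \<subseteq> B \<Longrightarrow> hausdorff_pre k d A \<le> hausdorff_pre k d B"
  by (intro hausdorff_pre_greatest hausdorff_pre_le) auto

lemma hausdorff_pre_antimono: "d \<le> d' \<Longrightarrow> hausdorff_pre k d' A \<le> hausdorff_pre k d A"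
  by (rule hausdorff_pre_greatest) (rule hausdorff_pre_le, auto intro: order_trans)

lemma hausdorff_pre_empty: "d \<ge> 0 \<Longrightarrow> hausdorff_pre k d {} = 0"
  using hausdorff_pre_le[of "{}" "\<lambda>_. {}" d k] by (simp add: diameter_empty)

text \<open>Coverings of the sets \<open>A n\<close>, each optimal up to e/2^(n+1), are merged into
  a single sequence by \<open>prod_decode\<close>; the errors add up to e.\<close>

lemma hausdorff_pre_countably_subadditive:
  fixes A :: "nat \<Rightarrow> 'a::metric_space set"
  shows "hausdorff_pre k d (\<Union>n. A n) \<le> (\<Sum>n. hausdorff_pre k d (A n))"
proof (rule ennreal_le_epsilon)
  fix e :: real assume e: "e > 0" and fin: "(\<Sum>n. hausdorff_pre k d (A n)) < top"
  have "\<exists>C. A n \<subseteq> (\<Union>i. C i) \<and> (\<forall>i. bounded (C i)) \<and> (\<forall>i. diameter (C i) \<le> d) \<and>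
     (\<Sum>i. hausdorff_cost k (C i)) \<le> hausdorff_pre k d (A n) + ennreal (e * (1/2) ^ Suc n)" for n
  proof -
    have "hausdorff_pre k d (A n) < top"
      using fin by (metis ennreal_suminf_lessD)
    then have "hausdorff_pre k d (A n) < hausdorff_pre k d (A n) + ennreal (e * (1/2) ^ Suc n)"
      using e by (simp add: ennreal_add_left_cancel_less[of _ 0, simplified])
    then show ?thesis by (elim hausdorff_pre_less) (auto intro: less_imp_le)
  qed
  then obtain C where C: "\<And>n. A n \<subseteq> (\<Union>i. C n i)" "\<And>n i. bounded (C n i)"
    "\<And>n i. diameter (C n i) \<le> d"
    "\<And>n. (\<Sum>i. hausdorff_cost k (C n i)) \<le> hausdorff_pre k d (A n) + ennreal (e * (1/2) ^ Suc n)"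
    by metis
  define D where "D j = (case prod_decode j of (n, i) \<Rightarrow> C n i)" for j
  have sub: "(\<Union>n. A n) \<subseteq> (\<Union>j. D j)"
  proof
    fix x assume "x \<in> (\<Union>n. A n)"
    then obtain n i where "x \<in> C n i" using C(1) by blast
    then have "x \<in> D (prod_encode (n, i))" by (simp add: D_def)
    then show "x \<in> (\<Union>j. D j)" by blast
  qed
  have "hausdorff_pre k d (\<Union>n. A n) \<le> (\<Sum>j. hausdorff_cost k (D j))"
    by (intro hausdorff_pre_le sub) (auto simp: D_def C split: prod.splits)
  also have "\<dots> = (\<Sum>j. (\<lambda>(n,i). hausdorff_cost k (C n i)) (prod_decode j))"
    by (simp add: D_def case_prod_unfold)
  also have "\<dots> = (\<Sum>n. \<Sum>i. hausdorff_cost k (C n i))"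
    by (rule suminf_ennreal_2dimen[where f="\<lambda>(n,i). hausdorff_cost k (C n i)", unfolded o_def]) simp
  also have "\<dots> \<le> (\<Sum>n. hausdorff_pre k d (A n) + ennreal (e * (1/2) ^ Suc n))"
    by (intro suminf_le C) auto
  also have "\<dots> = (\<Sum>n. hausdorff_pre k d (A n)) + (\<Sum>n. ennreal (e * (1/2) ^ Suc n))"
    by (rule suminf_add[symmetric]) auto
  also have "(\<Sum>n. ennreal (e * (1/2) ^ Suc n)) = ennreal e"
  proof (rule suminf_ennreal_eq)
    show "(\<lambda>n. e * (1/2) ^ Suc n) sums e"
      using sums_mult[OF power_half_series, of e] by simp
  qed (use e in auto)
  finally show "hausdorff_pre k d (\<Union>n. A n) \<le> (\<Sum>n. hausdorff_pre k d (A n)) + ennreal e" .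
qed

lemma hausdorff_pre_le_outer: "d > 0 \<Longrightarrow> hausdorff_pre k d A \<le> hausdorff_outer k A"
  unfolding hausdorff_outer_def by (rule SUP_upper) simp

lemma hausdorff_outer_mono: "A \<subseteq> B \<Longrightarrow> hausdorff_outer k A \<le> hausdorff_outer k B"
  unfolding hausdorff_outer_def by (rule SUP_mono) (auto intro: hausdorff_pre_mono)

lemma hausdorff_outer_empty [simp]: "hausdorff_outer k {} = 0"
proof -
  have "hausdorff_outer k {} \<le> (0::ennreal)"
    unfolding hausdorff_outer_def by (rule SUP_least) (simp add: hausdorff_pre_empty)
  then show ?thesis by simp
qed

lemma hausdorff_outer_countably_subadditive:
  "hausdorff_outer k (\<Union>n. A n) \<le> (\<Sum>n. hausdorff_outer k (A n))"
  unfolding hausdorff_outer_def[of k "\<Union>n. A n"]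
proof (rule SUP_least)
  fix d :: real assume "d \<in> {0<..}"
  then have "(\<Sum>n. hausdorff_pre k d (A n)) \<le> (\<Sum>n. hausdorff_outer k (A n))"
    by (intro suminf_le hausdorff_pre_le_outer) auto
  then show "hausdorff_pre k d (\<Union>n. A n) \<le> (\<Sum>n. hausdorff_outer k (A n))"
    using hausdorff_pre_countably_subadditive order_trans by blast
qed

section \<open>Caratheodory measurability of Borel sets\<close>

lemma hausdorff_outer_measure_space:
  "outer_measure_space UNIV (hausdorff_outer k)"
  by (auto simp: outer_measure_space_def positive_def increasing_def countably_subadditive_def
      intro: hausdorff_outer_mono hausdorff_outer_countably_subadditive)

lemma hausdorff_outer_subadditive:
  "hausdorff_outer k (A \<union> B) \<le> hausdorff_outer k A + hausdorff_outer k B"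
proof -
  have "(\<Union>n. (case n of 0 \<Rightarrow> A | Suc 0 \<Rightarrow> B | _ \<Rightarrow> {})) = A \<union> B"
    by (auto split: nat.splits)
  moreover have "(\<Sum>n. hausdorff_outer k (case n of 0 \<Rightarrow> A | Suc 0 \<Rightarrow> B | _ \<Rightarrow> {}))
      = (\<Sum>n<2. hausdorff_outer k (case n of 0 \<Rightarrow> A | Suc 0 \<Rightarrow> B | _ \<Rightarrow> {}))"
    by (intro suminf_finite) (auto split: nat.splits simp: numeral_2_eq_2 less_Suc_eq)
  ultimately show ?thesis
    using hausdorff_outer_countably_subadditive[of k "\<lambda>n. (case n of 0 \<Rightarrow> A | Suc 0 \<Rightarrow> B | _ \<Rightarrow> {})"]
    by (simp add: numeral_2_eq_2)
qed

text \<open>A set of diameter at most d cannot meet both A and B, so every covering of the union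
  splits into coverings of A and of B whose costs together do not exceed the given one.\<close>

lemma hausdorff_pre_separated:
  fixes A B :: "'a::metric_space set"
  assumes sep: "\<And>x y. x \<in> A \<Longrightarrow> y \<in> B \<Longrightarrow> d < dist x y"
  shows "hausdorff_pre k d A + hausdorff_pre k d B \<le> hausdorff_pre k d (A \<union> B)"
proof (rule hausdorff_pre_greatest)
  fix C :: "nat \<Rightarrow> 'a set"
  assume C: "A \<union> B \<subseteq> (\<Union>i. C i)" "\<And>i. bounded (C i)" "\<And>i. diameter (C i) \<le> d"
  define CA where "CA i = (if C i \<inter> A = {} then {} else C i)" for i
  define CB where "CB i = (if C i \<inter> B = {} then {} else C i)" for i
  \<comment> \<open>Some covering set has diameter between 0 and d, so d is nonnegative and the
    empty set may replace the covering sets that are dropped.\<close>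
  have diam0: "0 \<le> d" using C(3)[of 0] diameter_ge_0[OF C(2)[of 0]] by linarith
  have "hausdorff_pre k d A \<le> (\<Sum>i. hausdorff_cost k (CA i))"
    by (rule hausdorff_pre_le) (use C diam0 in \<open>fastforce simp: CA_def diameter_empty\<close>)+
  moreover have "hausdorff_pre k d B \<le> (\<Sum>i. hausdorff_cost k (CB i))"
    by (rule hausdorff_pre_le) (use C diam0 in \<open>fastforce simp: CB_def diameter_empty\<close>)+
  ultimately have "hausdorff_pre k d A + hausdorff_pre k d B
      \<le> (\<Sum>i. hausdorff_cost k (CA i)) + (\<Sum>i. hausdorff_cost k (CB i))"
    by (rule add_mono)
  also have "\<dots> = (\<Sum>i. hausdorff_cost k (CA i) + hausdorff_cost k (CB i))"
    by (rule suminf_add) auto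
  also have "\<dots> \<le> (\<Sum>i. hausdorff_cost k (C i))"
  proof (intro suminf_le)
    fix i
    have "C i \<inter> A = {} \<or> C i \<inter> B = {}"
    proof (rule ccontr)
      assume "\<not> ?thesis"
      then obtain x y where "x \<in> C i" "x \<in> A" "y \<in> C i" "y \<in> B" by blast
      with sep[of x y] diameter_bounded_bound[OF C(2)[of i], of x y] C(3)[of i]
      show False by force
    qed
    then show "hausdorff_cost k (CA i) + hausdorff_cost k (CB i) \<le> hausdorff_cost k (C i)"
      by (auto simp: CA_def CB_def)
  qed auto
  finally show "hausdorff_pre k d A + hausdorff_pre k d B \<le> (\<Sum>i. hausdorff_cost k (C i))" .
qed

text \<open>The suprema over scales for A and for B are independent of each other, hence the
  auxiliary bound with two scales a and b; both are lowered to one scale below the separation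
  r.\<close>

lemma hausdorff_outer_separated:
  fixes A B :: "'a::metric_space set"
  assumes r: "r > 0" and sep: "\<And>x y. x \<in> A \<Longrightarrow> y \<in> B \<Longrightarrow> r \<le> dist x y"
  shows "hausdorff_outer k A + hausdorff_outer k B \<le> hausdorff_outer k (A \<union> B)"
proof -
  have *: "hausdorff_pre k a A + hausdorff_pre k b B \<le> hausdorff_outer k (A \<union> B)"
    if "a > 0" "b > 0" for a b
  proof -
    define d where "d = min (min a b) (r / 2)"
    have d: "d > 0" "d \<le> a" "d \<le> b" "d < r" using that r by (auto simp: d_def)
    have "hausdorff_pre k a A + hausdorff_pre k b B \<le> hausdorff_pre k d A + hausdorff_pre k d B"
      by (intro add_mono hausdorff_pre_antimono d)
    also have "\<dots> \<le> hausdorff_pre k d (A \<union> B)"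
      using sep d(4) by (intro hausdorff_pre_separated) force
    also have "\<dots> \<le> hausdorff_outer k (A \<union> B)" by (rule hausdorff_pre_le_outer) fact
    finally show ?thesis .
  qed
  have "hausdorff_outer k A + hausdorff_pre k b B \<le> hausdorff_outer k (A \<union> B)" if "b > 0" for b
    unfolding hausdorff_outer_def[of k A]
    by (subst ennreal_SUP_add_left[symmetric]) (auto intro!: SUP_least * that)
  then have "(SUP b\<in>{0<..}. hausdorff_outer k A + hausdorff_pre k b B) \<le> hausdorff_outer k (A \<union> B)"
    by (intro SUP_least) auto
  then show ?thesis
    unfolding hausdorff_outer_def[of k B] using ennreal_SUP_add_right[of "{0<..}" "hausdorff_outer k A" "\<lambda>b. hausdorff_pre k b B"] by simp
qed

text \<open>Caratheodory's criterion for metric outer measures. The part \<open>Z n\<close> of X at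
  distance more than 1/(n+1) from F is separated from F, so additivity holds for it. What is missing
  from X - F is a tail of the shells \<open>Y i\<close>, and the tails tend to 0 because the shell
  measures have a finite sum.\<close>

lemma closed_in_lambda_system:
  fixes F :: "'a::metric_space set"
  assumes F: "closed F"
  shows "F \<in> lambda_system UNIV UNIV (hausdorff_outer k)"
proof -
  let ?f = "hausdorff_outer k"
  have main: "?f (X \<inter> F) + ?f (X - F) \<le> ?f X" if ne: "F \<noteq> {}" and fin: "?f X < top" for X
  proof -
    define Z where "Z n = {x \<in> X. 1 / real (Suc n) < infdist x F}" for n
    define Y where "Y n = Z (Suc n) - Z n" for n
    have Zsub: "Z n \<subseteq> X" for n by (auto simp: Z_def)
    have Z0: "infdist x F = 0" if "x \<in> F" for x using that by simp
    have sepZ: "1 / real (Suc n) \<le> dist x y" if "x \<in> X \<inter> F" "y \<in> Z n" for x y n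
      using infdist_le[of x F y] that by (auto simp: Z_def dist_commute)
    have ZF: "?f (X \<inter> F) + ?f (Z n) \<le> ?f X" for n
    proof -
      have "?f (X \<inter> F) + ?f (Z n) \<le> ?f (X \<inter> F \<union> Z n)"
        by (rule hausdorff_outer_separated[of "1 / real (Suc n)"]) (simp, erule (1) sepZ)
      also have "\<dots> \<le> ?f X" by (rule hausdorff_outer_mono) (auto simp: Z_def)
      finally show ?thesis .
    qed
    \<comment> \<open>Shells of equal parity are separated from each other by a shell in between, so
      their measures add up inside X. The parity p is 0 or 1 below.\<close>
    have sumY: "(\<Sum>i<N. ?f (Y (2*i+p))) \<le> ?f (\<Union>i<N. Y (2*i+p))" for N p
    proof (induction N)
      case (Suc N)
      have eq: "(\<Union>i<Suc N. Y (2*i+p)) = (\<Union>i<N. Y (2*i+p)) \<union> Y (2*N+p)"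
        by (auto simp: less_Suc_eq)
      have "?f (\<Union>i<N. Y (2*i+p)) + ?f (Y (2*N+p)) \<le> ?f (\<Union>i<Suc N. Y (2*i+p))"
      proof (cases "N = 0")
        case False
        show ?thesis
          unfolding eq
        proof (rule hausdorff_outer_separated[of "1 / real (2*N+p) - 1 / real (2*N+p+1)"])
          show "0 < 1 / real (2*N+p) - 1 / real (2*N+p+1)"
            using False by (simp only: diff_gt_0_iff_gt, intro divide_strict_left_mono) auto
          fix x y assume "x \<in> (\<Union>i<N. Y (2*i+p))" "y \<in> Y (2*N+p)"
          then obtain i where i: "i < N" "1 / real (Suc (Suc (2*i+p))) < infdist x F"
            and y: "infdist y F \<le> 1 / real (2*N+p+1)"
            by (auto simp: Y_def Z_def)
          have "1 / real (2*N+p) \<le> 1 / real (Suc (Suc (2*i+p)))"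
            using i by (intro divide_left_mono) auto
          then have "1 / real (2*N+p) \<le> infdist x F" using i by linarith
          with y infdist_triangle[of x F y]
          show "1 / real (2*N+p) - 1 / real (2*N+p+1) \<le> dist x y" by linarith
        qed
      qed (simp add: lessThan_Suc)
      with Suc show ?case
        by (metis (no_types, lifting) add_right_mono order_trans sum.lessThan_Suc)
    qed simp
    define S where "S = (\<Sum>n. ?f (Y n))"
    have YX: "?f (\<Union>i<N. Y (2*i+p)) \<le> ?f X" for N p
      by (rule hausdorff_outer_mono) (auto simp: Y_def Z_def)
    have "(\<Sum>i<n. ?f (Y i)) \<le> ?f X + ?f X" for n
    proof -
      have "(\<Sum>i<n. ?f (Y i)) \<le> (\<Sum>i<2*n. ?f (Y i))"
        by (rule sum_mono2) auto
      also have "\<dots> = (\<Sum>i<n. ?f (Y (2*i+0))) + (\<Sum>i<n. ?f (Y (2*i+1)))"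
        by (induction n) (simp_all add: ac_simps)
      also have "\<dots> \<le> ?f X + ?f X"
        by (intro add_mono order_trans[OF sumY YX])
      finally show ?thesis .
    qed
    then have "S \<le> ?f X + ?f X"
      unfolding S_def suminf_eq_SUP by (rule SUP_least)
    with fin have S: "S \<noteq> top" by (auto simp: top_unique)
    \<comment> \<open>The partial sum is added on the left instead of subtracting the tail on the
      right, which avoids differences in \<open>ennreal\<close>. In the limit both sides contain the
      finite S, which cancels.\<close>
    have bound: "?f (X \<inter> F) + ?f (X - F) + (\<Sum>i<n. ?f (Y i)) \<le> ?f X + S" for n
    proof -
      have "X - F \<subseteq> Z n \<union> (\<Union>i. Y (i + n))"
      proof
        fix x assume x: "x \<in> X - F"
        then have "infdist x F > 0"
          using in_closed_iff_infdist_zero[OF F ne, of x] infdist_nonneg[of x F] by force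
        then obtain j where "inverse (real (Suc j)) < infdist x F"
          using reals_Archimedean by blast
        then have ex: "\<exists>j. x \<in> Z j" using x by (auto simp: Z_def inverse_eq_divide)
        define j where "j = (LEAST j. x \<in> Z j)"
        have j: "x \<in> Z j" unfolding j_def using ex by (rule LeastI_ex)
        show "x \<in> Z n \<union> (\<Union>i. Y (i + n))"
        proof (cases "j \<le> n")
          case True
          have "1 / real (Suc n) \<le> 1 / real (Suc j)" using True by (intro divide_left_mono) auto
          then show ?thesis using j by (auto simp: Z_def)
        next
          case False
          then obtain i where i: "j = Suc (i + n)"
            by (metis add.commute less_imp_Suc_add not_le)
          have "x \<notin> Z (i + n)" using i not_less_Least[of "i + n" "\<lambda>j. x \<in> Z j"]
            by (simp add: j_def)
          then have "x \<in> Y (i + n)" using j i by (simp add: Y_def)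
          then show ?thesis by blast
        qed
      qed
      then have "?f (X - F) \<le> ?f (Z n \<union> (\<Union>i. Y (i + n)))" by (rule hausdorff_outer_mono)
      also have "\<dots> \<le> ?f (Z n) + ?f (\<Union>i. Y (i + n))" by (rule hausdorff_outer_subadditive)
      also have "\<dots> \<le> ?f (Z n) + (\<Sum>i. ?f (Y (i + n)))"
        by (intro add_left_mono hausdorff_outer_countably_subadditive)
      finally have 1: "?f (X - F) \<le> ?f (Z n) + (\<Sum>i. ?f (Y (i + n)))" .
      have "?f (X \<inter> F) + ?f (X - F) + (\<Sum>i<n. ?f (Y i))
          \<le> ?f (X \<inter> F) + (?f (Z n) + (\<Sum>i. ?f (Y (i + n)))) + (\<Sum>i<n. ?f (Y i))"
        by (intro add_mono 1 order_refl)
      also have "\<dots> = (?f (X \<inter> F) + ?f (Z n)) + ((\<Sum>i. ?f (Y (i + n))) + (\<Sum>i<n. ?f (Y i)))"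
        by (simp add: ac_simps)
      also have "(\<Sum>i. ?f (Y (i + n))) + (\<Sum>i<n. ?f (Y i)) = S"
        unfolding S_def by (rule suminf_offset[symmetric]) simp
      also have "(?f (X \<inter> F) + ?f (Z n)) + S \<le> ?f X + S"
        by (intro add_right_mono ZF)
      finally show ?thesis .
    qed
    have "?f (X \<inter> F) + ?f (X - F) + S \<le> ?f X + S"
    proof -
      have "?f (X \<inter> F) + ?f (X - F) + S = (SUP n. ?f (X \<inter> F) + ?f (X - F) + (\<Sum>i<n. ?f (Y i)))"
        unfolding S_def suminf_eq_SUP by (rule ennreal_SUP_add_right) simp
      also have "\<dots> \<le> ?f X + S" by (intro SUP_least bound)
      finally show ?thesis .
    qed
    then show ?thesis
      using S by (simp add: add.commute[of _ S] ennreal_add_left_cancel_le)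
  qed
  have "?f (X \<inter> F) + ?f (X - F) = ?f X" for X
  proof (rule antisym)
    show "?f (X \<inter> F) + ?f (X - F) \<le> ?f X"
    proof (cases "F = {} \<or> ?f X = top")
      case False
      then show ?thesis by (intro main) (auto simp: less_top)
    qed auto
    have "?f X = ?f ((X \<inter> F) \<union> (X - F))" by (rule arg_cong[of _ _ ?f]) auto
    also have "\<dots> \<le> ?f (X \<inter> F) + ?f (X - F)" by (rule hausdorff_outer_subadditive)
    finally show "?f X \<le> ?f (X \<inter> F) + ?f (X - F)" .
  qed
  then show ?thesis
    by (auto simp: lambda_system_def Int_commute Diff_eq)
qed

lemma sets_hausdorff_measure [simp, measurable_cong]:
  "sets (hausdorff_measure k) = sets borel"
  using sets.sigma_sets_eq[of borel] by (simp add: hausdorff_measure_def sets_measure_of_conv)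

text \<open>\<open>measure_of\<close> returns the prescribed function only if it is a measure on the
  given sigma-algebra. Caratheodory's theorem provides this on the lambda system, which contains the
  closed sets and hence all Borel sets.\<close>

lemma emeasure_hausdorff_measure:
  fixes A :: "'a::metric_space set"
  assumes A: "A \<in> sets borel"
  shows "emeasure (hausdorff_measure k) A = hausdorff_outer k A"
proof -
  let ?f = "hausdorff_outer k :: 'a set \<Rightarrow> ennreal"
  let ?L = "lambda_system UNIV UNIV ?f"
  have "sigma_algebra (UNIV::'a set) UNIV"
    using sigma_algebra_Pow[of "UNIV::'a set"] by simp
  then have ms: "measure_space UNIV ?L ?f"
    by (rule sigma_algebra.caratheodory_lemma) (rule hausdorff_outer_measure_space)
  then have L: "sigma_algebra UNIV ?L" "countably_additive ?L ?f"
    by (auto simp: measure_space_def)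
  have "sets (borel::'a measure) = sigma_sets UNIV (Collect closed)"
    by (simp add: borel_eq_closed)
  also have "\<dots> \<subseteq> ?L"
    by (rule sigma_algebra.sigma_sets_subset[OF L(1)]) (auto intro: closed_in_lambda_system)
  finally have sub: "sets borel \<subseteq> ?L" .
  have "countably_additive (sets borel) ?f"
    using L(2) sub unfolding countably_additive_def by blast
  then show ?thesis
    unfolding hausdorff_measure_def
    by (intro emeasure_measure_of_sigma)
       (use A sets.sigma_algebra_axioms[of "borel::'a measure"] in
          \<open>auto simp: positive_def\<close>)
qed

section \<open>Comparison of a Borel measure with Hausdorff measure\<close>

lemma ennreal_le_if_scaled:
  fixes a b :: ennreal
  assumes "\<And>c::real. c > 1 \<Longrightarrow> a \<le> ennreal c * b"
  shows "a \<le> b"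
proof (cases "b = top")
  case False
  show ?thesis
  proof (rule ennreal_le_epsilon)
    fix e :: real assume e: "e > 0"
    obtain r where r: "b = ennreal r" "r \<ge> 0" using False by (cases b) auto
    \<comment> \<open>Dividing by r + 1 instead of r also covers the case b = 0.\<close>
    have "a \<le> ennreal (1 + e / (r + 1)) * b" using e r by (intro assms) simp
    also have "\<dots> = ennreal ((1 + e / (r + 1)) * r)"
      using r e by (simp add: ennreal_mult)
    also have "\<dots> \<le> ennreal (r + e)"
    proof (rule ennreal_leI)
      have "e / (r + 1) * r \<le> e" using r e by (simp add: field_simps)
      then show "(1 + e / (r + 1)) * r \<le> r + e" by (simp add: algebra_simps)
    qed
    finally show "a \<le> b + ennreal e" using r e by simp
  qed
qed auto

text \<open>The sets of a covering are arbitrary, whereas \<open>bound\<close> speaks of Borel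
  subsets of A. Intersecting A with their closures gives such sets without increasing the
  diameters.\<close>

lemma emeasure_le_hausdorff_outer:
  fixes \<nu> :: "'a::metric_space measure"
  assumes [measurable_cong]: "sets \<nu> = sets borel" and A[measurable]: "A \<in> sets borel" and c: "c \<ge> 0"
    and bound: "\<And>C. C \<in> sets borel \<Longrightarrow> C \<noteq> {} \<Longrightarrow> bounded C \<Longrightarrow> C \<subseteq> A \<Longrightarrow>
      emeasure \<nu> C \<le> ennreal (c * (unit_ball_vol k * (diameter C / 2) ^ k))"
  shows "emeasure \<nu> A \<le> ennreal c * hausdorff_outer k A"
proof -
  have "emeasure \<nu> A \<le> ennreal c * (\<Sum>i. hausdorff_cost k (C i))"
    if C: "A \<subseteq> (\<Union>i. C i)" "\<And>i. bounded (C i)" for C :: "nat \<Rightarrow> 'a set"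
  proof -
    have "emeasure \<nu> A = emeasure \<nu> (\<Union>i. A \<inter> closure (C i))"
      using C(1) closure_subset by (intro arg_cong2[of _ _ _ _ emeasure] refl) blast
    also have "\<dots> \<le> (\<Sum>i. emeasure \<nu> (A \<inter> closure (C i)))"
      by (rule emeasure_subadditive_countably) (auto simp: assms(1))
    also have "\<dots> \<le> (\<Sum>i. ennreal c * hausdorff_cost k (C i))"
    proof (intro suminf_le)
      fix i
      show "emeasure \<nu> (A \<inter> closure (C i)) \<le> ennreal c * hausdorff_cost k (C i)"
      proof (cases "A \<inter> closure (C i) = {}")
        case False
        then have ne: "C i \<noteq> {}" by auto
        have bd: "bounded (closure (C i))" by (rule bounded_closure) (rule C(2))
        have "emeasure \<nu> (A \<inter> closure (C i))
            \<le> ennreal (c * (unit_ball_vol k * (diameter (A \<inter> closure (C i)) / 2) ^ k))"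
          using False bd by (intro bound) (auto intro: bounded_subset)
        also have "\<dots> \<le> ennreal (c * (unit_ball_vol k * (diameter (C i) / 2) ^ k))"
        proof (intro ennreal_leI mult_left_mono power_mono divide_right_mono c unit_ball_vol_nonneg)
          have "diameter (A \<inter> closure (C i)) \<le> diameter (closure (C i))"
            by (rule diameter_subset[OF _ bd]) auto
          then show "diameter (A \<inter> closure (C i)) \<le> diameter (C i)"
            by (simp add: diameter_closure C(2))
          show "0 \<le> diameter (A \<inter> closure (C i)) / 2"
            using bd by (auto intro!: diameter_ge_0 intro: bounded_subset)
        qed auto
        also have "\<dots> = ennreal c * hausdorff_cost k (C i)"
          using ne c by (simp add: hausdorff_cost_def ennreal_mult')
        finally show ?thesis .
      qed simp
    qed auto
    also have "\<dots> = ennreal c * (\<Sum>i. hausdorff_cost k (C i))" by (rule ennreal_suminf_cmult)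
    finally show ?thesis .
  qed
  note * = this
  have "emeasure \<nu> A \<le> ennreal c * hausdorff_pre k 1 A"
  \<comment> \<open>The general argument divides by c. For c = 0 the estimate above is applied to a
    covering by bounded pieces of A instead.\<close>
  proof (cases "c = 0")
    case True
    show ?thesis
    proof -
      have "emeasure \<nu> A \<le> ennreal c * (\<Sum>i. hausdorff_cost k (A \<inter> cball undefined (real i)))"
        by (rule *) (auto simp: real_arch_simple)
      then show ?thesis using True by simp
    qed
  next
    case False
    then have c0: "c > 0" using c by simp
    have "emeasure \<nu> A / ennreal c \<le> hausdorff_pre k 1 A"
    proof (rule hausdorff_pre_greatest)
      fix C :: "nat \<Rightarrow> 'a set"
      assume "A \<subseteq> (\<Union>i. C i)" "\<And>i. bounded (C i)"
      from *[OF this] show "emeasure \<nu> A / ennreal c \<le> (\<Sum>i. hausdorff_cost k (C i))"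
        using c0 by (subst divide_le_posI_ennreal) (auto simp: mult.commute)
    qed
    then have "ennreal c * (emeasure \<nu> A / ennreal c) \<le> ennreal c * hausdorff_pre k 1 A"
      by (rule mult_left_mono) simp
    moreover have "ennreal c * (emeasure \<nu> A / ennreal c) = emeasure \<nu> A"
      using c0 by (metis divide_ennreal_def ennreal_less_top ennreal_eq_0_iff ennreal_mult_divide_eq
          ennreal_times_divide mult.commute not_le order_less_irrefl top.not_eq_extremum)
    ultimately show ?thesis by simp
  qed
  also have "\<dots> \<le> ennreal c * hausdorff_outer k A"
    by (intro mult_left_mono hausdorff_pre_le_outer) auto
  finally show ?thesis .
qed

text \<open>Only a local bound with a factor e > 1 is required, at a radius depending on the point
  and on e. Lindelof's theorem leaves countably many balls, which are made disjoint so that both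
  measures add up, and e tends to 1 at the end. Both the normal spheres and the submanifold are
  compared with Hausdorff measure through this lemma.\<close>

lemma emeasure_le_hausdorff_measure:
  fixes \<nu> :: "'a::{metric_space, second_countable_topology} measure"
  assumes [measurable_cong]: "sets \<nu> = sets borel" and A[measurable]: "A \<in> sets borel"
    and bound: "\<And>x e. x \<in> A \<Longrightarrow> e > 1 \<Longrightarrow> \<exists>r>0. \<forall>C. C \<in> sets borel \<longrightarrow> C \<noteq> {} \<longrightarrow> C \<subseteq> A \<inter> ball x r \<longrightarrow>
      emeasure \<nu> C \<le> ennreal (e * (unit_ball_vol k * (diameter C / 2) ^ k))"
  shows "emeasure \<nu> A \<le> emeasure (hausdorff_measure k) A"
proof (rule ennreal_le_if_scaled)
  fix e :: real assume e: "e > 1"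
  obtain r where r: "\<And>x. x \<in> A \<Longrightarrow> r x > 0"
    "\<And>x C. x \<in> A \<Longrightarrow> C \<in> sets borel \<Longrightarrow> C \<noteq> {} \<Longrightarrow> C \<subseteq> A \<inter> ball x (r x) \<Longrightarrow>
      emeasure \<nu> C \<le> ennreal (e * (unit_ball_vol k * (diameter C / 2) ^ k))"
    using bound[OF _ e] by metis
  obtain \<F> where \<F>: "\<F> \<subseteq> (\<lambda>x. ball x (r x)) ` A" "countable \<F>"
      "\<Union>\<F> = \<Union>((\<lambda>x. ball x (r x)) ` A)"
    by (rule Lindelof[of "(\<lambda>x. ball x (r x)) ` A"]) auto
  have A_sub: "A \<subseteq> \<Union>\<F>" using \<F>(3) r(1) by auto
  show "emeasure \<nu> A \<le> ennreal e * emeasure (hausdorff_measure k) A"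
  proof (cases "A = {}")
    case False
    then have ne: "\<F> \<noteq> {}" using A_sub by auto
    define B where "B = from_nat_into \<F>"
    have B: "B n \<in> \<F>" for n unfolding B_def by (rule from_nat_into[OF ne])
    have rB: "range B = \<F>" unfolding B_def by (rule range_from_nat_into[OF ne \<F>(2)])
    have openB: "open (B n)" for n using B[of n] \<F>(1) by auto
    define D where "D n = A \<inter> disjointed B n" for n
    have DB: "D n \<subseteq> A \<inter> B n" for n using disjointed_subset[of B n] by (auto simp: D_def)
    have D[measurable]: "D n \<in> sets borel" for n
      unfolding D_def using openB by (auto simp: disjointed_def intro!: sets.Int A sets.Diff sets.finite_UN)
    have disj: "disjoint_family D"
      using disjoint_family_disjointed[of B] by (auto simp: D_def disjoint_family_on_def)
    have UN: "(\<Union>n. D n) = A"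
      using A_sub rB by (auto simp: D_def UN_disjointed_eq simp flip: Int_UN_distrib)
    have "emeasure \<nu> A = (\<Sum>n. emeasure \<nu> (D n))"
      unfolding UN[symmetric] by (rule suminf_emeasure[symmetric]) (auto simp: assms(1) disj)
    also have "\<dots> \<le> (\<Sum>n. ennreal e * emeasure (hausdorff_measure k) (D n))"
    proof (intro suminf_le)
      fix n
      obtain x where x: "x \<in> A" "B n = ball x (r x)" using B[of n] \<F>(1) by auto
      show "emeasure \<nu> (D n) \<le> ennreal e * emeasure (hausdorff_measure k) (D n)"
        unfolding emeasure_hausdorff_measure[OF D]
        using x DB[of n] e by (intro emeasure_le_hausdorff_outer assms(1) D r(2)) auto
    qed auto
    also have "\<dots> = ennreal e * (\<Sum>n. emeasure (hausdorff_measure k) (D n))"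
      by (rule ennreal_suminf_cmult)
    also have "(\<Sum>n. emeasure (hausdorff_measure k) (D n)) = emeasure (hausdorff_measure k) A"
      unfolding UN[symmetric] by (rule suminf_emeasure) (auto simp: disj)
    finally show ?thesis .
  qed simp
qed

section \<open>The isodiametric inequality\<close>

definition section_length :: "'i \<Rightarrow> ('i \<Rightarrow> real) set \<Rightarrow> ('i \<Rightarrow> real) \<Rightarrow> ennreal" where
  "section_length i A x = (\<integral>\<^sup>+t. indicator A (x(i := t)) \<partial>lborel)"

text \<open>The strict inequality excludes points over which the section of \<open>A\<close> is empty.\<close>
definition steiner :: "'i set \<Rightarrow> 'i \<Rightarrow> ('i \<Rightarrow> real) set \<Rightarrow> ('i \<Rightarrow> real) set" where
  "steiner I i A = {x \<in> space (Pi\<^sub>M I (\<lambda>_. lborel)). ennreal (2 * \<bar>x i\<bar>) < section_length i A x}"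

lemma measurable_section_length:
  assumes "i \<in> I" and A[measurable]: "A \<in> sets (Pi\<^sub>M I (\<lambda>_. lborel))"
  shows "section_length i A \<in> borel_measurable (Pi\<^sub>M I (\<lambda>_. lborel))"
proof -
  have [measurable]: "(\<lambda>(x, t). x(i := t)) \<in> Pi\<^sub>M I (\<lambda>_. lborel) \<Otimes>\<^sub>M lborel \<rightarrow>\<^sub>M Pi\<^sub>M I (\<lambda>_. lborel :: real measure)"
    unfolding case_prod_beta
    by (rule measurable_fun_upd[where J=I]) (use assms(1) in auto)
  have "(\<lambda>(x, t). indicator A (x(i := t)) :: ennreal)
      \<in> borel_measurable (Pi\<^sub>M I (\<lambda>_. lborel) \<Otimes>\<^sub>M lborel)"
    using measurable_compose[OF \<open>(\<lambda>(x, t). x(i := t)) \<in> _\<close> borel_measurable_indicator[OF A]]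
    by (simp add: case_prod_unfold)
  then show ?thesis
    unfolding section_length_def
    using lborel.borel_measurable_nn_integral by fastforce
qed

lemma steiner_measurable:
  assumes "i \<in> I" "A \<in> sets (Pi\<^sub>M I (\<lambda>_. lborel))"
  shows "steiner I i A \<in> sets (Pi\<^sub>M I (\<lambda>_. lborel))"
proof -
  note measurable_section_length[OF assms, measurable]
  have [measurable]: "(\<lambda>x. x i) \<in> borel_measurable (Pi\<^sub>M I (\<lambda>_. lborel :: real measure))"
    using measurable_component_singleton[OF assms(1), of "\<lambda>_. lborel :: real measure"] by simp
  show ?thesis unfolding steiner_def by measurable
qed

lemma section_length_upd [simp]: "section_length i A (x(i := s)) = section_length i A x"
  by (simp add: section_length_def)

lemma emeasure_interval_abs: "(\<integral>\<^sup>+t. indicator {t. ennreal (2 * \<bar>t\<bar>) < l} t \<partial>lborel) = l"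
proof (cases l)
  case (real r)
  have "{t. ennreal (2 * \<bar>t\<bar>) < l} = {-(r/2)<..<r/2}"
    using real by (auto simp: ennreal_less_iff)
  then show ?thesis using real by simp
next
  case top
  then have "{t. ennreal (2 * \<bar>t\<bar>) < l} = UNIV" by auto
  then show ?thesis using top by simp
qed

text \<open>Fubini in direction i: over every base point the section is replaced by an open interval
  of the same length centred at 0.\<close>

lemma emeasure_steiner:
  assumes I: "finite I" and i: "i \<in> I" and A[measurable]: "A \<in> sets (Pi\<^sub>M I (\<lambda>_. lborel))"
  shows "emeasure (Pi\<^sub>M I (\<lambda>_. lborel)) (steiner I i A) = emeasure (Pi\<^sub>M I (\<lambda>_. lborel)) A"
proof -
  interpret product_sigma_finite "\<lambda>_. lborel :: real measure" ..
  define K where "K = I - {i}"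
  have K: "I = insert i K" "finite K" "i \<notin> K" using I i by (auto simp: K_def)
  note st = steiner_measurable[OF i A]
  have rep: "emeasure (Pi\<^sub>M I (\<lambda>_. lborel)) B
      = (\<integral>\<^sup>+x. section_length i B x \<partial>Pi\<^sub>M K (\<lambda>_. lborel))"
    if B: "B \<in> sets (Pi\<^sub>M I (\<lambda>_. lborel))" for B
  proof -
    have "emeasure (Pi\<^sub>M I (\<lambda>_. lborel)) B = (\<integral>\<^sup>+x. indicator B x \<partial>Pi\<^sub>M I (\<lambda>_. lborel))"
      using B by simp
    also have "\<dots> = (\<integral>\<^sup>+x. section_length i B x \<partial>Pi\<^sub>M K (\<lambda>_. lborel))"
      unfolding section_length_def K(1)
      by (rule product_nn_integral_insert) (use K B in auto)
    finally show ?thesis .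
  qed
  have "section_length i (steiner I i A) x = section_length i A x"
    if x: "x \<in> space (Pi\<^sub>M K (\<lambda>_. lborel :: real measure))" for x
  proof -
    have "x(i := t) \<in> space (Pi\<^sub>M I (\<lambda>_. lborel :: real measure))" for t
      using x by (auto simp: space_PiM K(1) PiE_def extensional_def)
    then have "indicator (steiner I i A) (x(i := t)) = (indicator {t. ennreal (2 * \<bar>t\<bar>) < section_length i A x} t :: ennreal)"
      for t by (simp add: steiner_def indicator_def)
    then show ?thesis
      unfolding section_length_def[of i "steiner I i A"] by (simp add: emeasure_interval_abs)
  qed
  then show ?thesis
    unfolding rep[OF st] rep[OF A] by (rule nn_integral_cong)
qed

text \<open>Let P and Q be the sections of A over the base points of x and y. The bound D leaves
  room c for differences between points of P and points of Q. If [a, b] spans P, then Q lies in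
  [b - c, a + c], so half the two lengths add up to at most c, and points of the centred sections
  are no further apart than that.\<close>

lemma steiner_dist:
  assumes I: "finite I" and i: "i \<in> I" and A: "A \<in> sets (Pi\<^sub>M I (\<lambda>_. lborel))"
    and D: "\<And>x y. x \<in> A \<Longrightarrow> y \<in> A \<Longrightarrow> (\<Sum>j\<in>I. (x j - y j)\<^sup>2) \<le> D"
    and x: "x \<in> steiner I i A" and y: "y \<in> steiner I i A"
  shows "(\<Sum>j\<in>I. (x j - y j)\<^sup>2) \<le> D"
proof -
  define R where "R = (\<Sum>j\<in>I-{i}. (x j - y j)\<^sup>2)"
  have split: "(\<Sum>j\<in>I. ((x(i:=p)) j - (y(i:=q)) j)\<^sup>2) = (p - q)\<^sup>2 + R" for p q
    using I i by (simp add: sum.remove[of I i] R_def)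
  define P where "P = {t. x(i := t) \<in> A}"
  define Q where "Q = {t. y(i := t) \<in> A}"
  have meas: "{t. z(i := t) \<in> A} \<in> sets borel \<and> section_length i A z = emeasure lborel {t. z(i := t) \<in> A}"
    if "z \<in> steiner I i A" for z
  proof -
    have z: "z \<in> space (Pi\<^sub>M I (\<lambda>_. lborel :: real measure))" using that by (simp add: steiner_def)
    have "(\<lambda>t. z(i := t)) \<in> lborel \<rightarrow>\<^sub>M Pi\<^sub>M I (\<lambda>_. lborel :: real measure)"
      by (rule measurable_fun_upd[where J=I]) (use i z in auto)
    from measurable_sets[OF this A] have b: "{t. z(i := t) \<in> A} \<in> sets borel"
      by (simp add: vimage_def)
    have "section_length i A z = (\<integral>\<^sup>+t. indicator {t. z(i := t) \<in> A} t \<partial>lborel)"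
      unfolding section_length_def by (simp add: indicator_def)
    with b show ?thesis by simp
  qed
  have Pl: "ennreal (2 * \<bar>x i\<bar>) < emeasure lborel P" and Ql: "ennreal (2 * \<bar>y i\<bar>) < emeasure lborel Q"
    using meas[OF x] meas[OF y] x y by (simp_all add: P_def Q_def steiner_def)
  then have ne: "P \<noteq> {}" "Q \<noteq> {}" by auto
  have pq: "(p - q)\<^sup>2 + R \<le> D" if "p \<in> P" "q \<in> Q" for p q
    using D[of "x(i:=p)" "y(i:=q)"] that split[of p q] by (simp add: P_def Q_def)
  define c where "c = sqrt (D - R)"
  have DR: "D - R \<ge> 0" using ne pq by (metis add.commute diff_ge_0_iff_ge ex_in_conv le_add_same_cancel1 order_trans zero_le_power2)
  have c: "\<bar>p - q\<bar> \<le> c" if "p \<in> P" "q \<in> Q" for p q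
    using pq[OF that] real_sqrt_le_mono[of "(p-q)\<^sup>2" "D - R"] by (simp add: c_def)
  obtain p0 q0 where p0: "p0 \<in> P" and q0: "q0 \<in> Q" using ne by blast
  have bP: "bdd_above P" "bdd_below P"
  proof -
    show "bdd_above P"
    proof (rule bdd_aboveI)
      show "p \<le> q0 + c" if "p \<in> P" for p using c[OF that q0] by linarith
    qed
    show "bdd_below P"
    proof (rule bdd_belowI)
      show "q0 - c \<le> p" if "p \<in> P" for p using c[OF that q0] by linarith
    qed
  qed
  define a where "a = Inf P"
  define b where "b = Sup P"
  have "P \<subseteq> {a..b}" using bP by (auto simp: a_def b_def intro: cInf_lower cSup_upper)
  then have "emeasure lborel P \<le> emeasure lborel {a..b}" by (rule emeasure_mono) simp
  moreover have ab: "a \<le> b" using \<open>P \<subseteq> {a..b}\<close> p0 by force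
  ultimately have "ennreal (2 * \<bar>x i\<bar>) < ennreal (b - a)" using Pl by simp
  then have xi: "2 * \<bar>x i\<bar> < b - a" using ab by (simp add: ennreal_less_iff)
  have "Q \<subseteq> {b - c..a + c}"
  proof
    fix q assume q: "q \<in> Q"
    have "b \<le> q + c" unfolding b_def using c[OF _ q] ne by (intro cSup_least) (auto simp: abs_le_iff algebra_simps)
    moreover have "q - c \<le> a" unfolding a_def using c[OF _ q] ne by (intro cInf_greatest) (force simp: abs_le_iff algebra_simps)+
    ultimately show "q \<in> {b - c..a + c}" by simp
  qed
  then have "emeasure lborel Q \<le> emeasure lborel {b - c..a + c}" by (rule emeasure_mono) simp
  moreover have "b - c \<le> a + c" using \<open>Q \<subseteq> {b - c..a + c}\<close> q0 by force
  ultimately have "ennreal (2 * \<bar>y i\<bar>) < ennreal (a + c - (b - c))" using Ql by simp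
  then have yi: "2 * \<bar>y i\<bar> < a + c - (b - c)" using \<open>b - c \<le> a + c\<close> by (simp add: ennreal_less_iff)
  have "\<bar>x i - y i\<bar> \<le> c" using xi yi by linarith
  then have "(x i - y i)\<^sup>2 \<le> D - R"
    using DR by (simp add: c_def abs_le_square_iff flip: real_sqrt_abs)
  then show ?thesis using split[of "x i" "y i"] by simp
qed

lemma steiner_flip_self:
  assumes "i \<in> I" "x \<in> steiner I i A" shows "x(i := - x i) \<in> steiner I i A"
  using assms by (auto simp: steiner_def space_PiM PiE_def extensional_def)

text \<open>Later symmetrisations do not destroy earlier ones: the sections in direction i over a
  point and over its reflection in coordinate j coincide.\<close>

lemma steiner_flip_other:
  assumes "i \<in> I" "j \<in> I" "j \<noteq> i" and flip: "\<And>x. x \<in> A \<Longrightarrow> x(j := - x j) \<in> A"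
    and x: "x \<in> steiner I i A"
  shows "x(j := - x j) \<in> steiner I i A"
proof -
  have "(x(j := - x j))(i := t) \<in> A \<longleftrightarrow> x(i := t) \<in> A" for t
  proof -
    let ?y = "x(i := t)" and ?z = "(x(j := - x j))(i := t)"
    have "?z = ?y(j := - ?y j)" "?y = ?z(j := - ?z j)" using assms(3) by (auto simp: fun_eq_iff)
    then show ?thesis using flip by metis
  qed
  then have "section_length i A (x(j := - x j)) = section_length i A x"
    by (simp add: section_length_def indicator_def)
  then show ?thesis
    using assms x by (auto simp: steiner_def space_PiM PiE_def extensional_def)
qed

lemma steiner_symmetrization:
  fixes A :: "('i \<Rightarrow> real) set"
  assumes I: "finite I" and A: "A \<in> sets (Pi\<^sub>M I (\<lambda>_. lborel))"
    and D: "\<And>x y. x \<in> A \<Longrightarrow> y \<in> A \<Longrightarrow> (\<Sum>j\<in>I. (x j - y j)\<^sup>2) \<le> D"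
    and K: "K \<subseteq> I"
  shows "\<exists>B\<in>sets (Pi\<^sub>M I (\<lambda>_. lborel)).
     emeasure (Pi\<^sub>M I (\<lambda>_. lborel)) B = emeasure (Pi\<^sub>M I (\<lambda>_. lborel)) A \<and>
     (\<forall>x\<in>B. \<forall>y\<in>B. (\<Sum>j\<in>I. (x j - y j)\<^sup>2) \<le> D) \<and> (\<forall>j\<in>K. \<forall>x\<in>B. x(j := - x j) \<in> B)"
proof -
  have "finite K" using K I finite_subset by blast
  then show ?thesis using K
  proof (induction K)
    case empty
    then show ?case using A D by blast
  next
    case (insert i K)
    have "K \<subseteq> I" using insert.prems by simp
    from insert.IH[OF this] obtain B where B: "B\<in>sets (Pi\<^sub>M I (\<lambda>_. lborel))"
      "emeasure (Pi\<^sub>M I (\<lambda>_. lborel)) B = emeasure (Pi\<^sub>M I (\<lambda>_. lborel)) A"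
      "\<And>x y. x \<in> B \<Longrightarrow> y \<in> B \<Longrightarrow> (\<Sum>j\<in>I. (x j - y j)\<^sup>2) \<le> D"
      "\<And>j x. j \<in> K \<Longrightarrow> x \<in> B \<Longrightarrow> x(j := - x j) \<in> B" by blast
    have i: "i \<in> I" using insert by auto
    show ?case
    proof (intro bexI conjI ballI)
      show "steiner I i B \<in> sets (Pi\<^sub>M I (\<lambda>_. lborel))" by (rule steiner_measurable[OF i B(1)])
      show "emeasure (Pi\<^sub>M I (\<lambda>_. lborel)) (steiner I i B) = emeasure (Pi\<^sub>M I (\<lambda>_. lborel)) A"
        using emeasure_steiner[OF I i B(1)] B(2) by simp
      show "(\<Sum>j\<in>I. (x j - y j)\<^sup>2) \<le> D" if "x \<in> steiner I i B" "y \<in> steiner I i B" for x y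
        by (rule steiner_dist[OF I i B(1)]) (use B(3) that in auto)
      show "x(j := - x j) \<in> steiner I i B" if "j \<in> insert i K" "x \<in> steiner I i B" for j x
      proof (cases "j = i")
        case True
        then show ?thesis using steiner_flip_self[OF i that(2)] by simp
      next
        case False
        with that insert.prems show ?thesis
          by (intro steiner_flip_other i B(4)) auto
      qed
    qed
  qed
qed

text \<open>After symmetrisation in every coordinate the set is invariant under x -> -x. Comparing x
  with -x shows that its norm is at most d/2, so the set lies in a ball of diameter d.\<close>

theorem isodiametric_PiM:
  fixes A :: "('i \<Rightarrow> real) set"
  assumes I: "finite I" and A: "A \<in> sets (Pi\<^sub>M I (\<lambda>_. lborel))" and d: "d \<ge> 0"
    and diam: "\<And>x y. x \<in> A \<Longrightarrow> y \<in> A \<Longrightarrow> (\<Sum>j\<in>I. (x j - y j)\<^sup>2) \<le> d\<^sup>2"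
  shows "emeasure (Pi\<^sub>M I (\<lambda>_. lborel)) A \<le> ennreal (unit_ball_vol (card I) * (d / 2) ^ card I)"
proof -
  let ?M = "Pi\<^sub>M I (\<lambda>_. lborel :: real measure)"
  obtain B where B: "B \<in> sets ?M" "emeasure ?M B = emeasure ?M A"
      "\<And>x y. x \<in> B \<Longrightarrow> y \<in> B \<Longrightarrow> (\<Sum>j\<in>I. (x j - y j)\<^sup>2) \<le> d\<^sup>2"
      "\<And>j x. j \<in> I \<Longrightarrow> x \<in> B \<Longrightarrow> x(j := - x j) \<in> B"
    using steiner_symmetrization[OF I A diam order_refl] by blast
  have flip: "(\<lambda>j. if j \<in> K then - x j else x j) \<in> B" if "finite K" "K \<subseteq> I" "x \<in> B" for K x
    using that
  proof (induction K)
    case (insert i K)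
    let ?y = "\<lambda>j. if j \<in> K then - x j else x j"
    have "?y(i := - ?y i) = (\<lambda>j. if j \<in> insert i K then - x j else x j)"
      using insert by (auto simp: fun_eq_iff)
    with B(4)[of i ?y] insert show ?case by auto
  qed simp
  have norm: "sqrt (\<Sum>j\<in>I. (x j)\<^sup>2) \<le> d / 2" if x: "x \<in> B" for x
  proof -
    have "(\<Sum>j\<in>I. (x j - (if j \<in> I then - x j else x j))\<^sup>2) \<le> d\<^sup>2"
      using B(3)[OF x flip[OF I order_refl x]] .
    also have "(\<Sum>j\<in>I. (x j - (if j \<in> I then - x j else x j))\<^sup>2) = 4 * (\<Sum>j\<in>I. (x j)\<^sup>2)"
      by (simp add: sum_distrib_left power2_eq_square algebra_simps)
    finally have "(\<Sum>j\<in>I. (x j)\<^sup>2) \<le> (d / 2)\<^sup>2" by (simp add: power2_eq_square field_simps)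
    then show ?thesis using d real_sqrt_le_mono by fastforce
  qed
  \<comment> \<open>The volume of a ball is used for radii r > d/2, which are positive also for d =
    0; then r decreases to d/2.\<close>
  have "emeasure ?M A \<le> ennreal (unit_ball_vol (card I) * r ^ card I)" if r: "r > d / 2" for r
  proof -
    have "emeasure ?M A = emeasure ?M B" using B by simp
    also have "\<dots> \<le> emeasure ?M ({f. sqrt (\<Sum>i\<in>I. (f i)\<^sup>2) \<le> r} \<inter> space ?M)"
    proof (rule emeasure_mono)
      show "B \<subseteq> {f. sqrt (\<Sum>i\<in>I. (f i)\<^sup>2) \<le> r} \<inter> space ?M"
        using norm r sets.sets_into_space[OF B(1)] by fastforce
      show "{f. sqrt (\<Sum>i\<in>I. (f i)\<^sup>2) \<le> r} \<inter> space ?M \<in> sets ?M"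
        using I by measurable
    qed
    also have "\<dots> = ennreal (unit_ball_vol (card I) * r ^ card I)"
      using emeasure_cball_aux[of I r] I r d
      by (simp add: unit_ball_vol_def Ball_Volume.unit_ball_vol_def)
    finally show ?thesis .
  qed
  then have *: "emeasure ?M A \<le> ennreal (unit_ball_vol (card I) * (d / 2 + inverse (real (Suc n))) ^ card I)" for n
    by simp
  show ?thesis
  proof (rule LIMSEQ_le_const)
    show "(\<lambda>n. ennreal (unit_ball_vol (card I) * (d / 2 + inverse (real (Suc n))) ^ card I))
        \<longlonglongrightarrow> ennreal (unit_ball_vol (card I) * (d / 2) ^ card I)"
      by (intro tendsto_ennrealI tendsto_intros)
         (use LIMSEQ_inverse_real_of_nat tendsto_add[OF tendsto_const] in fastforce)
  qed (use * in blast)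
qed

section \<open>Determinants and change of variables\<close>

text \<open>The rows outside the image of \<sigma> are unit rows, so only permutations that fix
  these indices contribute to the determinant; they are the permutations of \<open>{..<m}\<close>
  carried over by \<sigma>.\<close>

lemma det_eq_detm:
  fixes A :: "real^'n^'n"
  assumes inj: "inj_on \<sigma> {..<m}"
    and id: "\<And>a b. a \<notin> \<sigma> ` {..<m} \<Longrightarrow> A $ a $ b = (if a = b then 1 else 0)"
  shows "det A = detm m (\<lambda>i j. A $ \<sigma> i $ \<sigma> j)"
proof -
  let ?S = "\<sigma> ` {..<m}"
  have bij: "bij_betw \<sigma> {..<m} ?S" using inj by (simp add: bij_betw_def)
  have "det A = (\<Sum>p | p permutes ?S. of_int (sign p) * (\<Prod>i\<in>UNIV. A $ i $ p i))"
    unfolding det_def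
  proof (rule sum.mono_neutral_right)
    show "{p. p permutes ?S} \<subseteq> {p. p permutes UNIV}"
      by (auto intro: permutes_subset)
    show "\<forall>p\<in>{p. p permutes UNIV} - {p. p permutes ?S}. of_int (sign p) * (\<Prod>i\<in>UNIV. A $ i $ p i) = 0"
    proof
      fix p assume p: "p \<in> {p. p permutes UNIV} - {p. p permutes ?S}"
      then obtain a where a: "a \<notin> ?S" "p a \<noteq> a" by (auto simp: permutes_def)
      then have "A $ a $ p a = 0" using id[of a "p a"] by simp
      then have "(\<Prod>i\<in>UNIV. A $ i $ p i) = 0" by (intro prod_zero) auto
      then show "of_int (sign p) * (\<Prod>i\<in>UNIV. A $ i $ p i) = 0" by simp
    qed
  qed simp
  also have "\<dots> = (\<Sum>p | p permutes ?S. of_int (sign p) * (\<Prod>i\<in>?S. A $ i $ p i))"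
  proof (rule sum.cong)
    fix p assume "p \<in> {p. p permutes ?S}"
    then have p: "p permutes ?S" by simp
    have "(\<Prod>i\<in>UNIV. A $ i $ p i) = (\<Prod>i\<in>?S. A $ i $ p i)"
      using p id by (intro prod.mono_neutral_right) (auto simp: permutes_not_in)
    then show "of_int (sign p) * (\<Prod>i\<in>UNIV. A $ i $ p i) = of_int (sign p) * (\<Prod>i\<in>?S. A $ i $ p i)"
      by simp
  qed simp
  also have "\<dots> = (\<Sum>p | p permutes {..<m}. of_int (sign (map_permutation {..<m} \<sigma> p)) *
      (\<Prod>i\<in>?S. A $ i $ (map_permutation {..<m} \<sigma> p) i))"
  proof (rule sum.reindex_bij_witness[where j="map_permutation ?S (inv_into {..<m} \<sigma>)" and i="map_permutation {..<m} \<sigma>"])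
    have bij': "bij_betw (inv_into {..<m} \<sigma>) ?S {..<m}" by (rule bij_betw_inv_into[OF bij])
    show "map_permutation {..<m} \<sigma> (map_permutation ?S (inv_into {..<m} \<sigma>) p) = p"
      if "p \<in> {p. p permutes ?S}" for p
      by (rule map_permutation_compose_inv[OF bij']) (use that inj in \<open>auto simp: f_inv_into_f\<close>)
    show "map_permutation ?S (inv_into {..<m} \<sigma>) (map_permutation {..<m} \<sigma> p) = p"
      if "p \<in> {p. p permutes {..<m}}" for p
      by (rule map_permutation_compose_inv[OF bij]) (use that inj in auto)
    show "map_permutation ?S (inv_into {..<m} \<sigma>) p \<in> {p. p permutes {..<m}}"
      if "p \<in> {p. p permutes ?S}" for p
      using map_permutation_permutes[OF bij'] that by simp
    show "map_permutation {..<m} \<sigma> p \<in> {p. p permutes ?S}"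
      if "p \<in> {p. p permutes {..<m}}" for p
      using map_permutation_permutes[OF bij] that by simp
    show "of_int (sign (map_permutation {..<m} \<sigma> (map_permutation ?S (inv_into {..<m} \<sigma>) p))) *
        (\<Prod>i\<in>?S. A $ i $ (map_permutation {..<m} \<sigma> (map_permutation ?S (inv_into {..<m} \<sigma>) p)) i)
        = of_int (sign p) * (\<Prod>i\<in>?S. A $ i $ p i)"
      if "p \<in> {p. p permutes ?S}" for p
      by (subst (1 2) map_permutation_compose_inv[OF bij']) (use that inj in \<open>auto simp: f_inv_into_f\<close>)
  qed
  also have "\<dots> = detm m (\<lambda>i j. A $ \<sigma> i $ \<sigma> j)"
    unfolding detm_def
  proof (rule sum.cong)
    fix p assume "p \<in> {p. p permutes {..<m}}"
    then have p: "p permutes {..<m}" by simp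
    have "(\<Prod>i\<in>?S. A $ i $ (map_permutation {..<m} \<sigma> p) i)
        = (\<Prod>i<m. A $ \<sigma> i $ (map_permutation {..<m} \<sigma> p) (\<sigma> i))"
      by (simp add: prod.reindex[OF inj])
    also have "\<dots> = (\<Prod>i<m. A $ \<sigma> i $ \<sigma> (p i))"
      by (intro prod.cong refl) (simp add: map_permutation_apply[OF inj])
    finally show "of_int (sign (map_permutation {..<m} \<sigma> p)) * (\<Prod>i\<in>?S. A $ i $ (map_permutation {..<m} \<sigma> p) i)
       = of_int (sign p) * (\<Prod>i<m. A $ \<sigma> i $ \<sigma> (p i))"
      using sign_map_permutation[OF inj p] by simp
  qed simp
  finally show ?thesis .
qed

section \<open>Change of variables over arbitrary finite index types\<close>

text \<open>The change of variables theory of the library is restricted to well-ordered index types;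
  every finite index type is in bijection with one of these.\<close>

typedef ('a::finite) idx = "{..<CARD('a)}"
  by (rule exI[of _ 0]) simp

instance idx :: (finite) finite
proof
  have "(UNIV :: 'a idx set) = Abs_idx ` {..<CARD('a)}"
    using type_definition.Abs_image[OF type_definition_idx] by metis
  then show "finite (UNIV :: 'a idx set)" by (metis finite_imageI finite_lessThan)
qed

lemma card_idx: "CARD('a::finite idx) = CARD('a)"
  using type_definition.card[OF type_definition_idx, where 'a1='a] by simp

instantiation idx :: (finite) wellorder
begin

definition less_eq_idx :: "'a idx \<Rightarrow> 'a idx \<Rightarrow> bool" where "less_eq_idx x y \<longleftrightarrow> Rep_idx x \<le> Rep_idx y"
definition less_idx :: "'a idx \<Rightarrow> 'a idx \<Rightarrow> bool" where "less_idx x y \<longleftrightarrow> Rep_idx x < Rep_idx y"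

instance
proof
  fix P :: "'a idx \<Rightarrow> bool" and a
  assume step: "\<And>x. (\<And>y. y < x \<Longrightarrow> P y) \<Longrightarrow> P x"
  show "P a"
  proof (induction a rule: measure_induct_rule[of Rep_idx])
    case (less x)
    then show ?case unfolding less_idx_def[symmetric] by (rule step)
  qed
qed (auto simp: less_eq_idx_def less_idx_def Rep_idx_inject)

end

definition reindex_vec :: "('b \<Rightarrow> 'a) \<Rightarrow> real^'a \<Rightarrow> real^'b" where
  "reindex_vec f x = (\<chi> j. x $ f j)"

lemma reindex_vec_nth [simp]: "reindex_vec f x $ j = x $ f j"
  by (simp add: reindex_vec_def)

lemma linear_reindex_vec: "linear (reindex_vec f :: real^'a::finite \<Rightarrow> real^'b::finite)"
  by (rule linearI) (auto simp: vec_eq_iff)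

lemma prod_Basis_vec: "(\<Prod>b\<in>Basis. (x :: real^'a::finite) \<bullet> b) = (\<Prod>i\<in>UNIV. x $ i)"
proof -
  have B: "(Basis :: (real^'a) set) = (\<lambda>i. axis i 1) ` UNIV" by (auto simp: Basis_vec_def)
  have "inj (\<lambda>i::'a. axis i (1::real))" by (auto simp: inj_on_def axis_eq_axis)
  then show ?thesis unfolding B by (subst prod.reindex) (auto simp: inner_axis o_def)
qed

lemma measurable_linear_borel:
  "linear (f :: 'a::euclidean_space \<Rightarrow> 'b::euclidean_space) \<Longrightarrow> f \<in> borel_measurable borel"
  by (intro borel_measurable_continuous_onI linear_continuous_on) (simp add: linear_conv_bounded_linear)

lemma distr_reindex_vec:
  fixes f :: "'b::finite \<Rightarrow> 'a::finite"
  assumes f: "bij f"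
  shows "distr lborel borel (reindex_vec f) = lborel"
proof (rule lborel_eqI[symmetric])
  fix l u :: "real^'b" assume lu: "\<And>b. b \<in> Basis \<Longrightarrow> l \<bullet> b \<le> u \<bullet> b"
  have le: "l $ i \<le> u $ i" for i using lu[of "axis i 1"] by (simp add: inner_axis)
  let ?g = "inv f"
  have fg: "f (?g i) = i" "?g (f j) = j" for i j
    using f by (simp_all add: bij_is_surj surj_f_inv_f bij_is_inj inv_f_f)
  have vim: "reindex_vec f -` box l u = box (reindex_vec ?g l) (reindex_vec ?g u)"
    by (auto simp: mem_box_cart) (metis fg(1), metis fg(1), metis fg(2), metis fg(2))
  have "emeasure (distr lborel borel (reindex_vec f)) (box l u) = emeasure lborel (box (reindex_vec ?g l) (reindex_vec ?g u))"
    by (subst emeasure_distr) (auto simp: vim measurable_linear_borel linear_reindex_vec)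
  also have "\<dots> = ennreal (\<Prod>b\<in>Basis. (reindex_vec ?g u - reindex_vec ?g l) \<bullet> b)"
  proof (rule emeasure_lborel_box)
    show "reindex_vec ?g l \<bullet> b \<le> reindex_vec ?g u \<bullet> b" if "b \<in> Basis" for b
      using that le by (auto simp: Basis_vec_def inner_axis)
  qed
  also have "(\<Prod>b\<in>Basis. (reindex_vec ?g u - reindex_vec ?g l) \<bullet> b) = (\<Prod>b\<in>Basis. (u - l) \<bullet> b)"
    unfolding prod_Basis_vec
    by (rule prod.reindex_bij_witness[of _ f ?g]) (auto simp: fg)
  finally show "emeasure (distr lborel borel (reindex_vec f)) (box l u) = ennreal (\<Prod>b\<in>Basis. (u - l) \<bullet> b)" .
qed simp

text \<open>The two matrices have different index types. Both determinants are therefore expressed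
  by \<open>detm\<close> over an enumeration of the indices, where they agree entry by
  entry.\<close>

lemma det_reindex_vec:
  fixes D :: "real^'a::finite \<Rightarrow> real^'a" and b :: "'a \<Rightarrow> 'b::finite"
  assumes b: "bij b"
  shows "det (matrix (reindex_vec (inv b) \<circ> D \<circ> reindex_vec b)) = det (matrix D)"
proof -
  have inv: "inv b (b i) = i" for i using b by (simp add: bij_is_inj inv_f_f)
  obtain \<sigma> where \<sigma>: "bij_betw \<sigma> {..<CARD('a)} (UNIV :: 'a set)"
    using ex_bij_betw_nat_finite[of "UNIV::'a set"] by (auto simp: atLeast0LessThan)
  have b\<sigma>: "bij_betw (b \<circ> \<sigma>) {..<CARD('a)} (UNIV :: 'b set)"
    by (rule bij_betw_trans[OF \<sigma> b])
  have ax: "reindex_vec b (axis (b i) 1) = (axis i 1 :: real^'a)" for i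
    using b by (auto simp: vec_eq_iff axis_def bij_is_inj inj_eq)
  have "det (matrix (reindex_vec (inv b) \<circ> D \<circ> reindex_vec b))
     = detm CARD('a) (\<lambda>i j. matrix (reindex_vec (inv b) \<circ> D \<circ> reindex_vec b) $ (b \<circ> \<sigma>) i $ (b \<circ> \<sigma>) j)"
    by (rule det_eq_detm) (use b\<sigma> in \<open>auto simp: bij_betw_def o_def\<close>)
  also have "\<dots> = detm CARD('a) (\<lambda>i j. matrix D $ \<sigma> i $ \<sigma> j)"
    by (simp add: matrix_def inv ax)
  also have "\<dots> = det (matrix D)"
    by (rule det_eq_detm[symmetric]) (use \<sigma> in \<open>auto simp: bij_betw_def\<close>)
  finally show ?thesis .
qed

text \<open>The image itself is only Lebesgue measurable, so it is enlarged by a null set to a Borel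
  set N. Points attained several times are counted several times on the right, whence an inequality.
  If the integral is infinite, the whole space serves as N.\<close>

lemma differentiable_image_cover_wellorder:
  fixes f :: "real^'n::{finite,wellorder} \<Rightarrow> real^'n::_"
  assumes S: "S \<in> sets borel"
    and deriv: "\<And>x. x \<in> S \<Longrightarrow> (f has_derivative f' x) (at x within S)"
    and meas: "(\<lambda>x. indicator S x * \<bar>det (matrix (f' x))\<bar>) \<in> borel_measurable borel"
  shows "\<exists>N\<in>sets borel. f ` S \<subseteq> N \<and>
     emeasure lborel N \<le> (\<integral>\<^sup>+x. ennreal (indicator S x * \<bar>det (matrix (f' x))\<bar>) \<partial>lborel)"
proof (cases "(\<integral>\<^sup>+x. ennreal (indicator S x * \<bar>det (matrix (f' x))\<bar>) \<partial>lborel) = top")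
  case False
  let ?g = "\<lambda>x. indicator S x * \<bar>det (matrix (f' x))\<bar>"
  have gi: "?g integrable_on UNIV"
    using False by (intro nn_integral_integrable_on meas) (auto simp: less_top)
  then have gS: "(\<lambda>x. \<bar>det (matrix (f' x))\<bar>) integrable_on S"
    by (subst integrable_restrict_UNIV[symmetric]) (auto simp: indicator_def if_distrib cong: if_cong elim: integrable_eq)
  have Sl: "S \<in> sets lebesgue" using S by (metis sets_completionI_sets sets_lborel)
  have "f ` S \<in> lmeasurable" by (rule measurable_differentiable_image[OF Sl deriv gS])
  moreover have m: "measure lebesgue (f ` S) \<le> integral S (\<lambda>x. \<bar>det (matrix (f' x))\<bar>)"
    by (rule measure_differentiable_image[OF Sl deriv gS])
  ultimately have e: "emeasure lebesgue (f ` S) \<le> ennreal (integral S (\<lambda>x. \<bar>det (matrix (f' x))\<bar>))"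
    by (subst emeasure_eq_measure2) (auto simp: fmeasurable_def intro: ennreal_leI)
  have i: "(\<integral>\<^sup>+x. ennreal (?g x) \<partial>lborel) = ennreal (integral S (\<lambda>x. \<bar>det (matrix (f' x))\<bar>))"
    by (rule nn_integral_has_integral_lebesgue) (use gS in auto)
  obtain A N N' where A: "f ` S = A \<union> N" "N \<subseteq> N'" "N' \<in> null_sets lborel" "A \<in> sets lborel"
    using \<open>f ` S \<in> lmeasurable\<close> by (auto simp: fmeasurable_def elim: sets_completionE)
  have "emeasure lborel (A \<union> N') = emeasure lborel A"
    using A by (simp add: emeasure_Un_null_set)
  also have "\<dots> = emeasure lebesgue A" using A(4) by simp
  also have "\<dots> \<le> emeasure lebesgue (f ` S)"
    by (rule emeasure_mono) (use A \<open>f ` S \<in> lmeasurable\<close> in \<open>auto simp: fmeasurable_def\<close>)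
  finally have "emeasure lborel (A \<union> N') \<le> (\<integral>\<^sup>+x. ennreal (?g x) \<partial>lborel)" using e i by simp
  moreover have "f ` S \<subseteq> A \<union> N'" "A \<union> N' \<in> sets borel" using A by (auto simp: null_sets_def)
  ultimately show ?thesis by blast
qed (intro bexI[of _ UNIV], auto)

text \<open>Conjugation with the coordinate renamings \<iota> and \<kappa>, which preserve Lebesgue
  measure and determinants, reduces this to a well-ordered index type.\<close>

theorem differentiable_image_cover:
  fixes f :: "real^'n \<Rightarrow> real^'n"
  assumes S: "S \<in> sets borel"
    and deriv: "\<And>x. x \<in> S \<Longrightarrow> (f has_derivative f' x) (at x within S)"
    and meas: "(\<lambda>x. indicator S x * \<bar>det (matrix (f' x))\<bar>) \<in> borel_measurable borel"
  shows "\<exists>N\<in>sets borel. f ` S \<subseteq> N \<and>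
     emeasure lborel N \<le> (\<integral>\<^sup>+x. ennreal (indicator S x * \<bar>det (matrix (f' x))\<bar>) \<partial>lborel)"
proof -
  obtain b :: "'n \<Rightarrow> 'n idx" where b: "bij b"
    using finite_same_card_bij[of "UNIV::'n set" "UNIV::'n idx set"] card_idx[where 'a='n] by auto
  define \<iota> :: "real^'n \<Rightarrow> real^'n idx" where "\<iota> = reindex_vec (inv b)"
  define \<kappa> :: "real^'n idx \<Rightarrow> real^'n" where "\<kappa> = reindex_vec b"
  have inv: "inv b (b i) = i" "b (inv b j) = j" for i j
    using b by (simp_all add: bij_is_inj inv_f_f bij_is_surj surj_f_inv_f)
  have \<iota>\<kappa>[simp]: "\<iota> (\<kappa> y) = y" "\<kappa> (\<iota> x) = x" for x y
    by (auto simp: \<iota>_def \<kappa>_def vec_eq_iff inv)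
  have lin: "linear \<iota>" "linear \<kappa>" by (simp_all add: \<iota>_def \<kappa>_def linear_reindex_vec)
  then have [measurable]: "\<iota> \<in> borel_measurable borel" "\<kappa> \<in> borel_measurable borel"
    by (simp_all add: measurable_linear_borel)
  have bl: "bounded_linear \<iota>" "bounded_linear \<kappa>" using lin by (simp_all add: linear_conv_bounded_linear)
  have distr: "distr lborel borel \<iota> = lborel" "distr lborel borel \<kappa> = lborel"
    unfolding \<iota>_def \<kappa>_def using b by (auto intro!: distr_reindex_vec bij_imp_bij_inv)
  define T where "T = \<kappa> -` S"
  have T: "T \<in> sets borel" unfolding T_def using measurable_sets_borel[of \<kappa> borel S] S by simp
  have kT: "\<kappa> ` T = S"
  proof
    show "S \<subseteq> \<kappa> ` T" by (rule subsetI, rule image_eqI[where x="\<iota> _"]) (auto simp: T_def)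
  qed (auto simp: T_def)
  define f2 where "f2 y = (\<iota> \<circ> f' (\<kappa> y) \<circ> \<kappa>)" for y
  have det: "det (matrix (f2 y)) = det (matrix (f' (\<kappa> y)))" for y
    unfolding f2_def \<iota>_def \<kappa>_def by (rule det_reindex_vec[OF b])
  have ind: "indicator T y = (indicator S (\<kappa> y) :: real)" for y by (simp add: T_def indicator_def)
  have "\<exists>N\<in>sets borel. (\<iota> \<circ> f \<circ> \<kappa>) ` T \<subseteq> N \<and>
     emeasure lborel N \<le> (\<integral>\<^sup>+x. ennreal (indicator T x * \<bar>det (matrix (f2 x))\<bar>) \<partial>lborel)"
  proof (rule differentiable_image_cover_wellorder[OF T])
    fix y assume y: "y \<in> T"
    then have "\<kappa> y \<in> S" by (simp add: T_def)
    then have "(f has_derivative f' (\<kappa> y)) (at (\<kappa> y) within \<kappa> ` T)" using deriv kT by simp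
    then have "((f \<circ> \<kappa>) has_derivative (f' (\<kappa> y) \<circ> \<kappa>)) (at y within T)"
      by (intro diff_chain_within bounded_linear_imp_has_derivative bl)
    then show "((\<iota> \<circ> f \<circ> \<kappa>) has_derivative f2 y) (at y within T)"
      using bounded_linear.has_derivative[OF bl(1)] by (simp add: f2_def o_def)
  next
    show "(\<lambda>x. indicator T x * \<bar>det (matrix (f2 x))\<bar>) \<in> borel_measurable borel"
      unfolding det ind using measurable_compose[OF \<open>\<kappa> \<in> _\<close> meas] by simp
  qed
  then obtain N where N: "N \<in> sets borel" "(\<iota> \<circ> f \<circ> \<kappa>) ` T \<subseteq> N"
    "emeasure lborel N \<le> (\<integral>\<^sup>+x. ennreal (indicator T x * \<bar>det (matrix (f2 x))\<bar>) \<partial>lborel)" by blast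
  have "(\<integral>\<^sup>+x. ennreal (indicator T x * \<bar>det (matrix (f2 x))\<bar>) \<partial>lborel)
     = (\<integral>\<^sup>+x. ennreal (indicator S x * \<bar>det (matrix (f' x))\<bar>) \<partial>distr lborel borel \<kappa>)"
    unfolding det ind by (subst nn_integral_distr) (use meas in \<open>auto intro: measurable_compose[OF _ measurable_ennreal]\<close>)
  also have "\<dots> = (\<integral>\<^sup>+x. ennreal (indicator S x * \<bar>det (matrix (f' x))\<bar>) \<partial>lborel)"
    by (simp add: distr)
  finally have eqi: "(\<integral>\<^sup>+x. ennreal (indicator T x * \<bar>det (matrix (f2 x))\<bar>) \<partial>lborel) = \<dots>" .
  have N': "\<iota> -` N \<in> sets borel" using measurable_sets_borel[of \<iota> borel N] N(1) by simp
  have "emeasure lborel (\<iota> -` N) = emeasure (distr lborel borel \<iota>) N"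
    using N(1) by (subst emeasure_distr) auto
  then have "emeasure lborel (\<iota> -` N) \<le> (\<integral>\<^sup>+x. ennreal (indicator S x * \<bar>det (matrix (f' x))\<bar>) \<partial>lborel)"
    using N(3) eqi by (simp add: distr)
  moreover have "f ` S \<subseteq> \<iota> -` N" using N(2) unfolding kT[symmetric] by auto
  ultimately show ?thesis using N' by blast
qed

section \<open>Lebesgue measure under linear maps\<close>

lemma emeasure_linear_image_le:
  fixes D :: "real^'n \<Rightarrow> real^'n"
  assumes D: "linear D" and S: "S \<in> sets borel"
  shows "\<exists>N\<in>sets borel. D ` S \<subseteq> N \<and> emeasure lborel N \<le> ennreal \<bar>det (matrix D)\<bar> * emeasure lborel S"
proof -
  have "(D has_derivative D) (at x within S)" for x
    using D by (simp add: linear_conv_bounded_linear bounded_linear_imp_has_derivative)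
  moreover have "(\<integral>\<^sup>+x. ennreal (indicator S x * \<bar>det (matrix D)\<bar>) \<partial>lborel) = ennreal \<bar>det (matrix D)\<bar> * emeasure lborel S"
    using S by (simp add: ennreal_mult' ennreal_indicator nn_integral_multc mult.commute)
  ultimately show ?thesis
    using differentiable_image_cover[OF S, of D "\<lambda>_. D"] S by simp
qed

text \<open>The covering bound is one-sided. Applied to D and to its inverse E it gives both
  inequalities, as the two determinants are reciprocal.\<close>

lemma emeasure_linear_vimage:
  fixes D :: "real^'n \<Rightarrow> real^'n"
  assumes D: "linear D" and det: "det (matrix D) \<noteq> 0" and S: "S \<in> sets borel"
  shows "emeasure lborel S = ennreal \<bar>det (matrix D)\<bar> * emeasure lborel (D -` S)"
proof (rule antisym)
  let ?d = "\<bar>det (matrix D)\<bar>"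
  have inj: "inj D" using det det_nz_iff_inj[OF D] by simp
  have surj: "surj D" using linear_injective_imp_surjective[OF D inj] by simp
  have vS: "D -` S \<in> sets borel"
    using measurable_sets_borel[of D borel S] measurable_linear_borel[OF D] S by simp
  obtain N where N: "N \<in> sets borel" "D ` (D -` S) \<subseteq> N" "emeasure lborel N \<le> ennreal ?d * emeasure lborel (D -` S)"
    using emeasure_linear_image_le[OF D vS] by blast
  have "D ` (D -` S) = S" using surj by (simp add: surj_image_vimage_eq)
  then have "emeasure lborel S \<le> emeasure lborel N" using N by (intro emeasure_mono) auto
  then show "emeasure lborel S \<le> ennreal ?d * emeasure lborel (D -` S)"
    using N(3) by (rule order_trans)
  obtain E where E: "linear E" "\<And>x. E (D x) = x" "\<And>x. D (E x) = x"
    using linear_injective_isomorphism[OF D inj] by blast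
  have "matrix E ** matrix D = mat 1"
    using matrix_compose[OF D E(1)] E(2) by (simp add: o_def matrix_id_mat_1[unfolded id_def])
  then have dd: "det (matrix E) * det (matrix D) = 1" by (metis det_mul det_I)
  obtain N' where N': "N' \<in> sets borel" "E ` S \<subseteq> N'" "emeasure lborel N' \<le> ennreal \<bar>det (matrix E)\<bar> * emeasure lborel S"
    using emeasure_linear_image_le[OF E(1) S] by blast
  have "D -` S = E ` S" using E by (auto simp: image_iff) metis
  then have "emeasure lborel (D -` S) \<le> emeasure lborel N'" using N' by (intro emeasure_mono) auto
  then have "emeasure lborel (D -` S) \<le> ennreal \<bar>det (matrix E)\<bar> * emeasure lborel S"
    using N'(3) by (rule order_trans)
  then have "ennreal ?d * emeasure lborel (D -` S) \<le> ennreal ?d * (ennreal \<bar>det (matrix E)\<bar> * emeasure lborel S)"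
    by (rule mult_left_mono) simp
  also have "\<dots> = ennreal (?d * \<bar>det (matrix E)\<bar>) * emeasure lborel S"
    by (simp add: ennreal_mult mult.assoc)
  also have "?d * \<bar>det (matrix E)\<bar> = 1" using dd by (metis abs_mult abs_one mult.commute)
  finally show "ennreal ?d * emeasure lborel (D -` S) \<le> emeasure lborel S" by simp
qed

lemma nn_integral_linear_vimage:
  fixes D :: "real^'n \<Rightarrow> real^'n"
  assumes D: "linear D" and det: "det (matrix D) \<noteq> 0" and h: "h \<in> borel_measurable borel"
  shows "(\<integral>\<^sup>+x. h x \<partial>lborel) = ennreal \<bar>det (matrix D)\<bar> * (\<integral>\<^sup>+x. h (D x) \<partial>lborel)"
proof -
  note [measurable] = measurable_linear_borel[OF D] h
  have "lborel = density (distr lborel borel D) (\<lambda>_. ennreal \<bar>det (matrix D)\<bar>)"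
  proof (rule measure_eqI)
    fix A :: "(real^'n) set" assume "A \<in> sets lborel"
    then have A[measurable]: "A \<in> sets borel" by simp
    have "emeasure (density (distr lborel borel D) (\<lambda>_. ennreal \<bar>det (matrix D)\<bar>)) A
        = ennreal \<bar>det (matrix D)\<bar> * emeasure lborel (D -` A)"
      by (simp add: emeasure_density nn_integral_cmult emeasure_distr)
    then show "emeasure lborel A = emeasure (density (distr lborel borel D) (\<lambda>_. ennreal \<bar>det (matrix D)\<bar>)) A"
      using emeasure_linear_vimage[OF D det A] by simp
  qed simp
  then have "(\<integral>\<^sup>+x. h x \<partial>lborel) = (\<integral>\<^sup>+x. h x \<partial>density (distr lborel borel D) (\<lambda>_. ennreal \<bar>det (matrix D)\<bar>))"
    by simp
  also have "\<dots> = ennreal \<bar>det (matrix D)\<bar> * (\<integral>\<^sup>+x. h (D x) \<partial>lborel)"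
    by (simp add: nn_integral_density nn_integral_distr nn_integral_cmult)
  finally show ?thesis .
qed

section \<open>Lebesgue measure on coordinate subspaces\<close>

definition coord_emb :: "'n set \<Rightarrow> ('n \<Rightarrow> real) \<Rightarrow> real^'n" where
  "coord_emb I f = (\<chi> i. if i \<in> I then f i else 0)"

definition coord_proj :: "'n set \<Rightarrow> real^'n \<Rightarrow> real^'n" where
  "coord_proj I x = (\<chi> i. if i \<in> I then x $ i else 0)"

text \<open>Lebesgue measure of a coordinate subspace, placed on all of \<open>real^'n\<close> so
  that base and fibre coordinates share one type whatever I is.\<close>

definition coord_measure :: "'n set \<Rightarrow> (real^'n) measure" where
  "coord_measure I = distr (Pi\<^sub>M I (\<lambda>_. lborel)) borel (coord_emb I)"

lemma coord_emb_nth [simp]: "coord_emb I f $ i = (if i \<in> I then f i else 0)"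
  by (simp add: coord_emb_def)

lemma coord_proj_nth [simp]: "coord_proj I x $ i = (if i \<in> I then x $ i else 0)"
  by (simp add: coord_proj_def)

lemma linear_coord_proj: "linear (coord_proj I :: real^'n \<Rightarrow> real^'n)"
  by (rule linearI) (auto simp: vec_eq_iff)

lemma coord_proj_add: "coord_proj I (x + y) = coord_proj I x + coord_proj I y"
  by (simp add: vec_eq_iff)

lemma coord_proj_scaleR: "coord_proj I (c *\<^sub>R x) = c *\<^sub>R coord_proj I x"
  by (simp add: vec_eq_iff)

lemma coord_proj_diff: "coord_proj I (x - y) = coord_proj I x - coord_proj I y"
  by (simp add: vec_eq_iff)

lemma coord_proj_0 [simp]: "coord_proj I 0 = 0"
  by (simp add: vec_eq_iff)

lemma coord_proj_proj [simp]: "coord_proj I (coord_proj J x) = coord_proj (I \<inter> J) x"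
  by (simp add: vec_eq_iff)

lemma coord_proj_empty [simp]: "coord_proj {} x = 0"
  by (simp add: vec_eq_iff)

lemma coord_proj_emb [simp]: "coord_proj I (coord_emb I f) = coord_emb I f"
  by (simp add: vec_eq_iff)

lemma coord_proj_Compl_add: "coord_proj I x + coord_proj (-I) x = x"
  by (simp add: vec_eq_iff)

lemma inner_coord_proj: "coord_proj I x \<bullet> y = x \<bullet> coord_proj I y"
  by (auto simp: inner_vec_def intro!: sum.cong)

lemma measurable_coord_proj [measurable]: "coord_proj I \<in> borel_measurable borel"
  by (rule measurable_linear_borel[OF linear_coord_proj])

lemma measurable_coord_emb [measurable]:
  "coord_emb I \<in> Pi\<^sub>M I (\<lambda>_. lborel) \<rightarrow>\<^sub>M (borel :: (real^'n) measure)"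
proof (subst borel_measurable_euclidean_space, rule ballI)
  fix b :: "real^'n" assume "b \<in> Basis"
  then obtain i where b: "b = axis i 1" by (auto simp: Basis_vec_def)
  have "(\<lambda>f. f i) \<in> borel_measurable (Pi\<^sub>M I (\<lambda>_. lborel :: real measure))" if "i \<in> I"
    using measurable_component_singleton[OF that, of "\<lambda>_. lborel :: real measure"] by simp
  then show "(\<lambda>f. coord_emb I f \<bullet> b) \<in> borel_measurable (Pi\<^sub>M I (\<lambda>_. lborel))"
    by (cases "i \<in> I") (simp_all add: b inner_axis)
qed

lemma sets_coord_measure [simp, measurable_cong]: "sets (coord_measure I) = sets borel"
  by (simp add: coord_measure_def)

lemma space_coord_measure [simp]: "space (coord_measure I) = UNIV"
  by (simp add: coord_measure_def)

lemma nn_integral_coord_measure: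
  assumes "h \<in> borel_measurable borel"
  shows "(\<integral>\<^sup>+x. h x \<partial>coord_measure I) = (\<integral>\<^sup>+f. h (coord_emb I f) \<partial>Pi\<^sub>M I (\<lambda>_. lborel))"
  unfolding coord_measure_def by (rule nn_integral_distr) (use assms in auto)

lemma emeasure_coord_measure:
  assumes "A \<in> sets borel"
  shows "emeasure (coord_measure I) A
    = emeasure (Pi\<^sub>M I (\<lambda>_. lborel)) (coord_emb I -` A \<inter> space (Pi\<^sub>M I (\<lambda>_. lborel)))"
  unfolding coord_measure_def by (rule emeasure_distr) (use assms in auto)

text \<open>The integral is pulled back to the product measure on functions, whose sigma-finiteness
  makes parametric integrals measurable.\<close>

lemma borel_measurable_nn_integral_coord:
  fixes h :: "'a \<Rightarrow> real^'n \<Rightarrow> ennreal"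
  assumes h: "(\<lambda>(x, y). h x y) \<in> borel_measurable (M \<Otimes>\<^sub>M borel)"
  shows "(\<lambda>x. \<integral>\<^sup>+y. h x y \<partial>coord_measure J) \<in> borel_measurable M"
proof -
  interpret product_sigma_finite "\<lambda>_. lborel :: real measure" ..
  interpret sigma_finite_measure "Pi\<^sub>M J (\<lambda>_. lborel :: real measure)" by (rule sigma_finite) simp
  have "(\<lambda>x. \<integral>\<^sup>+f. h x (coord_emb J f) \<partial>Pi\<^sub>M J (\<lambda>_. lborel)) \<in> borel_measurable M"
  proof (rule borel_measurable_nn_integral)
    have "(\<lambda>p. (fst p, coord_emb J (snd p))) \<in> M \<Otimes>\<^sub>M Pi\<^sub>M J (\<lambda>_. lborel) \<rightarrow>\<^sub>M M \<Otimes>\<^sub>M borel"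
      by measurable
    from measurable_compose[OF this h]
    show "(\<lambda>(x, f). h x (coord_emb J f)) \<in> borel_measurable (M \<Otimes>\<^sub>M Pi\<^sub>M J (\<lambda>_. lborel))"
      by (simp add: case_prod_unfold)
  qed
  moreover have "(\<integral>\<^sup>+y. h x y \<partial>coord_measure J) = (\<integral>\<^sup>+f. h x (coord_emb J f) \<partial>Pi\<^sub>M J (\<lambda>_. lborel))"
    if "x \<in> space M" for x
    using measurable_Pair2[OF h that] by (intro nn_integral_coord_measure) simp
  ultimately show ?thesis by (simp cong: measurable_cong)
qed

lemma nn_integral_coord_proj:
  fixes h :: "real^'n \<Rightarrow> ennreal"
  assumes h[measurable]: "h \<in> borel_measurable borel"
  shows "(\<integral>\<^sup>+x. h (coord_proj I x) \<partial>coord_measure I) = (\<integral>\<^sup>+x. h x \<partial>coord_measure I)"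
  by (subst (1 2) nn_integral_coord_measure) simp_all

lemma nn_integral_coord_Un:
  fixes h :: "real^'n \<Rightarrow> ennreal"
  assumes disj: "I \<inter> J = {}" and h[measurable]: "h \<in> borel_measurable borel"
  shows "(\<integral>\<^sup>+z. h z \<partial>coord_measure (I \<union> J))
    = (\<integral>\<^sup>+x. \<integral>\<^sup>+y. h (coord_proj I x + coord_proj J y) \<partial>coord_measure J \<partial>coord_measure I)"
proof -
  interpret product_sigma_finite "\<lambda>_. lborel :: real measure" ..
  have merge: "coord_emb (I \<union> J) (merge I J (f, g)) = coord_emb I f + coord_emb J g" for f g
    using disj by (auto simp: vec_eq_iff merge_def)
  have "(\<integral>\<^sup>+z. h z \<partial>coord_measure (I \<union> J))
      = (\<integral>\<^sup>+f. \<integral>\<^sup>+g. h (coord_emb (I \<union> J) (merge I J (f, g))) \<partial>Pi\<^sub>M J (\<lambda>_. lborel) \<partial>Pi\<^sub>M I (\<lambda>_. lborel))"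
    by (subst nn_integral_coord_measure[OF h], rule product_nn_integral_fold[OF disj]) auto
  also have "\<dots> = (\<integral>\<^sup>+f. \<integral>\<^sup>+g. h (coord_proj I (coord_emb I f) + coord_proj J (coord_emb J g))
      \<partial>Pi\<^sub>M J (\<lambda>_. lborel) \<partial>Pi\<^sub>M I (\<lambda>_. lborel))"
    by (simp add: merge)
  also have "\<dots> = (\<integral>\<^sup>+f. \<integral>\<^sup>+y. h (coord_proj I (coord_emb I f) + coord_proj J y)
      \<partial>coord_measure J \<partial>Pi\<^sub>M I (\<lambda>_. lborel))"
    by (intro nn_integral_cong nn_integral_coord_measure[symmetric]) measurable
  also have "\<dots> = (\<integral>\<^sup>+x. \<integral>\<^sup>+y. h (coord_proj I x + coord_proj J y) \<partial>coord_measure J \<partial>coord_measure I)"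
    by (intro nn_integral_coord_measure[symmetric] borel_measurable_nn_integral_coord) measurable
  finally show ?thesis .
qed

lemma coord_measure_UNIV: "coord_measure UNIV = (lborel :: (real^'n) measure)"
proof (rule lborel_eqI[symmetric])
  interpret product_sigma_finite "\<lambda>_. lborel :: real measure" ..
  fix l u :: "real^'n" assume lu: "\<And>b. b \<in> Basis \<Longrightarrow> l \<bullet> b \<le> u \<bullet> b"
  have le: "l $ i \<le> u $ i" for i using lu[of "axis i 1"] by (simp add: inner_axis)
  have "coord_emb UNIV -` box l u \<inter> space (Pi\<^sub>M UNIV (\<lambda>_. lborel)) = Pi\<^sub>E UNIV (\<lambda>i. {l $ i<..<u $ i})"
    by (auto simp: mem_box_cart space_PiM PiE_def Pi_def)
  then have "emeasure (coord_measure UNIV) (box l u) = (\<Prod>i\<in>UNIV. ennreal (u $ i - l $ i))"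
    by (subst emeasure_coord_measure) (simp_all add: emeasure_PiM le)
  also have "\<dots> = ennreal (\<Prod>b\<in>Basis. (u - l) \<bullet> b)"
    unfolding prod_Basis_vec by (simp add: prod_ennreal le)
  finally show "emeasure (coord_measure UNIV) (box l u) = ennreal (\<Prod>b\<in>Basis. (u - l) \<bullet> b)" .
qed simp

lemma nn_integral_lborel_coord:
  fixes h :: "real^'n \<Rightarrow> ennreal"
  assumes h: "h \<in> borel_measurable borel"
  shows "(\<integral>\<^sup>+z. h z \<partial>lborel)
    = (\<integral>\<^sup>+x. \<integral>\<^sup>+y. h (coord_proj I x + coord_proj (-I) y) \<partial>coord_measure (-I) \<partial>coord_measure I)"
  using nn_integral_coord_Un[of I "-I" h] h by (simp add: coord_measure_UNIV)

lemma nn_integral_coord_singleton: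
  assumes h[measurable]: "h \<in> borel_measurable borel"
  shows "(\<integral>\<^sup>+x. h x \<partial>coord_measure {i}) = (\<integral>\<^sup>+t. h (t *\<^sub>R axis i 1) \<partial>lborel)"
proof -
  interpret product_sigma_finite "\<lambda>_. lborel :: real measure" ..
  have "coord_emb {i} f = f i *\<^sub>R axis i 1" for f by (auto simp: vec_eq_iff axis_def)
  then have "(\<integral>\<^sup>+x. h x \<partial>coord_measure {i}) = (\<integral>\<^sup>+f. h (f i *\<^sub>R axis i 1) \<partial>Pi\<^sub>M {i} (\<lambda>_. lborel))"
    by (simp add: nn_integral_coord_measure)
  also have "\<dots> = (\<integral>\<^sup>+t. h (t *\<^sub>R axis i 1) \<partial>lborel)"
    by (rule product_nn_integral_singleton) measurable
  finally show ?thesis .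
qed

text \<open>The indicator of this cylinder is a factor of integral 1, by which integrals over the
  complementary coordinate subspace are lifted to the whole space in
  \<open>nn_integral_coord_linear\<close>.\<close>

definition coord_cube :: "'n set \<Rightarrow> (real^'n) set" where
  "coord_cube I = {x. \<forall>i\<in>I. 0 \<le> x $ i \<and> x $ i \<le> 1}"

lemma coord_cube_measurable [measurable]: "coord_cube I \<in> sets (borel :: (real^'n) measure)"
proof -
  have "closed (coord_cube I :: (real^'n) set)"
    unfolding coord_cube_def Ball_def
    by (intro closed_Collect_all closed_Collect_imp closed_Collect_conj closed_Collect_le continuous_intros) auto
  then show ?thesis by simp
qed

lemma emeasure_coord_cube: "emeasure (coord_measure I) (coord_cube I) = 1"
proof -
  interpret product_sigma_finite "\<lambda>_. lborel :: real measure" ..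
  have "coord_emb I -` coord_cube I \<inter> space (Pi\<^sub>M I (\<lambda>_. lborel)) = Pi\<^sub>E I (\<lambda>i. {0..1})"
    by (auto simp: coord_cube_def space_PiM PiE_def Pi_def)
  then show ?thesis
    by (subst emeasure_coord_measure) (simp_all add: emeasure_PiM coord_cube_measurable)
qed

theorem isodiametric_coord:
  fixes A :: "(real^'n) set"
  assumes A: "A \<in> sets borel" and d: "d \<ge> 0" and diam: "\<And>x y. x \<in> A \<Longrightarrow> y \<in> A \<Longrightarrow> dist (coord_proj I x) (coord_proj I y) \<le> d"
  shows "emeasure (coord_measure I) A \<le> ennreal (unit_ball_vol (card I) * (d / 2) ^ card I)"
proof -
  have "(\<Sum>j\<in>I. (f j - g j)\<^sup>2) \<le> d\<^sup>2" if "coord_emb I f \<in> A" "coord_emb I g \<in> A" for f g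
  proof -
    have "(\<Sum>j\<in>I. (f j - g j)\<^sup>2) = (\<Sum>j\<in>UNIV. (coord_emb I f $ j - coord_emb I g $ j)\<^sup>2)"
      by (rule sum.mono_neutral_cong_left) auto
    also have "\<dots> = (dist (coord_emb I f) (coord_emb I g))\<^sup>2"
      by (simp add: dist_norm norm_eq_sqrt_inner inner_vec_def sum_nonneg power2_eq_square)
    also have "\<dots> \<le> d\<^sup>2" using diam[OF that] by (intro power_mono) auto
    finally show ?thesis .
  qed
  then show ?thesis
    unfolding emeasure_coord_measure[OF A]
    by (intro isodiametric_PiM d) (use A in auto)
qed

text \<open>D acts on the J coordinates and fixes the others. The function h on the subspace is
  multiplied by the indicator of the unit cube in the other coordinates, the formula for the whole
  space is applied to the product H, and Fubini removes the cube on both sides.\<close>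

theorem nn_integral_coord_linear:
  fixes D :: "real^'n \<Rightarrow> real^'n"
  assumes D: "linear D" and det: "det (matrix D) \<noteq> 0"
    and J: "\<And>x. coord_proj J (D (coord_proj J x)) = D (coord_proj J x)"
    and I: "\<And>x. D (coord_proj (-J) x) = coord_proj (-J) x"
    and h[measurable]: "h \<in> borel_measurable borel"
  shows "(\<integral>\<^sup>+x. h x \<partial>coord_measure J)
    = ennreal \<bar>det (matrix D)\<bar> * (\<integral>\<^sup>+x. h (D (coord_proj J x)) \<partial>coord_measure J)"
proof -
  note [measurable] = measurable_linear_borel[OF D]
  define H where "H x = h (coord_proj J x) * indicator (coord_cube (-J)) x" for x
  have H[measurable]: "H \<in> borel_measurable borel" unfolding H_def by measurable
  have *: "(\<integral>\<^sup>+y. c * indicator (coord_cube (-J)) (y :: real^'n) \<partial>coord_measure (-J)) = c" for c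
    using emeasure_coord_cube[of "-J"] by (subst nn_integral_cmult) simp_all
  have cube: "x + coord_proj (-J) y \<in> coord_cube (-J) \<longleftrightarrow> y \<in> coord_cube (-J)"
    if "coord_proj J x = x" for x y :: "real^'n"
  proof -
    have "x $ i = 0" if "i \<notin> J" for i
      using \<open>coord_proj J x = x\<close> that by (metis coord_proj_nth)
    then show ?thesis by (auto simp: coord_cube_def)
  qed
  have "H (coord_proj J x + coord_proj (-J) y) = h (coord_proj J x) * indicator (coord_cube (-J)) y" for x y
    using cube[of "coord_proj J x" y] by (simp add: H_def coord_proj_add indicator_def)
  then have 1: "(\<integral>\<^sup>+z. H z \<partial>lborel) = (\<integral>\<^sup>+x. h (coord_proj J x) \<partial>coord_measure J)"
    unfolding nn_integral_lborel_coord[OF H, of J] by (simp add: *)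
  have "H (D (coord_proj J x + coord_proj (-J) y)) = h (D (coord_proj J x)) * indicator (coord_cube (-J)) y" for x y
    using cube[of "D (coord_proj J x)" y] J[of x] I[of y]
    by (simp add: H_def coord_proj_add indicator_def linear_add[OF D])
  then have 2: "(\<integral>\<^sup>+z. H (D z) \<partial>lborel) = (\<integral>\<^sup>+x. h (D (coord_proj J x)) \<partial>coord_measure J)"
    by (subst nn_integral_lborel_coord[of _ J]) (measurable, simp add: *)
  show ?thesis
    using nn_integral_linear_vimage[OF D det H] 1 2 nn_integral_coord_proj[OF h, of J] by simp
qed

section \<open>The sphere in a coordinate subspace\<close>

text \<open>Reflection in the hyperplane orthogonal to a. For a = 0 it is the identity, which
  \<open>householder_swap\<close> uses when x = y.\<close>

definition householder :: "real^'n \<Rightarrow> real^'n \<Rightarrow> real^'n" where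
  "householder a x = x - (2 * (x \<bullet> a) / (a \<bullet> a)) *\<^sub>R a"

lemma linear_householder: "linear (householder a)"
  by (rule linearI)
     (simp_all add: householder_def inner_add_left scaleR_diff_right add_divide_distrib ring_distribs
        scaleR_add_left)

lemma householder_inner: "householder a x \<bullet> householder a y = x \<bullet> y"
proof (cases "a = 0")
  case False
  define c where "c = 2 * (x \<bullet> a) / (a \<bullet> a)"
  define d where "d = 2 * (y \<bullet> a) / (a \<bullet> a)"
  have c: "c * (a \<bullet> a) = 2 * (x \<bullet> a)" and cd: "c * (y \<bullet> a) = d * (x \<bullet> a)"
    using False by (simp_all add: c_def d_def)
  have "householder a x \<bullet> householder a y
      = x \<bullet> y - d * (x \<bullet> a) - c * (y \<bullet> a) + d * (c * (a \<bullet> a))"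
    unfolding householder_def c_def[symmetric] d_def[symmetric]
    by (simp only: inner_diff_left inner_diff_right inner_scaleR_left inner_scaleR_right inner_commute[of a y]) algebra
  then show ?thesis unfolding c cd by simp
qed (simp add: householder_def)

lemma orthogonal_householder: "orthogonal_transformation (householder a)"
  by (simp add: orthogonal_transformation_def linear_householder householder_inner)

lemma householder_swap:
  assumes "norm x = 1" "norm y = 1"
  shows "householder (x - y) x = y"
proof (cases "x = y")
  case False
  have "x \<bullet> x = 1" "y \<bullet> y = 1" using assms by (simp_all add: norm_eq_1)
  then have "(x - y) \<bullet> (x - y) = 2 * (x \<bullet> (x - y))"
    by (simp add: inner_diff_left inner_diff_right inner_commute)
  moreover have "(x - y) \<bullet> (x - y) \<noteq> 0" using False by simp
  ultimately have "2 * (x \<bullet> (x - y)) / ((x - y) \<bullet> (x - y)) = 1" by simp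
  then show ?thesis unfolding householder_def by (simp only: scaleR_one) simp
qed (simp add: householder_def)

lemma det_orthogonal_transformation:
  fixes R :: "real^'n \<Rightarrow> real^'n"
  assumes "orthogonal_transformation R"
  shows "\<bar>det (matrix R)\<bar> = 1"
  using assms det_orthogonal_matrix[of "matrix R"] by (auto simp: orthogonal_transformation_matrix)

lemma nn_integral_power_Icc:
  assumes "e > 0"
  shows "(\<integral>\<^sup>+t. ennreal (t ^ p) * indicator {0<..e} t \<partial>lborel) = ennreal (e ^ Suc p / real (Suc p))"
proof -
  have "(\<integral>\<^sup>+t. ennreal (t ^ p) * indicator {0<..e} t \<partial>lborel) = (\<integral>\<^sup>+t. ennreal (t ^ p) * indicator {0..e} t \<partial>lborel)"
  proof (rule nn_integral_cong_AE)
    show "AE t in lborel. ennreal (t ^ p) * indicator {0<..e} t = ennreal (t ^ p) * indicator {0..e} t"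
      using AE_lborel_singleton[of "0::real"] by eventually_elim (auto simp: indicator_def)
  qed
  also have "\<dots> = ennreal (e ^ Suc p / real (Suc p) - 0 ^ Suc p / real (Suc p))"
  proof (rule nn_integral_FTC_Icc)
    show "((\<lambda>t. t ^ Suc p / real (Suc p)) has_real_derivative t ^ p) (at t)" for t
      by (auto intro!: derivative_eq_intros simp del: of_nat_Suc power_Suc)
  qed (use assms in auto)
  finally show ?thesis by simp
qed

section \<open>Narrow cones over small pieces of the sphere\<close>

text \<open>Slices orthogonal to the axis of a narrow cone are, up to scaling, central projections of
  its spherical part.\<close>
lemma cone_slice_dist:
  fixes e u1 u2 :: "'a::real_inner"
  assumes e: "norm e = 1" and d: "0 < d" "d < 1"
    and u: "norm u1 = 1" "norm u2 = 1" "dist e u1 < d" "dist e u2 < d"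
  shows "norm (u1 /\<^sub>R (u1 \<bullet> e) - u2 /\<^sub>R (u2 \<bullet> e)) \<le> (1 + d) / (1 - d)\<^sup>2 * dist u1 u2"
proof -
  have low: "1 - d < u \<bullet> e" if "norm u = 1" "dist e u < d" for u
  proof -
    have "1 - u \<bullet> e = (e - u) \<bullet> e" using e by (simp add: inner_diff_left norm_eq_1)
    also have "\<dots> \<le> norm (e - u) * norm e" by (rule norm_cauchy_schwarz)
    finally show ?thesis using that e by (simp add: dist_norm)
  qed
  define a1 a2 where "a1 = u1 \<bullet> e" and "a2 = u2 \<bullet> e"
  have a: "1 - d < a1" "1 - d < a2" using low u by (simp_all add: a1_def a2_def)
  have a1': "a2 \<le> 1" unfolding a2_def using norm_cauchy_schwarz[of u2 e] u e by simp
  have da: "\<bar>a2 - a1\<bar> \<le> dist u1 u2"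
    using Cauchy_Schwarz_ineq2[of "u2 - u1" e] e
    by (simp add: a1_def a2_def inner_diff_left dist_norm norm_minus_commute)
  have proj: "norm (x - (x \<bullet> e) *\<^sub>R e) \<le> norm x" for x
  proof -
    have ee: "e \<bullet> e = 1" using e by (simp add: norm_eq_1)
    have "(norm (x - (x \<bullet> e) *\<^sub>R e))\<^sup>2 = (norm x)\<^sup>2 - (x \<bullet> e)\<^sup>2"
      by (simp only: power2_norm_eq_inner inner_diff_left inner_diff_right inner_scaleR_left
          inner_scaleR_right inner_commute[of e x] ee) algebra
    then show ?thesis by (metis diff_le_eq le_add_same_cancel1 norm_ge_zero power2_le_imp_le zero_le_power2)
  qed
  define w where "w = (u1 - u2) - ((u1 - u2) \<bullet> e) *\<^sub>R e"
  define v where "v = (u2 - e) - ((u2 - e) \<bullet> e) *\<^sub>R e"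
  have "norm w \<le> dist u1 u2" unfolding w_def dist_norm by (rule proj)
  have "norm v \<le> dist e u2" unfolding v_def dist_norm norm_minus_commute[of e u2] by (rule proj)
  have v: "v = u2 - a2 *\<^sub>R e" using e by (simp add: v_def a2_def inner_diff_left norm_eq_1 algebra_simps)
  have w: "w = u1 - u2 - (a1 - a2) *\<^sub>R e" by (simp add: w_def a1_def a2_def inner_diff_left)
  \<comment> \<open>The vectors w and v are the components of u1 - u2 and u2 - e orthogonal to e.
    The first term has the factor a2 \<le> 1, and the second is a product of two small quantities,
    which yields the constant 1 + d.\<close>
  have "a2 *\<^sub>R u1 - a1 *\<^sub>R u2 = a2 *\<^sub>R w + (a2 - a1) *\<^sub>R v"
    unfolding v w by (simp add: algebra_simps)
  then have "norm (a2 *\<^sub>R u1 - a1 *\<^sub>R u2) \<le> a2 * norm w + \<bar>a2 - a1\<bar> * norm v"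
    using a d norm_triangle_ineq[of "a2 *\<^sub>R w" "(a2 - a1) *\<^sub>R v"] by simp
  also have "\<dots> \<le> 1 * dist u1 u2 + dist u1 u2 * d"
    using a d a1' da \<open>norm w \<le> _\<close> \<open>norm v \<le> _\<close> u(4) by (intro add_mono mult_mono) auto
  finally have num: "norm (a2 *\<^sub>R u1 - a1 *\<^sub>R u2) \<le> (1 + d) * dist u1 u2" by (simp add: algebra_simps)
  have pos: "a1 > 0" "a2 > 0" using a d by linarith+
  have "u1 /\<^sub>R a1 - u2 /\<^sub>R a2 = (a2 *\<^sub>R u1 - a1 *\<^sub>R u2) /\<^sub>R (a1 * a2)"
  proof -
    have "inverse (a1 * a2) * a2 = inverse a1" "inverse (a1 * a2) * a1 = inverse a2"
      using pos by (simp_all add: field_simps)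
    then show ?thesis by (simp only: scaleR_diff_right scaleR_scaleR)
  qed
  then have "norm (u1 /\<^sub>R a1 - u2 /\<^sub>R a2) = norm (a2 *\<^sub>R u1 - a1 *\<^sub>R u2) / (a1 * a2)"
    using pos by (simp add: divide_inverse mult.commute)
  also have "\<dots> \<le> (1 + d) * dist u1 u2 / ((1 - d) * (1 - d))"
    using num a d pos by (intro frac_le mult_mono) auto
  finally show ?thesis by (simp add: a1_def a2_def power2_eq_square)
qed

lemma cone_axis_bounds:
  fixes e z :: "'a::real_inner"
  assumes e: "norm e = 1" and d: "d < 1" and z: "z \<noteq> 0" "dist e (sgn z) < d"
  shows "0 < z \<bullet> e" "z \<bullet> e \<le> norm z" "norm z \<le> (z \<bullet> e) / (1 - d)"
proof -
  have "1 - sgn z \<bullet> e = (e - sgn z) \<bullet> e" using e by (simp add: inner_diff_left norm_eq_1)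
  also have "\<dots> \<le> norm (e - sgn z) * norm e" by (rule norm_cauchy_schwarz)
  finally have 1: "1 - d < sgn z \<bullet> e" using z e by (simp add: dist_norm)
  have 2: "z \<bullet> e = norm z * (sgn z \<bullet> e)" using z by (simp add: sgn_div_norm)
  show "z \<bullet> e \<le> norm z" using norm_cauchy_schwarz[of z e] e by simp
  show "0 < z \<bullet> e" unfolding 2 using 1 d z by simp
  have "norm z * (1 - d) \<le> z \<bullet> e" unfolding 2 using 1 by (intro mult_left_mono) auto
  then show "norm z \<le> (z \<bullet> e) / (1 - d)" using d by (simp add: field_simps)
qed

text \<open>The cone is sliced orthogonally to its axis. The slice at height t has diameter at most
  t \<kappa> D by \<open>cone_slice_dist\<close>, so the isodiametric inequality bounds its measure
  by t^(card J - 1) \<omega>, and norms on it are at most t/(1 - d). Integrating t^(card J - 1 + i)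
  over heights up to \<epsilon> gives the leading constant.\<close>

lemma narrow_cone_measure:
  fixes J :: "'n::finite set" and C :: "(real^'n) set"
  assumes j: "j \<in> J" and d: "0 < d" "d < 1" and \<epsilon>: "\<epsilon> > 0" and D: "D \<ge> 0"
    and C[measurable]: "C \<in> sets borel" and ball: "C \<subseteq> ball (axis j 1) d"
    and diam: "\<And>x y. x \<in> C \<Longrightarrow> y \<in> C \<Longrightarrow> dist x y \<le> D"
  shows "(\<integral>\<^sup>+w. indicator {z. z \<noteq> 0 \<and> norm z \<le> \<epsilon> \<and> sgn z \<in> C} (coord_proj J w) * ennreal (norm (coord_proj J w) ^ i)
            \<partial>coord_measure J)
     \<le> ennreal (\<epsilon> ^ (card J + i) / real (card J + i) * ((1 / (1 - d)) ^ i *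
          (unit_ball_vol (card J - 1) * (((1 + d) / (1 - d)\<^sup>2 * D) / 2) ^ (card J - 1))))"
proof -
  define e :: "real^'n" where "e = axis j 1"
  have e: "norm e = 1" by (simp add: e_def)
  define K where "K = J - {j}"
  have J: "J = {j} \<union> K" "{j} \<inter> K = {}" using j by (auto simp: K_def)
  have cK: "card K = card J - 1" using j by (simp add: K_def)
  have cJ: "card J > 0" using j by (simp add: card_gt_0_iff finite_subset[OF subset_UNIV] ) auto
  define \<kappa> where "\<kappa> = (1 + d) / (1 - d)\<^sup>2"
  have \<kappa>: "\<kappa> \<ge> 0" using d by (simp add: \<kappa>_def)
  define \<omega> where "\<omega> = unit_ball_vol (card K) * ((\<kappa> * D) / 2) ^ card K"
  have \<omega>: "\<omega> \<ge> 0"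
    unfolding \<omega>_def using D \<kappa> by simp
  define Z where "Z = {z :: real^'n. z \<noteq> 0 \<and> norm z \<le> \<epsilon> \<and> sgn z \<in> C}"
  have Z[measurable]: "Z \<in> sets borel" unfolding Z_def by measurable
  define F where "F z = indicator Z z * ennreal (norm z ^ i)" for z :: "real^'n"
  have F[measurable]: "F \<in> borel_measurable borel" unfolding F_def by measurable
  have Ze: "0 < z \<bullet> e" "z \<bullet> e \<le> \<epsilon>" "norm z \<le> (z \<bullet> e) / (1 - d)" if "z \<in> Z" for z
  proof -
    have "z \<noteq> 0" "dist e (sgn z) < d" "norm z \<le> \<epsilon>" using that ball by (auto simp: Z_def e_def)
    from cone_axis_bounds[OF e d(2) this(1,2)] this(3)
    show "0 < z \<bullet> e" "z \<bullet> e \<le> \<epsilon>" "norm z \<le> (z \<bullet> e) / (1 - d)" by auto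
  qed
  have proj1: "coord_proj {j} (t *\<^sub>R e) = t *\<^sub>R e" for t by (auto simp: vec_eq_iff e_def axis_def)
  have slice: "(t *\<^sub>R e + coord_proj K y) \<bullet> e = t" for t y
    using J(2) by (simp add: e_def inner_axis)
  have inner: "(\<integral>\<^sup>+y. F (t *\<^sub>R e + coord_proj K y) \<partial>coord_measure K)
      \<le> ennreal ((1 / (1 - d)) ^ i * \<omega>) * (ennreal (t ^ (card K + i)) * indicator {0<..\<epsilon>} t)" for t
  proof (cases "t \<in> {0<..\<epsilon>}")
    case False
    then have "t *\<^sub>R e + coord_proj K y \<notin> Z" for y using Ze[of "t *\<^sub>R e + coord_proj K y"] slice[of t y] by auto
    then have "F (t *\<^sub>R e + coord_proj K y) = 0" for y by (simp add: F_def)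
    then show ?thesis by simp
  next
    case True
    then have t: "0 < t" "t \<le> \<epsilon>" by auto
    define S where "S = {y. t *\<^sub>R e + coord_proj K y \<in> Z}"
    have S[measurable]: "S \<in> sets borel"
      unfolding S_def by measurable
    have "emeasure (coord_measure K) S \<le> ennreal (unit_ball_vol (card K) * ((t * (\<kappa> * D)) / 2) ^ card K)"
    proof (rule isodiametric_coord[OF S])
      show "0 \<le> t * (\<kappa> * D)" using t \<kappa> D by simp
      fix x y assume x: "x \<in> S" and y: "y \<in> S"
      define u v where "u = t *\<^sub>R e + coord_proj K x" and "v = t *\<^sub>R e + coord_proj K y"
      have u: "u \<in> Z" "u \<bullet> e = t" and v: "v \<in> Z" "v \<bullet> e = t"
        using x y slice by (simp_all add: S_def u_def v_def)
      \<comment> \<open>A point of the cone is its height times the central projection of its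
        direction to the hyperplane at height 1.\<close>
      have sg: "z = (z \<bullet> e) *\<^sub>R (sgn z /\<^sub>R (sgn z \<bullet> e))" if "z \<in> Z" for z
      proof -
        have "(z \<bullet> e) * (norm z * inverse (z \<bullet> e) * inverse (norm z)) = 1"
          using that Ze(1)[OF that] by (simp add: Z_def field_simps)
        then show ?thesis by (simp add: sgn_div_norm)
      qed
      have "coord_proj K x - coord_proj K y = u - v" by (simp add: u_def v_def)
      also have "\<dots> = t *\<^sub>R (sgn u /\<^sub>R (sgn u \<bullet> e) - sgn v /\<^sub>R (sgn v \<bullet> e))"
        using sg[OF u(1)] sg[OF v(1)] u v by (metis scaleR_diff_right)
      finally have "dist (coord_proj K x) (coord_proj K y)
          = t * norm (sgn u /\<^sub>R (sgn u \<bullet> e) - sgn v /\<^sub>R (sgn v \<bullet> e))"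
        using t by (simp add: dist_norm)
      also have "\<dots> \<le> t * (\<kappa> * dist (sgn u) (sgn v))"
        unfolding \<kappa>_def using u v ball t
        by (intro mult_left_mono cone_slice_dist e d) (auto simp: Z_def e_def norm_sgn)
      also have "\<dots> \<le> t * (\<kappa> * D)"
        using u v t \<kappa> by (intro mult_left_mono diam) (auto simp: Z_def)
      finally show "dist (coord_proj K x) (coord_proj K y) \<le> t * (\<kappa> * D)" .
    qed
    also have "unit_ball_vol (card K) * ((t * (\<kappa> * D)) / 2) ^ card K = t ^ card K * \<omega>"
      by (simp add: \<omega>_def power_mult_distrib power_divide)
    finally have S_le: "emeasure (coord_measure K) S \<le> ennreal (t ^ card K * \<omega>)" .
    have "(\<integral>\<^sup>+y. F (t *\<^sub>R e + coord_proj K y) \<partial>coord_measure K)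
        \<le> (\<integral>\<^sup>+y. ennreal ((t / (1 - d)) ^ i) * indicator S y \<partial>coord_measure K)"
    proof (rule nn_integral_mono)
      fix y
      show "F (t *\<^sub>R e + coord_proj K y) \<le> ennreal ((t / (1 - d)) ^ i) * indicator S y"
      proof (cases "y \<in> S")
        case True
        then have "t *\<^sub>R e + coord_proj K y \<in> Z" by (simp add: S_def)
        from Ze(3)[OF this] show ?thesis using True slice[of t y]
          by (auto simp: F_def S_def intro!: ennreal_leI power_mono)
      qed (simp add: F_def S_def)
    qed
    also have "\<dots> = ennreal ((t / (1 - d)) ^ i) * emeasure (coord_measure K) S"
      by (simp add: nn_integral_cmult)
    also have "\<dots> \<le> ennreal ((t / (1 - d)) ^ i) * ennreal (t ^ card K * \<omega>)"
      by (intro mult_left_mono S_le) simp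
    also have "\<dots> = ennreal ((1 / (1 - d)) ^ i * \<omega>) * ennreal (t ^ (card K + i))"
      using t d \<omega> by (simp add: power_divide power_add field_simps flip: ennreal_mult)
    finally show ?thesis using True by simp
  qed
  have "(\<integral>\<^sup>+w. F (coord_proj J w) \<partial>coord_measure J) = (\<integral>\<^sup>+w. F w \<partial>coord_measure J)"
    by (rule nn_integral_coord_proj) measurable
  also have "\<dots> = (\<integral>\<^sup>+x. \<integral>\<^sup>+y. F (coord_proj {j} x + coord_proj K y) \<partial>coord_measure K \<partial>coord_measure {j})"
    unfolding J(1) by (rule nn_integral_coord_Un[OF J(2)]) measurable
  also have "\<dots> = (\<integral>\<^sup>+t. \<integral>\<^sup>+y. F (coord_proj {j} (t *\<^sub>R e) + coord_proj K y) \<partial>coord_measure K \<partial>lborel)"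
    unfolding e_def by (intro nn_integral_coord_singleton borel_measurable_nn_integral_coord) measurable
  also have "\<dots> \<le> (\<integral>\<^sup>+t. ennreal ((1 / (1 - d)) ^ i * \<omega>) * (ennreal (t ^ (card K + i)) * indicator {0<..\<epsilon>} t) \<partial>lborel)"
    unfolding proj1 by (intro nn_integral_mono inner)
  also have "\<dots> = ennreal ((1 / (1 - d)) ^ i * \<omega>) * ennreal (\<epsilon> ^ Suc (card K + i) / real (Suc (card K + i)))"
    by (subst nn_integral_cmult) (simp_all add: nn_integral_power_Icc[OF \<epsilon>] del: power_Suc of_nat_Suc)
  also have "Suc (card K + i) = card J + i" using cK cJ by simp
  also have "ennreal ((1 / (1 - d)) ^ i * \<omega>) * ennreal (\<epsilon> ^ (card J + i) / real (card J + i))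
     = ennreal (\<epsilon> ^ (card J + i) / real (card J + i) * ((1 / (1 - d)) ^ i * \<omega>))"
    using \<omega> \<epsilon> d by (simp add: mult.commute flip: ennreal_mult)
  finally show ?thesis by (simp add: F_def Z_def \<omega>_def \<kappa>_def cK)
qed

section \<open>Radial projection of the fibre onto the sphere\<close>

definition coord_sphere :: "'n set \<Rightarrow> (real^'n) set" where
  "coord_sphere J = {w. coord_proj J w = w \<and> norm w = 1}"

lemma compact_coord_sphere: "compact (coord_sphere J :: (real^'n) set)"
proof -
  have "closed {w :: real^'n. coord_proj J w = w}"
    by (intro closed_Collect_eq linear_continuous_on continuous_intros)
       (simp add: linear_conv_bounded_linear[symmetric] linear_coord_proj)
  then have "compact (sphere 0 1 \<inter> {w :: real^'n. coord_proj J w = w})"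
    by (intro compact_Int_closed) simp
  moreover have "coord_sphere J = sphere 0 1 \<inter> {w :: real^'n. coord_proj J w = w}"
    by (auto simp: coord_sphere_def)
  ultimately show ?thesis by simp
qed

text \<open>The distortion in \<open>narrow_cone_measure\<close> tends to 1 as the cone
  narrows.\<close>

lemma small_cone_constant:
  assumes e: "e > (1::real)"
  shows "\<exists>d. 0 < d \<and> d < 1 \<and> (1 / (1 - d)) ^ i * ((1 + d) / (1 - d)\<^sup>2) ^ k \<le> e"
proof -
  have "((\<lambda>d::real. (1 / (1 - d)) ^ i * ((1 + d) / (1 - d)\<^sup>2) ^ k) \<longlongrightarrow>
      (1 / (1 - 0)) ^ i * ((1 + 0) / (1 - 0)\<^sup>2) ^ k) (at_right 0)"
    by (intro tendsto_intros) auto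
  then have "eventually (\<lambda>d. (1 / (1 - d)) ^ i * ((1 + d) / (1 - d)\<^sup>2) ^ k < e) (at_right 0)"
    using e by (intro order_tendstoD) auto
  moreover have "eventually (\<lambda>d::real. d \<in> {0<..<1}) (at_right 0)"
    by (rule eventually_at_right_real) simp
  ultimately have "eventually (\<lambda>d. (1 / (1 - d)) ^ i * ((1 + d) / (1 - d)\<^sup>2) ^ k < e \<and> d \<in> {0<..<1}) (at_right 0)"
    by (rule eventually_conj)
  then obtain d where "(1 / (1 - d)) ^ i * ((1 + d) / (1 - d)\<^sup>2) ^ k < e \<and> d \<in> {0<..<1}"
    using eventually_happens'[OF trivial_limit_at_right_real] by blast
  then show ?thesis by (intro exI[of _ d]) auto
qed

text \<open>The measure \<nu> is the image, under the radial projection followed by R, of the ball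
  in the fibre with weight norm^i / c. Its mass on a small piece of the sphere is that of a narrow
  cone, so \<open>emeasure_le_hausdorff_measure\<close> bounds \<nu> by Hausdorff measure. In the
  application R takes the coordinate sphere to the unit normal sphere.\<close>

theorem sphere_integral_le:
  fixes R :: "real^'n \<Rightarrow> real^'n"
  assumes R: "orthogonal_transformation R" and J: "J \<noteq> {}" and \<epsilon>: "\<epsilon> > 0"
    and g[measurable]: "g \<in> borel_measurable borel"
  shows "(\<integral>\<^sup>+w. indicator {z. z \<noteq> 0 \<and> norm z \<le> \<epsilon>} (coord_proj J w) * ennreal (norm (coord_proj J w) ^ i)
            * g (R (sgn (coord_proj J w))) \<partial>coord_measure J)
    \<le> ennreal (\<epsilon> ^ (card J + i) / real (card J + i)) *
        (\<integral>\<^sup>+v. g v * indicator (R ` coord_sphere J) v \<partial>hausdorff_measure (card J - 1))"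
proof -
  let ?H = "hausdorff_measure (card J - 1) :: (real^'n) measure"
  let ?S = "R ` coord_sphere J"
  \<comment> \<open>The integral of r^(card J + i - 1) from 0 to \<epsilon>; dividing by it
    normalises \<nu>.\<close>
  define c where "c = \<epsilon> ^ (card J + i) / real (card J + i)"
  have cJ: "card J > 0" using J by (simp add: card_gt_0_iff)
  then have c: "c > 0" using \<epsilon> by (simp add: c_def)
  have linR: "linear R" using R by (simp add: orthogonal_transformation_def)
  note [measurable] = measurable_linear_borel[OF linR]
  have normR: "norm (R x) = norm x" for x using R by (rule orthogonal_transformation_norm)
  have distR: "dist (R x) (R y) = dist x y" for x y
    by (simp add: dist_norm linear_diff[OF linR, symmetric] normR)
  have S[measurable]: "?S \<in> sets borel"
    using compact_continuous_image[OF linear_continuous_on compact_coord_sphere] linR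
    by (intro borel_compact) (auto simp: linear_conv_bounded_linear)
  define W where "W z = indicator {z. z \<noteq> 0 \<and> norm z \<le> \<epsilon>} z * ennreal (norm z ^ i)" for z :: "real^'n"
  have W[measurable]: "W \<in> borel_measurable borel" unfolding W_def by measurable
  define T where "T w = R (sgn (coord_proj J w))" for w
  have T[measurable]: "T \<in> borel_measurable borel" unfolding T_def by measurable
  \<comment> \<open>W vanishes at the origin, the only point of the fibre that the radial projection
    does not send to the sphere.\<close>
  have TS: "T w \<in> ?S" if "W (coord_proj J w) \<noteq> 0" for w
  proof -
    have "coord_proj J w \<noteq> 0" using that by (auto simp: W_def indicator_def)
    then have "sgn (coord_proj J w) \<in> coord_sphere J"
      by (simp add: coord_sphere_def norm_sgn sgn_div_norm coord_proj_scaleR)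
    then show ?thesis by (simp add: T_def)
  qed
  define \<nu> where "\<nu> = distr (density (coord_measure J) (\<lambda>w. ennreal (1 / c) * W (coord_proj J w))) borel T"
  have sets\<nu>: "sets \<nu> = sets borel" by (simp add: \<nu>_def)
  have int\<nu>: "(\<integral>\<^sup>+v. h v \<partial>\<nu>) = ennreal (1 / c) * (\<integral>\<^sup>+w. W (coord_proj J w) * h (T w) \<partial>coord_measure J)"
    if [measurable]: "h \<in> borel_measurable borel" for h
    unfolding \<nu>_def by (simp add: nn_integral_distr nn_integral_density mult.assoc nn_integral_cmult)
  have em\<nu>: "emeasure \<nu> A = ennreal (1 / c) * (\<integral>\<^sup>+w. W (coord_proj J w) * indicator A (T w) \<partial>coord_measure J)"
    if "A \<in> sets borel" for A
    using int\<nu>[of "indicator A"] that by (simp add: sets\<nu>)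
  have local: "\<exists>r>0. \<forall>C. C \<in> sets borel \<longrightarrow> C \<noteq> {} \<longrightarrow> C \<subseteq> A \<inter> ball x r \<longrightarrow>
      emeasure \<nu> C \<le> ennreal (e * (unit_ball_vol (card J - 1) * (diameter C / 2) ^ (card J - 1)))"
    if A: "A \<subseteq> ?S" and x: "x \<in> A" and e: "e > 1" for A x e
  proof -
    obtain d where d: "0 < d" "d < 1" "(1 / (1 - d)) ^ i * ((1 + d) / (1 - d)\<^sup>2) ^ (card J - 1) \<le> e"
      using small_cone_constant[OF e] by blast
    obtain w0 where w0: "w0 \<in> coord_sphere J" "x = R w0" using A x by blast
    obtain j where j: "j \<in> J" using J by blast
    \<comment> \<open>The cone estimate is for cones around a coordinate axis. The reflection that
      exchanges this axis with w0 preserves the subspace of J and fixes its complement, since a lies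
      in that subspace.\<close>
    define a where "a = axis j 1 - w0"
    have aJ: "coord_proj J a = a"
      using w0(1) j by (simp add: a_def coord_proj_diff coord_sphere_def) (auto simp: vec_eq_iff axis_def)
    define Q where "Q = householder a"
    have Q: "orthogonal_transformation Q" "linear Q" by (simp_all add: Q_def orthogonal_householder linear_householder)
    have Qe: "Q (axis j 1) = w0"
      unfolding Q_def a_def using w0(1) by (intro householder_swap) (auto simp: coord_sphere_def)
    have normQ: "norm (Q z) = norm z" for z using Q(1) by (rule orthogonal_transformation_norm)
    have distQ: "dist (Q z) (Q y) = dist z y" for z y
      by (simp add: dist_norm linear_diff[OF Q(2), symmetric] normQ)
    have detQ: "\<bar>det (matrix Q)\<bar> = 1" by (rule det_orthogonal_transformation[OF Q(1)])
    have sgnQ: "sgn (Q z) = Q (sgn z)" for z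
      by (simp add: sgn_div_norm normQ linear_scale[OF Q(2)])
    have QJ: "coord_proj J (Q (coord_proj J z)) = Q (coord_proj J z)" for z
      by (simp add: Q_def householder_def coord_proj_diff coord_proj_scaleR aJ)
    have QI: "Q (coord_proj (-J) z) = coord_proj (-J) z" for z
    proof -
      have "coord_proj (-J) z \<bullet> a = coord_proj (-J) z \<bullet> coord_proj J a" by (simp add: aJ)
      also have "\<dots> = coord_proj J (coord_proj (-J) z) \<bullet> a" by (simp add: inner_coord_proj)
      finally show ?thesis by (simp add: Q_def householder_def)
    qed
    note [measurable] = measurable_linear_borel[OF Q(2)]
    have "emeasure \<nu> C \<le> ennreal (e * (unit_ball_vol (card J - 1) * (diameter C / 2) ^ (card J - 1)))"
      if C[measurable]: "C \<in> sets borel" and ne: "C \<noteq> {}" and sub: "C \<subseteq> A \<inter> ball x d" for C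
    proof -
      have bd: "bounded C" using sub by (meson bounded_ball bounded_subset inf.boundedE)
      define C' where "C' = {u. R (Q u) \<in> C}"
      have C'[measurable]: "C' \<in> sets borel" unfolding C'_def by measurable
      have "(\<integral>\<^sup>+w. W (coord_proj J w) * indicator C (T w) \<partial>coord_measure J)
          = ennreal \<bar>det (matrix Q)\<bar> * (\<integral>\<^sup>+w. W (coord_proj J (Q (coord_proj J w))) * indicator C (T (Q (coord_proj J w))) \<partial>coord_measure J)"
        by (rule nn_integral_coord_linear[OF Q(2) _ QJ QI]) (use detQ in \<open>auto, measurable\<close>)
      also have "\<dots> = (\<integral>\<^sup>+w. indicator {z. z \<noteq> 0 \<and> norm z \<le> \<epsilon> \<and> sgn z \<in> C'} (coord_proj J w)
          * ennreal (norm (coord_proj J w) ^ i) \<partial>coord_measure J)"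
        unfolding detQ T_def QJ W_def normQ sgnQ
        using normQ by (auto simp: C'_def indicator_def intro!: nn_integral_cong) (metis norm_eq_zero)+
      also have "\<dots> \<le> ennreal (\<epsilon> ^ (card J + i) / real (card J + i) * ((1 / (1 - d)) ^ i *
          (unit_ball_vol (card J - 1) * (((1 + d) / (1 - d)\<^sup>2 * diameter C) / 2) ^ (card J - 1))))"
      proof (rule narrow_cone_measure[OF j d(1,2) \<epsilon> _ C'])
        show "0 \<le> diameter C" using bd by (rule diameter_ge_0)
        show "C' \<subseteq> ball (axis j 1) d"
        proof
          fix u assume "u \<in> C'"
          then have "dist x (R (Q u)) < d" using sub by (auto simp: C'_def)
          then show "u \<in> ball (axis j 1) d" by (simp add: w0 distR Qe[symmetric] distQ)
        qed
        show "dist y z \<le> diameter C" if "y \<in> C'" "z \<in> C'" for y z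
          using diameter_bounded_bound[OF bd, of "R (Q y)" "R (Q z)"] that by (simp add: C'_def distR distQ)
      qed
      also have "\<dots> = ennreal (c * (((1 / (1 - d)) ^ i * ((1 + d) / (1 - d)\<^sup>2) ^ (card J - 1)) *
          (unit_ball_vol (card J - 1) * (diameter C / 2) ^ (card J - 1))))"
        by (simp add: c_def power_mult_distrib power_divide mult_ac)
      also have "\<dots> \<le> ennreal (c * (e * (unit_ball_vol (card J - 1) * (diameter C / 2) ^ (card J - 1))))"
        using c diameter_ge_0[OF bd]
        by (intro ennreal_leI mult_left_mono mult_right_mono d(3)) auto
      finally have "ennreal (1 / c) * (\<integral>\<^sup>+w. W (coord_proj J w) * indicator C (T w) \<partial>coord_measure J)
          \<le> ennreal (1 / c) * ennreal (c * (e * (unit_ball_vol (card J - 1) * (diameter C / 2) ^ (card J - 1))))"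
        by (rule mult_left_mono) simp
      also have "\<dots> = ennreal (e * (unit_ball_vol (card J - 1) * (diameter C / 2) ^ (card J - 1)))"
        using c by (simp add: ennreal_mult'[symmetric])
      finally show ?thesis by (simp add: em\<nu>[OF C])
    qed
    then show ?thesis using d(1) by blast
  qed
  have le: "emeasure \<nu> A \<le> emeasure ?H A" if A[measurable]: "A \<in> sets borel" for A
  proof -
    have "W (coord_proj J w) * indicator A (T w) = W (coord_proj J w) * indicator (A \<inter> ?S) (T w)" for w
      using TS[of w] by (cases "W (coord_proj J w) = 0") (auto simp: indicator_def)
    then have "emeasure \<nu> A = emeasure \<nu> (A \<inter> ?S)" by (simp add: em\<nu>)
    also have "\<dots> \<le> emeasure ?H (A \<inter> ?S)"
      by (rule emeasure_le_hausdorff_measure[OF sets\<nu>]) (measurable, rule local[of "A \<inter> ?S"], auto)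
    also have "\<dots> \<le> emeasure ?H A" by (rule emeasure_mono) auto
    finally show ?thesis .
  qed
  have "\<nu> \<le> ?H"
    using le by (subst le_measure) (auto simp: le_fun_def sets\<nu>)
  then have "(\<integral>\<^sup>+v. g v * indicator ?S v \<partial>\<nu>) \<le> (\<integral>\<^sup>+v. g v * indicator ?S v \<partial>?H)"
    by (intro nn_integral_mono_measure) (simp_all add: sets\<nu>)
  then have "ennreal c * (\<integral>\<^sup>+v. g v * indicator ?S v \<partial>\<nu>) \<le> ennreal c * (\<integral>\<^sup>+v. g v * indicator ?S v \<partial>?H)"
    by (rule mult_left_mono) simp
  moreover have "ennreal c * (\<integral>\<^sup>+v. g v * indicator ?S v \<partial>\<nu>)
      = (\<integral>\<^sup>+w. W (coord_proj J w) * g (T w) \<partial>coord_measure J)"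
  proof -
    have "W (coord_proj J w) * (g (T w) * indicator ?S (T w)) = W (coord_proj J w) * g (T w)" for w
      using TS[of w] by (cases "W (coord_proj J w) = 0") (auto simp: indicator_def)
    then show ?thesis
      using c by (simp add: int\<nu> mult.assoc[symmetric] ennreal_mult[symmetric])
  qed
  ultimately show ?thesis by (simp add: W_def T_def c_def)
qed

section \<open>Smooth maps\<close>

lemma Ck_on_cong:
  assumes "open V" "Ck_on k V f" "\<And>x. x \<in> V \<Longrightarrow> f x = g x"
  shows "Ck_on k V g"
  using assms(2,3)
proof (induction k arbitrary: f g)
  case 0
  then show ?case by (simp cong: continuous_on_cong)
next
  case (Suc k)
  have eq: "frechet_derivative f (at x) = frechet_derivative g (at x)" if "x \<in> V" for x
    using Suc.prems that by (intro frechet_derivative_transform_within_open[OF _ assms(1)]) auto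
  have "g differentiable (at x)" if "x \<in> V" for x
  proof -
    have "f differentiable (at x)" using Suc.prems that by simp
    then obtain D where "(f has_derivative D) (at x)" by (auto simp: differentiable_def)
    then have "(g has_derivative D) (at x)"
      by (rule has_derivative_transform_within_open[OF _ assms(1) that]) (use Suc.prems in auto)
    then show ?thesis by (auto simp: differentiable_def)
  qed
  moreover have "Ck_on k V (\<lambda>x. frechet_derivative g (at x) u)" for u
    by (rule Suc.IH[of "\<lambda>x. frechet_derivative f (at x) u"]) (use Suc.prems eq in auto)
  ultimately show ?case by simp
qed

text \<open>The derivative at a point is unique, so an explicit formula for it can replace
  \<open>frechet_derivative\<close>.\<close>

lemma Ck_on_SucI:
  assumes V: "open V" and f: "\<And>x. x \<in> V \<Longrightarrow> (f has_derivative f' x) (at x)"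
    and D: "\<And>u. Ck_on k V (\<lambda>x. f' x u)"
  shows "Ck_on (Suc k) V f"
proof -
  have "f' x = frechet_derivative f (at x)" if "x \<in> V" for x
    using f[OF that] by (rule frechet_derivative_at)
  then have "Ck_on k V (\<lambda>x. frechet_derivative f (at x) u)" for u
    by (intro Ck_on_cong[OF V D]) simp
  then show ?thesis using f by (auto simp: differentiable_def)
qed

lemma Ck_on_Suc_has_derivative:
  "Ck_on (Suc k) V f \<Longrightarrow> x \<in> V \<Longrightarrow> (f has_derivative frechet_derivative f (at x)) (at x)"
  by (simp add: frechet_derivative_works)

lemma Ck_on_mono_Suc: "Ck_on (Suc k) V f \<Longrightarrow> Ck_on k V f"
proof (induction k arbitrary: f)
  case 0
  then have "f differentiable_on V"
    by (auto simp: differentiable_on_def intro: differentiable_at_withinI)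
  then show ?case using differentiable_imp_continuous_on by auto
next
  case (Suc k)
  then show ?case by (metis Ck_on.simps(2))
qed

lemma Ck_on_const: "open V \<Longrightarrow> Ck_on k V (\<lambda>x. c)"
proof (induction k arbitrary: c)
  case (Suc k)
  then show ?case by (intro Ck_on_SucI[where f'="\<lambda>x u. 0"]) auto
qed simp

lemma Ck_on_add:
  "open V \<Longrightarrow> Ck_on k V f \<Longrightarrow> Ck_on k V g \<Longrightarrow> Ck_on k V (\<lambda>x. f x + g x)"
proof (induction k arbitrary: f g)
  case 0
  then show ?case by (auto intro: continuous_intros)
next
  case (Suc k)
  show ?case
  proof (rule Ck_on_SucI[OF Suc.prems(1)])
    show "((\<lambda>x. f x + g x) has_derivative
       (\<lambda>u. frechet_derivative f (at x) u + frechet_derivative g (at x) u)) (at x)" if "x \<in> V" for x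
      using Suc.prems that by (intro has_derivative_add Ck_on_Suc_has_derivative)
    show "Ck_on k V (\<lambda>x. frechet_derivative f (at x) u + frechet_derivative g (at x) u)" for u
      using Suc.prems by (intro Suc.IH) auto
  qed
qed

lemma Ck_on_sum:
  assumes "open V" "finite B" "\<And>b. b \<in> B \<Longrightarrow> Ck_on k V (f b)"
  shows "Ck_on k V (\<lambda>x. \<Sum>b\<in>B. f b x)"
  using assms(2,3)
  by (induction B) (simp_all add: Ck_on_const[OF assms(1)] Ck_on_add[OF assms(1)])

lemma Ck_on_bounded_linear:
  assumes "bounded_linear L" "open V" "Ck_on k V f"
  shows "Ck_on k V (\<lambda>x. L (f x))"
  using assms(3)
proof (induction k arbitrary: f)
  case 0
  then show ?case using bounded_linear.continuous_on[OF assms(1)] by auto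
next
  case (Suc k)
  show ?case
  proof (rule Ck_on_SucI[OF assms(2)])
    show "((\<lambda>x. L (f x)) has_derivative (\<lambda>u. L (frechet_derivative f (at x) u))) (at x)" if "x \<in> V" for x
      using Ck_on_Suc_has_derivative[OF Suc.prems that] by (rule bounded_linear.has_derivative[OF assms(1)])
  qed (use Suc in auto)
qed

lemma Ck_on_scaleR:
  fixes c :: "'a::euclidean_space \<Rightarrow> real" and f :: "'a \<Rightarrow> 'b::euclidean_space"
  shows "open V \<Longrightarrow> Ck_on k V c \<Longrightarrow> Ck_on k V f \<Longrightarrow> Ck_on k V (\<lambda>x. c x *\<^sub>R f x)"
proof (induction k arbitrary: c f)
  case 0
  then show ?case by (auto intro: continuous_intros)
next
  case (Suc k)
  show ?case
  proof (rule Ck_on_SucI[OF Suc.prems(1)])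
    show "((\<lambda>x. c x *\<^sub>R f x) has_derivative
       (\<lambda>u. c x *\<^sub>R frechet_derivative f (at x) u + frechet_derivative c (at x) u *\<^sub>R f x)) (at x)" if "x \<in> V" for x
      using Suc.prems that by (intro has_derivative_scaleR Ck_on_Suc_has_derivative)
    show "Ck_on k V (\<lambda>x. c x *\<^sub>R frechet_derivative f (at x) u + frechet_derivative c (at x) u *\<^sub>R f x)" for u
      using Suc.prems by (intro Suc.IH Ck_on_add) (auto intro: Ck_on_mono_Suc simp del: Ck_on.simps, auto)
  qed
qed

text \<open>The chain rule is expanded over a basis. This turns the derivative into a sum of scalar
  functions times compositions with g, to which the induction hypothesis applies.\<close>

lemma Ck_on_compose:
  fixes g :: "'a::euclidean_space \<Rightarrow> 'b::euclidean_space" and f :: "'b \<Rightarrow> 'c::euclidean_space"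
  assumes V: "open V" and W: "open W" and sub: "g ` V \<subseteq> W"
  shows "Ck_on k W f \<Longrightarrow> Ck_on k V g \<Longrightarrow> Ck_on k V (\<lambda>x. f (g x))"
proof (induction k arbitrary: f)
  case 0
  then show ?case using sub by (auto intro: continuous_on_compose2)
next
  case (Suc k)
  have f: "(f has_derivative frechet_derivative f (at (g x))) (at (g x))" if "x \<in> V" for x
    using Ck_on_Suc_has_derivative[OF Suc.prems(1)] sub that by blast
  have g: "(g has_derivative frechet_derivative g (at x)) (at x)" if "x \<in> V" for x
    using Ck_on_Suc_has_derivative[OF Suc.prems(2) that] .
  show ?case
  proof (rule Ck_on_SucI[OF V])
    show "((\<lambda>x. f (g x)) has_derivative
       (\<lambda>u. \<Sum>b\<in>Basis. (frechet_derivative g (at x) u \<bullet> b) *\<^sub>R frechet_derivative f (at (g x)) b)) (at x)"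
      if x: "x \<in> V" for x
    proof -
      have lin: "linear (frechet_derivative f (at (g x)))"
        using f[OF x] has_derivative_linear by blast
      have rep: "frechet_derivative f (at (g x)) w = (\<Sum>b\<in>Basis. (w \<bullet> b) *\<^sub>R frechet_derivative f (at (g x)) b)" for w
        by (subst (1) euclidean_representation[of w, symmetric]) (simp add: linear_sum[OF lin] linear_scale[OF lin])
      show ?thesis unfolding rep[symmetric] using diff_chain_at[OF g[OF x] f[OF x]] by (simp add: o_def)
    qed
    show "Ck_on k V (\<lambda>x. \<Sum>b\<in>Basis. (frechet_derivative g (at x) u \<bullet> b) *\<^sub>R frechet_derivative f (at (g x)) b)" for u
    proof (intro Ck_on_sum V Ck_on_scaleR finite_Basis)
      fix b :: 'b
      show "Ck_on k V (\<lambda>x. frechet_derivative g (at x) u \<bullet> b)"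
        using Suc.prems by (intro Ck_on_bounded_linear[OF bounded_linear_inner_left V]) simp
      show "Ck_on k V (\<lambda>x. frechet_derivative f (at (g x)) b)"
        using Suc.prems Ck_on_mono_Suc[OF Suc.prems(2)] by (intro Suc.IH) auto
    qed
  qed
qed

lemma smooth_on_compose:
  fixes g :: "'a::euclidean_space \<Rightarrow> 'b::euclidean_space" and f :: "'b \<Rightarrow> 'c::euclidean_space"
  assumes "open V" "open W" "g ` V \<subseteq> W" "smooth_on W f" "smooth_on V g"
  shows "smooth_on V (\<lambda>x. f (g x))"
  using Ck_on_compose[OF assms(1-3)] assms(4,5) by (auto simp: smooth_on_def)

lemma smooth_on_linear:
  fixes f :: "'a::euclidean_space \<Rightarrow> 'b::euclidean_space"
  assumes f: "linear f" and V: "open V"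
  shows "smooth_on V f"
  unfolding smooth_on_def
proof
  fix k
  have bl: "bounded_linear f" using f by (simp add: linear_conv_bounded_linear)
  show "Ck_on k V f"
  proof (cases k)
    case 0
    then show ?thesis using linear_continuous_on[OF bl] by simp
  next
    case (Suc k')
    then show ?thesis
      using V bounded_linear_imp_has_derivative[OF bl]
      by (simp only:) (intro Ck_on_SucI[where f'="\<lambda>_. f"] Ck_on_const, auto)
  qed
qed

lemma smooth_on_frechet_derivative:
  "smooth_on V f \<Longrightarrow> smooth_on V (\<lambda>x. frechet_derivative f (at x) u)"
  unfolding smooth_on_def by (metis Ck_on.simps(2))

lemma smooth_on_has_derivative:
  "smooth_on V f \<Longrightarrow> x \<in> V \<Longrightarrow> (f has_derivative frechet_derivative f (at x)) (at x)"
  unfolding smooth_on_def by (metis Ck_on_Suc_has_derivative)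

lemma smooth_on_continuous: "smooth_on V f \<Longrightarrow> continuous_on V f"
  unfolding smooth_on_def by (metis Ck_on.simps(1))

section \<open>Coefficients of the characteristic determinant\<close>

text \<open>The coefficients in \<open>psi\<close> as a function of the matrix alone, which
  separates the algebra from the geometry.\<close>

definition det_coeffs :: "nat \<Rightarrow> (nat \<Rightarrow> nat \<Rightarrow> real) \<Rightarrow> nat \<Rightarrow> real" where
  "det_coeffs m S = (THE c. (\<forall>i>m. c i = 0) \<and>
     (\<forall>t. detm m (\<lambda>i j. (if i = j then 1 else 0) - t * S i j) = (\<Sum>i\<le>m. t ^ i * c i)))"

lemma psi_eq_det_coeffs: "psi m M q v = det_coeffs m (sff_matrix m M q v)"
  by (simp add: psi_def det_coeffs_def)

text \<open>Existence: the Leibniz expansion is a polynomial p in t of degree at most m. Uniqueness: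
  a polynomial function determines its coefficients, and those beyond m are fixed to be 0.\<close>

lemma det_coeffs_ex1:
  "\<exists>!c. (\<forall>i>m. c i = 0) \<and>
     (\<forall>t. detm m (\<lambda>i j. (if i = j then 1 else 0) - t * S i j) = (\<Sum>i\<le>m. t ^ i * (c i :: real)))"
proof (rule ex_ex1I)
  define p :: "real poly" where "p = (\<Sum>\<pi> | \<pi> permutes {..<m}.
     of_int (sign \<pi>) * (\<Prod>i<m. [: (if i = \<pi> i then 1 else 0), - S i (\<pi> i) :]))"
  have deg: "degree p \<le> m"
    unfolding p_def
  proof (rule degree_sum_le)
    fix \<pi>
    have "degree (of_int (sign \<pi>) * (\<Prod>i<m. [: (if i = \<pi> i then 1 else 0), - S i (\<pi> i) :]))
        \<le> degree (of_int (sign \<pi>) :: real poly) + degree (\<Prod>i<m. [: (if i = \<pi> i then 1 else 0), - S i (\<pi> i) :])"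
      by (rule degree_mult_le)
    also have "degree (\<Prod>i<m. [: (if i = \<pi> i then 1 else 0), - S i (\<pi> i) :])
        \<le> (\<Sum>i<m. degree [: (if i = \<pi> i then 1 else 0), - S i (\<pi> i) :])"
      by (rule degree_prod_sum_le[unfolded o_def]) simp
    also have "\<dots> \<le> (\<Sum>i<m. 1)" by (intro sum_mono) simp
    finally show "degree (of_int (sign \<pi>) * (\<Prod>i<m. [: (if i = \<pi> i then 1 else 0), - S i (\<pi> i) :])) \<le> m"
      by (simp add: of_int_poly)
  qed (simp add: finite_permutations)
  have "detm m (\<lambda>i j. (if i = j then 1 else 0) - t * S i j) = poly p t" for t
    by (simp add: detm_def p_def poly_sum poly_prod)
  also have "poly p t = (\<Sum>i\<le>m. t ^ i * coeff p i)" for t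
    unfolding poly_altdef
    by (rule sum.mono_neutral_cong_left) (use deg in \<open>auto simp: coeff_eq_0 mult.commute\<close>)
  finally show "\<exists>c. (\<forall>i>m. c i = 0) \<and>
     (\<forall>t. detm m (\<lambda>i j. (if i = j then 1 else 0) - t * S i j) = (\<Sum>i\<le>m. t ^ i * (c i :: real)))"
    using deg by (intro exI[of _ "coeff p"]) (auto intro: coeff_eq_0)
next
  fix c d :: "nat \<Rightarrow> real"
  assume c: "(\<forall>i>m. c i = 0) \<and> (\<forall>t. detm m (\<lambda>i j. (if i = j then 1 else 0) - t * S i j) = (\<Sum>i\<le>m. t ^ i * c i))"
    and d: "(\<forall>i>m. d i = 0) \<and> (\<forall>t. detm m (\<lambda>i j. (if i = j then 1 else 0) - t * S i j) = (\<Sum>i\<le>m. t ^ i * d i))"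
  then have "\<forall>t. (\<Sum>i\<le>m. c i * t ^ i) = (\<Sum>i\<le>m. d i * t ^ i)" by (simp add: mult.commute)
  then have "\<forall>i\<le>m. c i = d i" using polyfun_eq_coeffs by blast
  then show "c = d" using c d by (metis ext not_le)
qed

lemma det_coeffs:
  "detm m (\<lambda>i j. (if i = j then 1 else 0) - t * S i j) = (\<Sum>i\<le>m. t ^ i * det_coeffs m S i)"
  "i > m \<Longrightarrow> det_coeffs m S i = 0"
  using theI'[OF det_coeffs_ex1[of m S]] unfolding det_coeffs_def[symmetric] by blast+

text \<open>Scaling the matrix by a amounts to substituting t a for t; comparing coefficients gives
  homogeneity of degree k.\<close>

lemma det_coeffs_scale: "det_coeffs m (\<lambda>i j. a * S i j) k = a ^ k * det_coeffs m S k"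
proof -
  have "det_coeffs m (\<lambda>i j. a * S i j) = (\<lambda>k. a ^ k * det_coeffs m S k)"
    unfolding det_coeffs_def[of m "\<lambda>i j. a * S i j"]
  proof (rule the1_equality[OF det_coeffs_ex1])
    show "(\<forall>i>m. a ^ i * det_coeffs m S i = 0) \<and>
      (\<forall>t. detm m (\<lambda>i j. (if i = j then 1 else 0) - t * (a * S i j)) = (\<Sum>i\<le>m. t ^ i * (a ^ i * det_coeffs m S i)))"
      using det_coeffs(1)[of m "_ * a" S] by (simp add: det_coeffs(2) power_mult_distrib mult.assoc)
  qed
  then show ?thesis by simp
qed

lemma detm_cong: "(\<And>i j. i < m \<Longrightarrow> j < m \<Longrightarrow> A i j = B i j) \<Longrightarrow> detm m A = detm m B"
  unfolding detm_def
  by (intro sum.cong arg_cong2[of _ _ _ _ "(*)"] prod.cong refl) (auto dest: permutes_in_image)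

lemma det_coeffs_cong:
  assumes "\<And>i j. i < m \<Longrightarrow> j < m \<Longrightarrow> S i j = S' i j"
  shows "det_coeffs m S = det_coeffs m S'"
proof -
  have "detm m (\<lambda>i j. (if i = j then 1 else 0) - t * S i j) = detm m (\<lambda>i j. (if i = j then 1 else 0) - t * S' i j)" for t
    by (rule detm_cong) (simp add: assms)
  then show ?thesis by (simp add: det_coeffs_def)
qed

text \<open>The i-th coefficient is the limit for t -> 0 of the polynomial minus its lower terms,
  divided by t^i. This gives measurability of \<open>psi\<close>, which is characterised only
  through the values of the determinant.\<close>

lemma measurable_polynomial_coeffs:
  fixes c :: "'a \<Rightarrow> nat \<Rightarrow> real"
  assumes eq: "\<And>x t. x \<in> space N \<Longrightarrow> P x t = (\<Sum>i\<le>m. t ^ i * c x i)"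
    and P: "\<And>t. (\<lambda>x. P x t) \<in> borel_measurable N"
  shows "i \<le> m \<Longrightarrow> (\<lambda>x. c x i) \<in> borel_measurable N"
proof (induction i rule: less_induct)
  case (less i)
  define t where "t n = inverse (real (Suc n))" for n
  define s where "s n x = (P x (t n) - (\<Sum>l<i. t n ^ l * c x l)) / t n ^ i" for n x
  have t0: "t n \<noteq> 0" for n by (simp add: t_def)
  show ?case
  proof (rule borel_measurable_LIMSEQ_real)
    fix x assume x: "x \<in> space N"
    have split: "{..m} = {..<i} \<union> {i..m}" using less.prems by auto
    have "s n x = (\<Sum>l=i..m. t n ^ (l - i) * c x l)" for n
    proof -
      have "P x (t n) - (\<Sum>l<i. t n ^ l * c x l) = (\<Sum>l=i..m. t n ^ l * c x l)"
        unfolding eq[OF x] split by (subst sum.union_disjoint) auto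
      also have "\<dots> = t n ^ i * (\<Sum>l=i..m. t n ^ (l - i) * c x l)"
        unfolding sum_distrib_left by (intro sum.cong refl) (simp add: power_add[symmetric] mult.assoc[symmetric])
      finally show ?thesis using t0[of n] by (simp add: s_def)
    qed
    moreover have "(\<lambda>n. \<Sum>l=i..m. t n ^ (l - i) * c x l) \<longlonglongrightarrow> (\<Sum>l=i..m. 0 ^ (l - i) * c x l)"
      unfolding t_def by (intro tendsto_intros LIMSEQ_inverse_real_of_nat)
    moreover have "(\<Sum>l=i..m. 0 ^ (l - i) * c x l) = c x i"
    proof -
      have "(\<Sum>l=i..m. 0 ^ (l - i) * c x l) = (\<Sum>l\<in>{i}. 0 ^ (l - i) * c x l)"
        using less.prems by (intro sum.mono_neutral_right) auto
      then show ?thesis by simp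
    qed
    ultimately show "(\<lambda>n. s n x) \<longlonglongrightarrow> c x i" by simp
  next
    fix n
    show "s n \<in> borel_measurable N"
      unfolding s_def using less.prems
      by (intro borel_measurable_divide borel_measurable_diff P borel_measurable_sum borel_measurable_times
          borel_measurable_const less.IH) auto
  qed
qed

section \<open>Orthonormal frames and straightened charts\<close>

text \<open>The counterpart of \<open>det_eq_detm\<close> for unit columns instead of unit
  rows.\<close>

lemma det_transpose_eq_detm:
  fixes A :: "real^'n^'n"
  assumes inj: "inj_on \<sigma> {..<m}"
    and id: "\<And>a b. b \<notin> \<sigma> ` {..<m} \<Longrightarrow> A $ a $ b = (if a = b then 1 else 0)"
  shows "det A = detm m (\<lambda>i j. A $ \<sigma> j $ \<sigma> i)"
proof -
  have "det A = det (transpose A)" by simp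
  also have "\<dots> = detm m (\<lambda>i j. transpose A $ \<sigma> i $ \<sigma> j)"
    by (rule det_eq_detm[OF inj]) (use id in \<open>auto simp: transpose_def\<close>)
  finally show ?thesis by (simp add: transpose_def)
qed

lemma vec_sum_axis: "(x :: real^'n) = (\<Sum>i\<in>UNIV. x $ i *\<^sub>R axis i 1)"
  by (simp add: vec_eq_iff axis_def if_distrib cong: if_cong)

lemma linear_vec_expand:
  assumes "linear (f :: real^'n \<Rightarrow> 'a::real_vector)"
  shows "f x = (\<Sum>i\<in>UNIV. x $ i *\<^sub>R f (axis i 1))"
  by (subst vec_sum_axis[of x]) (simp add: linear_sum[OF assms] linear_scale[OF assms])

lemma orthonormal_subspace_basis:
  assumes "subspace (T :: 'a::euclidean_space set)" "dim T = card K" "finite K"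
  shows "\<exists>b. (\<forall>i\<in>K. b i \<in> T) \<and> (\<forall>i\<in>K. \<forall>j\<in>K. b i \<bullet> b j = (if i = j then 1 else (0::real)))"
proof -
  obtain B where B: "B \<subseteq> T" "pairwise orthogonal B" "\<And>x. x \<in> B \<Longrightarrow> norm x = 1"
     "independent B" "card B = dim T" "span B = T"
    using orthonormal_basis_subspace[OF assms(1)] by metis
  have "finite B" using B(4) by (rule independent_imp_finite)
  then obtain b where b: "bij_betw b K B"
    using assms B(5) by (metis finite_same_card_bij)
  have "b i \<bullet> b j = (if i = j then 1 else 0)" if "i \<in> K" "j \<in> K" for i j
  proof (cases "i = j")
    case True
    then show ?thesis using B(3)[of "b j"] b that by (auto simp: norm_eq_1 bij_betw_def)
  next
    case False
    then have "b i \<noteq> b j" "b i \<in> B" "b j \<in> B" using b that by (auto simp: bij_betw_def inj_on_def)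
    then show ?thesis using B(2) False by (auto simp: pairwise_def orthogonal_def)
  qed
  moreover have "\<forall>i\<in>K. b i \<in> T" using b B(1) by (auto simp: bij_betw_def)
  ultimately show ?thesis by blast
qed

lemma orthogonal_from_basis:
  fixes b :: "'n::finite \<Rightarrow> real^'n"
  assumes "\<And>i j. b i \<bullet> b j = (if i = j then 1 else 0)"
  shows "orthogonal_transformation (\<lambda>x. \<Sum>i\<in>UNIV. x $ i *\<^sub>R b i)"
  unfolding orthogonal_transformation_def
proof (intro conjI allI)
  show "linear (\<lambda>x. \<Sum>i\<in>UNIV. x $ i *\<^sub>R b i)"
    by (rule linearI) (simp_all add: scaleR_add_left sum.distrib scaleR_sum_right)
  fix x y :: "real^'n"
  have "(\<Sum>i\<in>UNIV. x $ i *\<^sub>R b i) \<bullet> (\<Sum>j\<in>UNIV. y $ j *\<^sub>R b j)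
      = (\<Sum>i\<in>UNIV. \<Sum>j\<in>UNIV. x $ i * (y $ j * (if i = j then 1 else 0)))"
    by (subst inner_sum_left) (simp add: inner_sum_right assms sum_distrib_left mult.left_commute)
  also have "\<dots> = x \<bullet> y" by (simp add: inner_vec_def if_distrib cong: if_cong)
  finally show "(\<Sum>i\<in>UNIV. x $ i *\<^sub>R b i) \<bullet> (\<Sum>j\<in>UNIV. y $ j *\<^sub>R b j) = x \<bullet> y" .
qed

text \<open>The vectors e are completed by an orthonormal basis of the orthogonal complement of
  their span, indexed by the coordinates outside I.\<close>

lemma orthonormal_frame_extend:
  fixes e :: "nat \<Rightarrow> real^'n"
  assumes \<sigma>: "bij_betw \<sigma> {..<m} I"
    and e: "\<And>i j. i < m \<Longrightarrow> j < m \<Longrightarrow> e i \<bullet> e j = (if i = j then 1 else 0)"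
  shows "\<exists>R :: real^'n \<Rightarrow> real^'n. orthogonal_transformation R \<and> (\<forall>i<m. R (axis (\<sigma> i) 1) = e i)"
proof -
  let ?W = "span (e ` {..<m})"
  have "pairwise orthogonal (e ` {..<m})" using e by (auto simp: pairwise_def orthogonal_def)
  moreover have "0 \<notin> e ` {..<m}" using e by (metis (no_types) image_iff inner_zero_left lessThan_iff zero_neq_one)
  ultimately have ind: "independent (e ` {..<m})" by (rule pairwise_orthogonal_independent)
  have inj: "inj_on e {..<m}"
    by (rule inj_onI) (use e in \<open>metis lessThan_iff zero_neq_one\<close>)
  have dW: "dim ?W = m" using ind by (simp add: dim_eq_card_independent card_image inj)
  have cI: "card I = m" using bij_betw_same_card[OF \<sigma>] by simp
  let ?N = "{y \<in> UNIV. \<forall>x\<in>?W. orthogonal x y}"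
  have "dim ?N + dim ?W = dim (UNIV :: (real^'n) set)"
    by (rule dim_subspace_orthogonal_to_vectors) auto
  then have dN: "dim ?N = card (-I)" using dW cI by (simp add: Compl_eq_Diff_UNIV card_Diff_subset)
  have sN: "subspace ?N" by (simp add: subspace_orthogonal_to_vectors)
  obtain c where c': "\<forall>i\<in>-I. c i \<in> ?N"
      "\<forall>i\<in>-I. \<forall>j\<in>-I. c i \<bullet> c j = (if i = j then 1 else (0::real))"
    using orthonormal_subspace_basis[OF sN dN] finite_subset[OF subset_UNIV finite] by blast
  have c: "c i \<in> ?N" "j \<in> -I \<Longrightarrow> c i \<bullet> c j = (if i = j then 1 else (0::real))" if "i \<in> -I" for i j
    using c' that by blast+
  define \<tau> where "\<tau> = inv_into {..<m} \<sigma>"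
  have \<tau>: "\<tau> i < m" "\<sigma> (\<tau> i) = i" if "i \<in> I" for i
    using \<sigma> that bij_betw_inv_into_right[OF \<sigma>] by (auto simp: \<tau>_def bij_betw_def dest: inv_into_into[of i \<sigma> "{..<m}"])
  have \<tau>\<sigma>: "\<tau> (\<sigma> i) = i" if "i < m" for i
    using bij_betw_inv_into_left[OF \<sigma>] that by (simp add: \<tau>_def)
  have \<sigma>I: "\<sigma> i \<in> I" if "i < m" for i using \<sigma> that by (auto simp: bij_betw_def)
  define b where "b i = (if i \<in> I then e (\<tau> i) else c i)" for i
  have orth: "e i \<bullet> c j = 0" if "i < m" "j \<notin> I" for i j
    using c(1)[of j] that by (auto simp: orthogonal_def intro: span_base)
  have b: "b i \<bullet> b j = (if i = j then 1 else 0)" for i j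
  proof -
    have ee: "e (\<tau> i) \<bullet> e (\<tau> j) = (if i = j then 1 else 0)" if "i \<in> I" "j \<in> I"
      using that \<tau> e by metis
    have ce: "c i \<bullet> e (\<tau> j) = 0" if "i \<notin> I" "j \<in> I"
      using orth[of "\<tau> j" i] \<tau>(1)[of j] that by (simp add: inner_commute)
    show ?thesis
      using ee ce orth[of "\<tau> i" j] c(2)[of i j] \<tau>(1)[of i] by (auto simp: b_def)
  qed
  let ?R = "\<lambda>x. \<Sum>i\<in>UNIV. x $ i *\<^sub>R b i"
  have "?R (axis i 1) = b i" for i
  proof -
    have "?R (axis i 1) = (\<Sum>k\<in>UNIV. if k = i then b i else 0)"
      by (intro sum.cong) (auto simp: axis_def)
    then show ?thesis by simp
  qed
  then have "\<forall>i<m. ?R (axis (\<sigma> i) 1) = e i" by (auto simp: b_def \<sigma>I \<tau>\<sigma>)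
  then show ?thesis using orthogonal_from_basis[of b] b by blast
qed

section \<open>Coordinate subspaces and straightened charts\<close>

definition coord_space :: "'n set \<Rightarrow> (real^'n) set" where
  "coord_space I = {x. coord_proj I x = x}"

lemma coord_space_iff: "x \<in> coord_space I \<longleftrightarrow> (\<forall>i. i \<notin> I \<longrightarrow> x $ i = 0)"
  by (auto simp: coord_space_def vec_eq_iff)

lemma subspace_coord_space: "subspace (coord_space I)"
  by (auto simp: subspace_def coord_space_iff)

lemma coord_proj_in_space [simp]: "coord_proj I x \<in> coord_space I"
  by (simp add: coord_space_iff)

lemma coord_proj_space: "x \<in> coord_space I \<Longrightarrow> coord_proj I x = x"
  by (simp add: coord_space_def)

lemma axis_in_coord_space [simp]: "axis i 1 \<in> coord_space I \<longleftrightarrow> i \<in> I"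
  by (auto simp: coord_space_iff axis_def)

lemma dim_coord_space: "dim (coord_space I :: (real^'n) set) = card I"
proof -
  have "inj_on (\<lambda>i. axis i (1::real) :: real^'n) I" by (auto simp: inj_on_def axis_eq_axis)
  moreover have "coord_space I = {x::real^'n. \<forall>b\<in>Basis. b \<notin> (\<lambda>i. axis i 1) ` I \<longrightarrow> x \<bullet> b = 0}"
  proof -
    have "axis i (1::real) \<in> (\<lambda>i. axis i 1 :: real^'n) ` I \<longleftrightarrow> i \<in> I" for i
      by (auto simp: axis_eq_axis)
    then show ?thesis by (auto simp: coord_space_iff Basis_vec_def inner_axis)
  qed
  moreover have "(\<lambda>i. axis i (1::real) :: real^'n) ` I \<subseteq> Basis" by (auto simp: Basis_vec_def)
  ultimately show ?thesis by (simp add: dim_substandard card_image)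
qed

lemma inner_coord_space_Compl:
  "x \<in> coord_space I \<Longrightarrow> y \<in> coord_space (-I) \<Longrightarrow> x \<bullet> y = 0"
  unfolding inner_vec_def by (intro sum.neutral) (auto simp: coord_space_iff)

lemma coord_space_Compl_iff: "y \<in> coord_space (-I) \<longleftrightarrow> (\<forall>x\<in>coord_space I. x \<bullet> y = 0)"
proof
  assume "\<forall>x\<in>coord_space I. x \<bullet> y = 0"
  then have "axis i 1 \<bullet> y = 0" if "i \<in> I" for i using that by (metis axis_in_coord_space)
  then show "y \<in> coord_space (-I)" by (simp add: coord_space_iff inner_axis')
qed (use inner_coord_space_Compl in blast)

lemma orthogonal_frame_image:
  fixes R :: "real^'n \<Rightarrow> real^'n"
  assumes R: "orthogonal_transformation R" and L: "subspace L" "dim L = m"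
    and \<sigma>: "bij_betw \<sigma> {..<m} I" and e: "\<And>i. i < m \<Longrightarrow> R (axis (\<sigma> i) 1) \<in> L"
  shows "R ` coord_space I = L"
    and "R ` coord_space (-I) = {v. \<forall>w\<in>L. v \<bullet> w = 0}"
proof -
  have lin: "linear R" and inj: "inj R" and surj: "surj R"
    using R orthogonal_transformation_inj orthogonal_transformation_surj
    by (auto simp: orthogonal_transformation_def)
  have Rin: "R x \<bullet> R y = x \<bullet> y" for x y using R by (simp add: orthogonal_transformation_def)
  have "R ` coord_space I \<subseteq> L"
  proof safe
    fix x :: "real^'n" assume x: "x \<in> coord_space I"
    have "x $ i *\<^sub>R R (axis i 1) \<in> L" for i
    proof (cases "i \<in> I")
      case True
      then obtain k where "k < m" "i = \<sigma> k" using \<sigma> by (auto simp: bij_betw_def)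
      then show ?thesis using e L(1) by (simp add: subspace_scale)
    next
      case False
      then show ?thesis using x L(1) by (simp add: coord_space_iff subspace_0)
    qed
    then show "R x \<in> L"
      by (subst linear_vec_expand[OF lin]) (intro subspace_sum L(1))
  qed
  moreover have "dim (R ` coord_space I) = m"
    using dim_image_eq[OF lin, of "coord_space I"] inj bij_betw_same_card[OF \<sigma>]
    by (simp add: dim_coord_space inj_on_subset[OF inj])
  ultimately show 1: "R ` coord_space I = L"
    using L linear_subspace_image[OF lin subspace_coord_space[of I]]
    by (intro subspace_dim_equal) auto
  show "R ` coord_space (-I) = {v. \<forall>w\<in>L. v \<bullet> w = 0}"
  proof (intro set_eqI iffI)
    fix v assume "v \<in> {v. \<forall>w\<in>L. v \<bullet> w = 0}"
    moreover obtain y where y: "v = R y" using surj by (metis surjD)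
    ultimately have "y \<in> coord_space (-I)"
      unfolding 1[symmetric] by (auto simp: Rin coord_space_Compl_iff inner_commute)
    then show "v \<in> R ` coord_space (-I)" using y by blast
  next
    fix v assume "v \<in> R ` coord_space (-I)"
    then show "v \<in> {v. \<forall>w\<in>L. v \<bullet> w = 0}"
      unfolding 1[symmetric] by (auto simp: Rin coord_space_Compl_iff inner_commute)
  qed
qed

lemma smooth_on_cong:
  "open V \<Longrightarrow> smooth_on V f \<Longrightarrow> (\<And>x. x \<in> V \<Longrightarrow> f x = g x) \<Longrightarrow> smooth_on V g"
  unfolding smooth_on_def using Ck_on_cong by blast

text \<open>A rotation makes every chart flatten M onto the same coordinate subspace. A common I is
  wanted because fibre integrals from different charts are added up in the end.\<close>

lemma straighten_chart:
  fixes M :: "(real^'n) set"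
  assumes ch: "sm_chart m M p V \<Phi> L 0" and I: "card I = m"
  shows "\<exists>\<Phi>'. sm_chart m M p V \<Phi>' (coord_space I) 0"
proof -
  have V: "open V" "p \<in> V" "smooth_on V \<Phi>" "inj_on \<Phi> V" "open (\<Phi> ` V)"
    "smooth_on (\<Phi> ` V) (inv_into V \<Phi>)" "subspace L" "dim L = m"
    and img: "\<Phi> ` (M \<inter> V) = \<Phi> ` V \<inter> L"
    using ch by (auto simp: sm_chart_def)
  obtain \<sigma> where \<sigma>: "bij_betw \<sigma> {..<m} I"
    using ex_bij_betw_nat_finite[of I] I by (auto simp: atLeast0LessThan finite_subset[OF subset_UNIV])
  obtain e where e: "\<And>i. i < m \<Longrightarrow> e i \<in> L" "\<And>i j. i < m \<Longrightarrow> j < m \<Longrightarrow> e i \<bullet> e j = (if i = j then 1 else (0::real))"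
    using orthonormal_subspace_basis[OF V(7), of "{..<m}"] V(8) by auto
  obtain R :: "real^'n \<Rightarrow> real^'n" where R: "orthogonal_transformation R" "\<And>i. i < m \<Longrightarrow> R (axis (\<sigma> i) 1) = e i"
    using orthonormal_frame_extend[OF \<sigma>, of e] e(2) by metis
  have RL: "R ` coord_space I = L"
    using orthogonal_frame_image(1)[OF R(1) V(7,8) \<sigma>] R(2) e(1) by simp
  obtain R' where R': "orthogonal_transformation R'" "\<And>x. R' (R x) = x" "\<And>x. R (R' x) = x"
    using orthogonal_transformation_inv[OF R(1)] orthogonal_transformation_bij[OF R(1)]
    by (metis bij_inv_eq_iff)
  have lin: "linear R" "linear R'" using R(1) R'(1) by (auto simp: orthogonal_transformation_def)
  define \<Phi>' where "\<Phi>' x = R' (\<Phi> x)" for x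
  have im: "\<Phi>' ` S = R -` (\<Phi> ` S)" for S
  proof
    show "R -` (\<Phi> ` S) \<subseteq> \<Phi>' ` S"
      by (auto simp: \<Phi>'_def image_iff) (metis R'(2))
  qed (auto simp: \<Phi>'_def R'(3))
  have inj: "inj_on \<Phi>' V" using V(4) R'(3) by (auto simp: inj_on_def \<Phi>'_def) metis
  have op: "open (\<Phi>' ` V)"
    unfolding im using lin(1) V(5)
    by (intro open_vimage) (auto intro: linear_continuous_on simp: linear_conv_bounded_linear)
  have inv: "inv_into V \<Phi> (R y) = inv_into V \<Phi>' y" if y: "y \<in> \<Phi>' ` V" for y
  proof -
    obtain x where x: "x \<in> V" "y = \<Phi>' x" using y by blast
    then show ?thesis using inv_into_f_f[OF V(4) x(1)] inv_into_f_f[OF inj x(1)]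
      by (simp add: \<Phi>'_def R'(3))
  qed
  have "smooth_on V \<Phi>'"
    unfolding \<Phi>'_def
    by (rule smooth_on_compose[OF V(1) open_UNIV _ smooth_on_linear[OF lin(2) open_UNIV] V(3)]) auto
  moreover have "smooth_on (\<Phi>' ` V) (inv_into V \<Phi>')"
  proof (rule smooth_on_cong[OF op _ inv])
    show "smooth_on (\<Phi>' ` V) (\<lambda>y. inv_into V \<Phi> (R y))"
      by (rule smooth_on_compose[OF op V(5) _ V(6) smooth_on_linear[OF lin(1) op]]) (auto simp: im)
  qed
  moreover have "\<Phi>' ` (M \<inter> V) = \<Phi>' ` V \<inter> {y \<in> coord_space I. 0 \<bullet> y \<ge> 0}"
  proof -
    have "R -` L = coord_space I" using RL R'(2) by (auto simp: image_iff) metis+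
    then show ?thesis unfolding im img by auto
  qed
  ultimately have "sm_chart m M p V \<Phi>' (coord_space I) 0"
    unfolding sm_chart_def using V inj op I
    by (simp add: subspace_coord_space dim_coord_space subspace_0)
  then show ?thesis by blast
qed

section \<open>Flat charts and the second fundamental form\<close>

lemma sm_chartD:
  assumes "sm_chart m M p V \<Phi> L a"
  shows "open V" "p \<in> V" "smooth_on V \<Phi>" "inj_on \<Phi> V" "open (\<Phi> ` V)"
    "smooth_on (\<Phi> ` V) (inv_into V \<Phi>)" "subspace L" "dim L = m" "a \<in> L"
    "\<Phi> ` (M \<inter> V) = \<Phi> ` V \<inter> {y \<in> L. a \<bullet> y \<ge> 0}"
  using assms by (auto simp: sm_chart_def)

lemma chart_derivative_inverse:
  assumes ch: "sm_chart m M p V \<Phi> L a" and q: "q \<in> V"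
  shows "frechet_derivative (inv_into V \<Phi>) (at (\<Phi> q)) (frechet_derivative \<Phi> (at q) w) = w"
    and "frechet_derivative \<Phi> (at q) (frechet_derivative (inv_into V \<Phi>) (at (\<Phi> q)) z) = z"
proof -
  note c = sm_chartD[OF ch]
  let ?\<Psi> = "inv_into V \<Phi>"
  have A: "(\<Phi> has_derivative frechet_derivative \<Phi> (at q)) (at q)"
    using smooth_on_has_derivative[OF c(3) q] .
  have E: "(?\<Psi> has_derivative frechet_derivative ?\<Psi> (at (\<Phi> q))) (at (\<Phi> q))"
    using smooth_on_has_derivative[OF c(6), of "\<Phi> q"] q by blast
  have "((\<lambda>x. x) has_derivative (frechet_derivative ?\<Psi> (at (\<Phi> q)) \<circ> frechet_derivative \<Phi> (at q))) (at q)"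
  proof (rule has_derivative_transform_within_open[OF _ c(1) q])
    show "(?\<Psi> \<circ> \<Phi> has_derivative (frechet_derivative ?\<Psi> (at (\<Phi> q)) \<circ> frechet_derivative \<Phi> (at q))) (at q)"
      by (rule diff_chain_at[OF A E])
  qed (simp add: c(4))
  then have "frechet_derivative ?\<Psi> (at (\<Phi> q)) \<circ> frechet_derivative \<Phi> (at q) = (\<lambda>x. x)"
    using has_derivative_ident has_derivative_unique by blast
  then show "frechet_derivative ?\<Psi> (at (\<Phi> q)) (frechet_derivative \<Phi> (at q) w) = w"
    by (simp add: fun_eq_iff)
  have A': "(\<Phi> has_derivative frechet_derivative \<Phi> (at q)) (at (?\<Psi> (\<Phi> q)))"
    using A q c(4) by simp
  have "((\<lambda>x. x) has_derivative (frechet_derivative \<Phi> (at q) \<circ> frechet_derivative ?\<Psi> (at (\<Phi> q)))) (at (\<Phi> q))"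
  proof (rule has_derivative_transform_within_open[OF _ c(5)])
    show "(\<Phi> \<circ> ?\<Psi> has_derivative (frechet_derivative \<Phi> (at q) \<circ> frechet_derivative ?\<Psi> (at (\<Phi> q)))) (at (\<Phi> q))"
      by (rule diff_chain_at[OF E A'])
  qed (use q in \<open>auto simp: f_inv_into_f\<close>)
  then have "frechet_derivative \<Phi> (at q) \<circ> frechet_derivative ?\<Psi> (at (\<Phi> q)) = (\<lambda>x. x)"
    using has_derivative_ident has_derivative_unique by blast
  then show "frechet_derivative \<Phi> (at q) (frechet_derivative ?\<Psi> (at (\<Phi> q)) z) = z"
    by (simp add: fun_eq_iff)
qed

lemma sm_chart_change_point: "sm_chart m M p V \<Phi> L a \<Longrightarrow> q \<in> V \<Longrightarrow> sm_chart m M q V \<Phi> L a"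
  by (simp add: sm_chart_def)

text \<open>The assumption \<open>chart\<close> quantifies over V because \<open>sm_chart\<close>
  names a base point, while one chart serves all points of V. The last argument 0 makes the
  half-space condition vacuous, so all points of M in V are interior.\<close>

locale flat_chart =
  fixes m :: nat and M V :: "(real^'n) set" and \<Phi> \<Psi> :: "real^'n \<Rightarrow> real^'n" and I :: "'n set"
  assumes chart: "q \<in> V \<Longrightarrow> sm_chart m M q V \<Phi> (coord_space I) 0"
    and nonempty: "V \<noteq> {}"
    and card_I: "card I = m"
  defines "\<Psi> \<equiv> inv_into V \<Phi>"
begin

lemma V: "open V" "smooth_on V \<Phi>" "inj_on \<Phi> V" "open (\<Phi> ` V)" "smooth_on (\<Phi> ` V) \<Psi>"
  and image_M: "\<Phi> ` (M \<inter> V) = \<Phi> ` V \<inter> coord_space I"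
proof -
  obtain q where "q \<in> V" using nonempty by blast
  note c = sm_chartD[OF chart[OF this]]
  show "open V" "smooth_on V \<Phi>" "inj_on \<Phi> V" "open (\<Phi> ` V)" "smooth_on (\<Phi> ` V) \<Psi>"
    using c by (simp_all add: \<Psi>_def)
  show "\<Phi> ` (M \<inter> V) = \<Phi> ` V \<inter> coord_space I" using c(10) by simp
qed

abbreviation "J \<equiv> - I"
abbreviation "P \<equiv> coord_proj I"
abbreviation "Q \<equiv> coord_proj J"

definition "dPhi q = frechet_derivative \<Phi> (at q)"
definition "dPsi y = frechet_derivative \<Psi> (at y)"
definition "ddPhi q a b = frechet_derivative (\<lambda>p. dPhi p b) (at q) a"

lemma \<Psi>\<Phi>: "x \<in> V \<Longrightarrow> \<Psi> (\<Phi> x) = x"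
  using V(3) by (simp add: \<Psi>_def)

lemma \<Phi>\<Psi>: "y \<in> \<Phi> ` V \<Longrightarrow> \<Phi> (\<Psi> y) = y"
  by (simp add: \<Psi>_def f_inv_into_f)

lemma \<Psi>_in_V: "y \<in> \<Phi> ` V \<Longrightarrow> \<Psi> y \<in> V"
  by (simp add: \<Psi>_def inv_into_into)

lemma \<Phi>_in_space: "q \<in> M \<Longrightarrow> q \<in> V \<Longrightarrow> \<Phi> q \<in> coord_space I"
  using image_M by blast

lemma \<Psi>_in_M: "y \<in> \<Phi> ` V \<Longrightarrow> y \<in> coord_space I \<Longrightarrow> \<Psi> y \<in> M"
proof -
  assume "y \<in> \<Phi> ` V" "y \<in> coord_space I"
  then have "y \<in> \<Phi> ` (M \<inter> V)" using image_M by blast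
  then show "\<Psi> y \<in> M" by (auto simp: \<Psi>\<Phi>)
qed

lemma dPhi: "q \<in> V \<Longrightarrow> (\<Phi> has_derivative dPhi q) (at q)"
  unfolding dPhi_def by (rule smooth_on_has_derivative[OF V(2)])

lemma dPsi: "y \<in> \<Phi> ` V \<Longrightarrow> (\<Psi> has_derivative dPsi y) (at y)"
  unfolding dPsi_def by (rule smooth_on_has_derivative[OF V(5)])

lemma linear_dPhi: "q \<in> V \<Longrightarrow> linear (dPhi q)"
  using dPhi has_derivative_linear by blast

lemma linear_dPsi: "y \<in> \<Phi> ` V \<Longrightarrow> linear (dPsi y)"
  using dPsi has_derivative_linear by blast

lemma smooth_dPhi: "smooth_on V (\<lambda>q. dPhi q b)"
  unfolding dPhi_def by (rule smooth_on_frechet_derivative[OF V(2)])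

lemma smooth_dPsi: "smooth_on (\<Phi> ` V) (\<lambda>y. dPsi y b)"
  unfolding dPsi_def by (rule smooth_on_frechet_derivative[OF V(5)])

lemma ddPhi: "q \<in> V \<Longrightarrow> ((\<lambda>p. dPhi p b) has_derivative (\<lambda>a. ddPhi q a b)) (at q)"
  unfolding ddPhi_def by (rule smooth_on_has_derivative[OF smooth_dPhi])

lemma linear_ddPhi_left: "q \<in> V \<Longrightarrow> linear (\<lambda>a. ddPhi q a b)"
  using ddPhi has_derivative_linear by blast

lemma continuous_ddPhi: "continuous_on V (\<lambda>q. ddPhi q a b)"
  unfolding ddPhi_def by (intro smooth_on_continuous smooth_on_frechet_derivative smooth_dPhi)

lemma dPhi_expand: "q \<in> V \<Longrightarrow> dPhi q x = (\<Sum>i\<in>UNIV. x $ i *\<^sub>R dPhi q (axis i 1))"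
  by (rule linear_vec_expand[OF linear_dPhi])

text \<open>Linearity in the second argument is inherited from \<open>dPhi p\<close> by
  differentiating its expansion in coordinates.\<close>

lemma ddPhi_expand_right:
  assumes "q \<in> V"
  shows "ddPhi q a b = (\<Sum>i\<in>UNIV. b $ i *\<^sub>R ddPhi q a (axis i 1))"
proof -
  have "((\<lambda>p. \<Sum>i\<in>UNIV. b $ i *\<^sub>R dPhi p (axis i 1)) has_derivative
      (\<lambda>a. \<Sum>i\<in>UNIV. b $ i *\<^sub>R ddPhi q a (axis i 1))) (at q)"
    by (intro has_derivative_sum has_derivative_scaleR_right ddPhi assms)
  then have "((\<lambda>p. dPhi p b) has_derivative
      (\<lambda>a. \<Sum>i\<in>UNIV. b $ i *\<^sub>R ddPhi q a (axis i 1))) (at q)"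
    by (rule has_derivative_transform_within_open[OF _ V(1) assms]) (rule dPhi_expand[symmetric])
  then show ?thesis using has_derivative_unique[OF ddPhi[OF assms, of b]] by (metis (no_types))
qed

lemma dPsi_dPhi: "q \<in> V \<Longrightarrow> dPsi (\<Phi> q) (dPhi q w) = w"
  and dPhi_dPsi: "q \<in> V \<Longrightarrow> dPhi q (dPsi (\<Phi> q) z) = z"
  using chart_derivative_inverse[OF chart] by (auto simp: dPsi_def dPhi_def \<Psi>_def)

text \<open>\<open>tangent_space\<close> admits vectors from any chart, including half-space charts.
  In such a chart a direction z pointing into the half-space gives a curve that stays in M for small
  t \<ge> 0, so the coordinates of \<Phi> outside I vanish along it, and so do their derivatives at
  0. If z points out of the half-space, - z is used.\<close>

lemma tangent_space_eq:
  assumes q: "q \<in> M" "q \<in> V"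
  shows "tangent_space m M q = {w. dPhi q w \<in> coord_space I}"
proof (intro set_eqI iffI)
  fix w assume "w \<in> {w. dPhi q w \<in> coord_space I}"
  then show "w \<in> tangent_space m M q"
    using chart[OF q(2)] unfolding tangent_space_def dPhi_def by blast
next
  fix w assume "w \<in> tangent_space m M q"
  then obtain V' \<Phi>' L' a' where ch: "sm_chart m M q V' \<Phi>' L' a'"
    and wL: "frechet_derivative \<Phi>' (at q) w \<in> L'" by (auto simp: tangent_space_def)
  note c = sm_chartD[OF ch]
  define \<Psi>' where "\<Psi>' = inv_into V' \<Phi>'"
  define y where "y = \<Phi>' q"
  have y: "y \<in> \<Phi>' ` V'" using c(2) by (simp add: y_def)
  have \<Psi>'y: "\<Psi>' y = q" using c(2,4) by (simp add: \<Psi>'_def y_def)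
  have y_half: "y \<in> L'" "a' \<bullet> y \<ge> 0" using c(10) q(1) c(2) by (auto simp: y_def)
  have E': "(\<Psi>' has_derivative frechet_derivative \<Psi>' (at y)) (at y)"
    unfolding \<Psi>'_def using smooth_on_has_derivative[OF c(6)] y by (simp add: y_def \<Psi>'_def)
  have inv: "frechet_derivative \<Psi>' (at y) (frechet_derivative \<Phi>' (at q) w) = w" for w
    using chart_derivative_inverse(1)[OF ch c(2)] by (simp add: \<Psi>'_def y_def)
  have linE: "linear (frechet_derivative \<Psi>' (at y))" using E' has_derivative_linear by blast
  have main: "dPhi q (frechet_derivative \<Psi>' (at y) z) \<in> coord_space I" if z: "z \<in> L'" "a' \<bullet> z \<ge> 0" for z
    unfolding coord_space_iff
  proof (intro allI impI)
    fix j assume j: "j \<notin> I"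
    define \<gamma> where "\<gamma> t = \<Psi>' (y + t *\<^sub>R z)" for t :: real
    have g: "(\<gamma> has_derivative (\<lambda>t. frechet_derivative \<Psi>' (at y) (t *\<^sub>R z))) (at 0)"
      unfolding \<gamma>_def
      by (rule has_derivative_compose[where f="\<lambda>t. y + t *\<^sub>R z" and g=\<Psi>'])
         (auto intro!: derivative_eq_intros E'[simplified])
    have g0: "\<gamma> 0 = q" by (simp add: \<gamma>_def \<Psi>'y)
    define h where "h t = \<Phi> (\<gamma> t) $ j" for t
    have "((\<lambda>t. \<Phi> (\<gamma> t)) has_derivative (\<lambda>t. dPhi q (frechet_derivative \<Psi>' (at y) (t *\<^sub>R z)))) (at 0)"
      by (rule has_derivative_compose[OF g]) (simp add: g0 dPhi[OF q(2)])
    then have "(h has_derivative (\<lambda>t. dPhi q (frechet_derivative \<Psi>' (at y) (t *\<^sub>R z)) $ j)) (at 0)"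
      unfolding h_def by (rule bounded_linear.has_derivative[OF bounded_linear_vec_nth])
    moreover have "(\<lambda>t. dPhi q (frechet_derivative \<Psi>' (at y) (t *\<^sub>R z)) $ j)
        = (*) (dPhi q (frechet_derivative \<Psi>' (at y) z) $ j)"
      by (simp add: linear_scale[OF linE] linear_scale[OF linear_dPhi[OF q(2)]] fun_eq_iff mult.commute)
    ultimately have h: "DERIV h 0 :> dPhi q (frechet_derivative \<Psi>' (at y) z) $ j"
      by (simp add: has_field_derivative_def)
    have "eventually (\<lambda>t. \<gamma> t \<in> V) (at 0)"
    proof -
      have "(\<gamma> \<longlongrightarrow> \<gamma> 0) (at 0)"
        using has_derivative_continuous[OF g] by (simp add: continuous_within)
      then show ?thesis using topological_tendstoD[OF _ V(1)] q(2) g0 by fastforce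
    qed
    moreover have "eventually (\<lambda>t. y + t *\<^sub>R z \<in> \<Phi>' ` V') (at 0)"
    proof -
      have "((\<lambda>t. y + t *\<^sub>R z) \<longlongrightarrow> y + 0 *\<^sub>R z) (at 0)" by (intro tendsto_intros)
      then show ?thesis using topological_tendstoD[OF _ c(5)] y by fastforce
    qed
    ultimately have "eventually (\<lambda>t. \<gamma> t \<in> V \<and> y + t *\<^sub>R z \<in> \<Phi>' ` V') (at 0)"
      by (rule eventually_conj)
    then obtain \<delta> where \<delta>: "\<delta> > 0" "\<And>t. t \<noteq> 0 \<Longrightarrow> dist t 0 < \<delta> \<Longrightarrow> \<gamma> t \<in> V \<and> y + t *\<^sub>R z \<in> \<Phi>' ` V'"
      by (auto simp: eventually_at)
    have h_zero: "h t = 0" if "0 \<le> t" "t < \<delta>" for t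
    proof (cases "t = 0")
      case True
      then show ?thesis using \<Phi>_in_space[OF q] j g0 by (simp add: h_def coord_space_iff)
    next
      case False
      then have *: "\<gamma> t \<in> V" "y + t *\<^sub>R z \<in> \<Phi>' ` V'" using \<delta>(2)[of t] that by auto
      moreover have "y + t *\<^sub>R z \<in> L'" using y_half z c(7) by (simp add: subspace_add subspace_scale)
      moreover have "a' \<bullet> (y + t *\<^sub>R z) \<ge> 0" using y_half z that by (simp add: inner_add_right)
      ultimately have "y + t *\<^sub>R z \<in> \<Phi>' ` (M \<inter> V')" using c(10) by auto
      then have "\<gamma> t \<in> M" using c(4) by (auto simp: \<gamma>_def \<Psi>'_def)
      then show ?thesis using \<Phi>_in_space[OF _ *(1)] j by (simp add: h_def coord_space_iff)
    qed
    \<comment> \<open>The curve is controlled only for t \<ge> 0, so a one-sided argument is used: a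
      nonzero derivative would move h away from its value at 0 immediately to the right.\<close>
    show "dPhi q (frechet_derivative \<Psi>' (at y) z) $ j = 0"
    proof (rule ccontr)
      assume "\<not> ?thesis"
      then consider "dPhi q (frechet_derivative \<Psi>' (at y) z) $ j > 0" | "dPhi q (frechet_derivative \<Psi>' (at y) z) $ j < 0"
        by linarith
      then have "\<exists>d>0. \<forall>t>0. t < d \<longrightarrow> h 0 \<noteq> h (0 + t)"
      proof cases
        case 1
        from DERIV_pos_inc_right[OF h 1] show ?thesis by force
      next
        case 2
        from DERIV_neg_dec_right[OF h 2] show ?thesis by force
      qed
      then obtain d where d: "d > 0" "\<And>t. t > 0 \<Longrightarrow> t < d \<Longrightarrow> h 0 \<noteq> h t" by auto
      define t where "t = min d \<delta> / 2"
      have "t > 0" "t < d" "t < \<delta>" using d(1) \<delta>(1) by (auto simp: t_def)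
      then show False using d(2)[of t] h_zero[of t] h_zero[of 0] \<delta>(1) by simp
    qed
  qed
  let ?z = "frechet_derivative \<Phi>' (at q) w"
  show "w \<in> {w. dPhi q w \<in> coord_space I}"
  proof (cases "a' \<bullet> ?z \<ge> 0")
    case True
    then show ?thesis using main[OF wL] inv by simp
  next
    case False
    then have "dPhi q (frechet_derivative \<Psi>' (at y) (- ?z)) \<in> coord_space I"
      using wL c(7) by (intro main) (auto simp: subspace_neg)
    then have "- dPhi q w \<in> coord_space I"
      using inv by (simp add: linear_neg[OF linE] linear_neg[OF linear_dPhi[OF q(2)]])
    then show ?thesis by (simp add: coord_space_iff)
  qed
qed

lemma tangent_space_image:
  assumes q: "q \<in> M" "q \<in> V"
  shows "tangent_space m M q = dPsi (\<Phi> q) ` coord_space I"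
  unfolding tangent_space_eq[OF q]
proof (intro set_eqI iffI)
  fix w assume "w \<in> {w. dPhi q w \<in> coord_space I}"
  then show "w \<in> dPsi (\<Phi> q) ` coord_space I"
    by (intro image_eqI[where x="dPhi q w"]) (auto simp: dPsi_dPhi q)
qed (auto simp: dPhi_dPsi q)

lemma subspace_tangent: "q \<in> M \<Longrightarrow> q \<in> V \<Longrightarrow> subspace (tangent_space m M q)"
  unfolding tangent_space_image
  by (intro linear_subspace_image linear_dPsi subspace_coord_space) auto

lemma dim_tangent:
  assumes q: "q \<in> M" "q \<in> V"
  shows "dim (tangent_space m M q) = m"
proof -
  have "inj (dPsi (\<Phi> q))"
    using dPhi_dPsi[OF q(2)] by (metis injI)
  then show ?thesis
    unfolding tangent_space_image[OF q]
    using dim_image_eq[OF linear_dPsi, of "\<Phi> q" "coord_space I"] q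
    by (simp add: dim_coord_space card_I inj_on_subset)
qed

lemma tangent_onb:
  assumes q: "q \<in> M" "q \<in> V"
  shows "i < m \<Longrightarrow> tangent_onb m M q i \<in> tangent_space m M q"
    and "i < m \<Longrightarrow> j < m \<Longrightarrow> tangent_onb m M q i \<bullet> tangent_onb m M q j = (if i = j then 1 else 0)"
proof -
  have "\<exists>e. (\<forall>i<m. e i \<in> tangent_space m M q) \<and> (\<forall>i<m. \<forall>j<m. e i \<bullet> e j = (if i = j then 1 else (0::real)))"
    using orthonormal_subspace_basis[OF subspace_tangent[OF q], of "{..<m}"] dim_tangent[OF q] by auto
  from someI_ex[OF this]
  show "i < m \<Longrightarrow> tangent_onb m M q i \<in> tangent_space m M q"
    and "i < m \<Longrightarrow> j < m \<Longrightarrow> tangent_onb m M q i \<bullet> tangent_onb m M q j = (if i = j then 1 else 0)"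
    unfolding tangent_onb_def by blast+
qed

section \<open>Normal coordinates and the second fundamental form\<close>

text \<open>The transpose of the derivative of the chart maps the normal coordinates onto the normal space.\<close>
definition nu :: "real^'n \<Rightarrow> real^'n \<Rightarrow> real^'n" where
  "nu q u = (\<chi> j. dPhi q (axis j 1) \<bullet> u)"

lemma nu_inner: "q \<in> V \<Longrightarrow> nu q u \<bullet> x = dPhi q x \<bullet> u"
  by (subst dPhi_expand) (simp_all add: nu_def inner_vec_def[of "\<chi> j. _ j"] inner_sum_left mult.commute)

lemma linear_nu: "linear (nu q)"
  by (rule linearI) (simp_all add: nu_def vec_eq_iff inner_add_right)

text \<open>Differentiating \<open>dPhi p (Y p) \<bullet> u = 0\<close> along the submanifold.\<close>
lemma second_fundamental_form_eq:
  assumes q: "q \<in> M" "q \<in> V" and X: "X \<in> tangent_space m M q" and Y: "Y \<in> tangent_space m M q"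
    and u: "u \<in> coord_space J"
  shows "second_fundamental_form m M q (nu q u) X Y = - (ddPhi q X Y \<bullet> u)"
proof -
  have main: "\<forall>Yt W. open W \<and> q \<in> W \<and> smooth_on W Yt \<and> (\<forall>p\<in>M \<inter> W. Yt p \<in> tangent_space m M p) \<and> Yt q = Y \<longrightarrow>
       frechet_derivative Yt (at q) X \<bullet> nu q u = - (ddPhi q X Y \<bullet> u)"
  proof (intro allI impI, elim conjE)
    fix Yt W assume W: "open W" "q \<in> W" "smooth_on W Yt"
      and tan: "\<forall>p\<in>M \<inter> W. Yt p \<in> tangent_space m M p" and Yq: "Yt q = Y"
    define D where "D = frechet_derivative Yt (at q)"
    have D: "(Yt has_derivative D) (at q)" unfolding D_def by (rule smooth_on_has_derivative[OF W(3,2)])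
    \<comment> \<open>The pairing of \<open>dPhi p (Yt p)\<close> with u, expanded in coordinates so
      that the product rule applies. It vanishes at points of M near q, where Yt is tangent.\<close>
    define H where "H p = (\<Sum>i\<in>UNIV. Yt p $ i *\<^sub>R dPhi p (axis i 1)) \<bullet> u" for p
    have "(H has_derivative (\<lambda>h. (\<Sum>i\<in>UNIV. Yt q $ i *\<^sub>R ddPhi q h (axis i 1) + D h $ i *\<^sub>R dPhi q (axis i 1)) \<bullet> u)) (at q)"
      unfolding H_def
      by (intro bounded_linear.has_derivative[OF bounded_linear_inner_left] has_derivative_sum has_derivative_scaleR
          ddPhi q bounded_linear.has_derivative[OF bounded_linear_vec_nth] D)
    then have H: "(H has_derivative (\<lambda>h. ddPhi q h Y \<bullet> u + dPhi q (D h) \<bullet> u)) (at q)"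
      by (simp add: sum.distrib inner_add_left Yq ddPhi_expand_right[OF q(2), of _ Y] dPhi_expand[OF q(2), of "D _"])
    define z where "z = dPhi q X"
    have z: "z \<in> coord_space I" using X tangent_space_eq[OF q] by (simp add: z_def)
    \<comment> \<open>A curve in M through q with velocity X; H is known to vanish only along
      M.\<close>
    define \<gamma> where "\<gamma> t = \<Psi> (\<Phi> q + t *\<^sub>R z)" for t :: real
    have g: "(\<gamma> has_derivative (\<lambda>t. dPsi (\<Phi> q) (t *\<^sub>R z))) (at 0)"
      unfolding \<gamma>_def using dPsi[of "\<Phi> q"] q(2)
      by (intro has_derivative_compose[where f="\<lambda>t. \<Phi> q + t *\<^sub>R z" and g=\<Psi>])
         (auto intro!: derivative_eq_intros)
    have g0: "\<gamma> 0 = q" by (simp add: \<gamma>_def \<Psi>\<Phi> q)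
    have gz: "dPsi (\<Phi> q) (t *\<^sub>R z) = t *\<^sub>R X" for t
      using q by (simp add: linear_scale[OF linear_dPsi] z_def dPsi_dPhi)
    have "((\<lambda>t. H (\<gamma> t)) has_derivative (\<lambda>t. ddPhi q (t *\<^sub>R X) Y \<bullet> u + dPhi q (D (t *\<^sub>R X)) \<bullet> u)) (at 0)"
      using has_derivative_compose[OF g, of H "\<lambda>h. ddPhi q h Y \<bullet> u + dPhi q (D h) \<bullet> u"] H by (simp add: g0 gz)
    moreover have "((\<lambda>t. H (\<gamma> t)) has_derivative (\<lambda>t. 0)) (at 0)"
    proof -
      have "eventually (\<lambda>t. \<gamma> t \<in> W) (nhds 0)"
      proof -
        have "isCont \<gamma> 0" using has_derivative_continuous[OF g] by simp
        then show ?thesis using W g0 by (auto simp: continuous_at_open eventually_nhds)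
      qed
      moreover have "eventually (\<lambda>t. \<Phi> q + t *\<^sub>R z \<in> \<Phi> ` V) (nhds 0)"
      proof -
        have "isCont (\<lambda>t. \<Phi> q + t *\<^sub>R z) 0" by (intro continuous_intros)
        then have "\<exists>S. open S \<and> 0 \<in> S \<and> (\<forall>t\<in>S. \<Phi> q + t *\<^sub>R z \<in> \<Phi> ` V)"
          using V(4) q(2) unfolding continuous_at_open by fastforce
        then show ?thesis by (auto simp: eventually_nhds)
      qed
      ultimately have "eventually (\<lambda>t. \<gamma> t \<in> W \<and> \<Phi> q + t *\<^sub>R z \<in> \<Phi> ` V) (nhds 0)"
        by (rule eventually_conj)
      then obtain S where S: "open S" "0 \<in> S" "\<And>t. t \<in> S \<Longrightarrow> \<gamma> t \<in> W \<and> \<Phi> q + t *\<^sub>R z \<in> \<Phi> ` V"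
        by (auto simp: eventually_nhds)
      have "H (\<gamma> t) = 0" if "t \<in> S" for t
      proof -
        have "\<Phi> q + t *\<^sub>R z \<in> coord_space I"
          using \<Phi>_in_space[OF q] z by (simp add: subspace_add subspace_scale subspace_coord_space)
        then have M: "\<gamma> t \<in> M" "\<gamma> t \<in> V" "\<gamma> t \<in> W"
          using S(3)[OF that] \<Psi>_in_M \<Psi>_in_V by (auto simp: \<gamma>_def)
        then have "dPhi (\<gamma> t) (Yt (\<gamma> t)) \<in> coord_space I" using tan tangent_space_eq by auto
        then show ?thesis
          using u by (simp add: H_def dPhi_expand[OF M(2), symmetric] inner_coord_space_Compl)
      qed
      then show ?thesis
        by (intro has_derivative_transform_within_open[OF has_derivative_const[of 0] S(1,2)]) simp
    qed
    ultimately have "(\<lambda>t. ddPhi q (t *\<^sub>R X) Y \<bullet> u + dPhi q (D (t *\<^sub>R X)) \<bullet> u) = (\<lambda>t. 0)"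
      by (rule has_derivative_unique)
    from fun_cong[OF this, of 1] have "dPhi q (D X) \<bullet> u = - (ddPhi q X Y \<bullet> u)" by simp
    then show "frechet_derivative Yt (at q) X \<bullet> nu q u = - (ddPhi q X Y \<bullet> u)"
      using nu_inner[OF q(2), of u "D X"] by (simp add: D_def inner_commute)
  qed
  \<comment> \<open>The field whose coordinate vector in the chart is constantly that of Y. Some
    tangent extension of Y has to exist, since otherwise every c would satisfy the condition under
    \<open>THE\<close>.\<close>
  define Y0 where "Y0 p = dPsi (\<Phi> p) (dPhi q Y)" for p
  have "smooth_on V Y0"
    unfolding Y0_def by (rule smooth_on_compose[OF V(1,4) _ smooth_dPsi V(2)]) auto
  moreover have "Y0 p \<in> tangent_space m M p" if "p \<in> M \<inter> V" for p
    using that Y tangent_space_eq q by (auto simp: Y0_def dPhi_dPsi)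
  moreover have "Y0 q = Y" using q by (simp add: Y0_def dPsi_dPhi)
  ultimately have Y0: "open V \<and> q \<in> V \<and> smooth_on V Y0 \<and> (\<forall>p\<in>M \<inter> V. Y0 p \<in> tangent_space m M p) \<and> Y0 q = Y"
    using V(1) q by blast
  show ?thesis
    unfolding second_fundamental_form_def
  proof (rule the_equality, rule main)
    fix c
    assume "\<forall>Yt W. open W \<and> q \<in> W \<and> smooth_on W Yt \<and> (\<forall>p\<in>M \<inter> W. Yt p \<in> tangent_space m M p) \<and> Yt q = Y \<longrightarrow>
       frechet_derivative Yt (at q) X \<bullet> nu q u = c"
    with main Y0 show "c = - (ddPhi q X Y \<bullet> u)" by metis
  qed
qed

end

section \<open>The normal exponential map\<close>

definition coord_enum :: "nat \<Rightarrow> 'n set \<Rightarrow> nat \<Rightarrow> 'n" where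
  "coord_enum m I = (SOME \<sigma>. bij_betw \<sigma> {..<m} I)"

text \<open>The axes of I go to the chosen basis of the tangent space, hence the remaining axes to
  an orthonormal basis of the normal space. The choice is made separately at each q, and nothing is
  known about its dependence on q.\<close>

definition tangent_frame :: "nat \<Rightarrow> (real^'n) set \<Rightarrow> 'n set \<Rightarrow> real^'n \<Rightarrow> real^'n \<Rightarrow> real^'n" where
  "tangent_frame m M I q = (SOME R. orthogonal_transformation R \<and>
     (\<forall>i<m. R (axis (coord_enum m I i) 1) = tangent_onb m M q i))"

lemma coord_enum:
  fixes I :: "'n::finite set"
  assumes "card I = m"
  shows "bij_betw (coord_enum m I) {..<m} I"
proof -
  have "\<exists>\<sigma>. bij_betw \<sigma> {..<m} I"
    using ex_bij_betw_nat_finite[of I] assms by (auto simp: atLeast0LessThan finite_subset[OF subset_UNIV])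
  then show ?thesis unfolding coord_enum_def by (rule someI_ex)
qed

lemma det_matrix_comp:
  fixes f g :: "real^'n \<Rightarrow> real^'n"
  assumes "linear f" "linear g"
  shows "det (matrix (\<lambda>x. f (g x))) = det (matrix f) * det (matrix g)"
  using matrix_compose[OF assms(2,1)] by (simp add: o_def det_mul)

lemma continuous_on_det:
  fixes A :: "'a::topological_space \<Rightarrow> real^'n^'n"
  assumes "\<And>a b. continuous_on S (\<lambda>x. A x $ a $ b)"
  shows "continuous_on S (\<lambda>x. det (A x))"
  unfolding det_def by (intro continuous_intros assms)

context flat_chart
begin

abbreviation "frame \<equiv> tangent_frame m M I"

lemma frame:
  assumes q: "q \<in> M" "q \<in> V"
  shows "orthogonal_transformation (frame q)"
    and "i < m \<Longrightarrow> frame q (axis (coord_enum m I i) 1) = tangent_onb m M q i"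
proof -
  have "\<exists>R :: real^'n \<Rightarrow> real^'n. orthogonal_transformation R \<and> (\<forall>i<m. R (axis (coord_enum m I i) 1) = tangent_onb m M q i)"
    using orthonormal_frame_extend[OF coord_enum[OF card_I] tangent_onb(2)[OF q]] by blast
  from someI_ex[OF this]
  show "orthogonal_transformation (frame q)"
    and "i < m \<Longrightarrow> frame q (axis (coord_enum m I i) 1) = tangent_onb m M q i"
    unfolding tangent_frame_def by blast+
qed

lemma linear_frame: "q \<in> M \<Longrightarrow> q \<in> V \<Longrightarrow> linear (frame q)"
  using frame(1) by (auto simp: orthogonal_transformation_def)

lemma frame_inner: "q \<in> M \<Longrightarrow> q \<in> V \<Longrightarrow> frame q x \<bullet> frame q y = x \<bullet> y"
  using frame(1) by (auto simp: orthogonal_transformation_def)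

lemma norm_frame: "q \<in> M \<Longrightarrow> q \<in> V \<Longrightarrow> norm (frame q x) = norm x"
  using frame(1) by (simp add: orthogonal_transformation_norm)

lemma frame_inverse:
  assumes q: "q \<in> M" "q \<in> V"
  obtains R' where "orthogonal_transformation R'" "linear R'" "\<And>x. R' (frame q x) = x" "\<And>x. frame q (R' x) = x"
    "\<And>x. norm (R' x) = norm x"
proof -
  obtain R' where R': "orthogonal_transformation R'" "\<And>x. R' (frame q x) = x" "\<And>x. frame q (R' x) = x"
    using orthogonal_transformation_inv[OF frame(1)[OF q]] orthogonal_transformation_bij[OF frame(1)[OF q]]
    by (metis bij_inv_eq_iff)
  then show ?thesis
    using that orthogonal_transformation_norm[OF R'(1)] by (auto simp: orthogonal_transformation_def)
qed

lemma frame_tangent: "q \<in> M \<Longrightarrow> q \<in> V \<Longrightarrow> frame q ` coord_space I = tangent_space m M q"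
  and frame_normal: "q \<in> M \<Longrightarrow> q \<in> V \<Longrightarrow> frame q ` coord_space J = normal_space m M q"
  unfolding normal_space_def
  using orthogonal_frame_image[OF frame(1) subspace_tangent dim_tangent coord_enum[OF card_I]]
    frame(2) tangent_onb(1) by auto

lemma frame_sphere:
  assumes q: "q \<in> M" "q \<in> V"
  shows "frame q ` coord_sphere J = unit_normal_sphere m M q"
proof -
  have "coord_sphere J = coord_space J \<inter> {w. norm w = 1}"
    by (auto simp: coord_sphere_def coord_space_def)
  then show ?thesis
    unfolding unit_normal_sphere_def frame_normal[OF q, symmetric] using norm_frame[OF q] by auto
qed

lemma tangent_normal_orthogonal:
  "v \<in> normal_space m M q \<Longrightarrow> w \<in> tangent_space m M q \<Longrightarrow> v \<bullet> w = 0"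
  by (simp add: normal_space_def)

lemma tangent_normal_orthogonal':
  "w \<in> tangent_space m M q \<Longrightarrow> v \<in> normal_space m M q \<Longrightarrow> w \<bullet> v = 0"
  using tangent_normal_orthogonal[of v q w] by (simp add: inner_commute)

lemma nu_normal: "q \<in> M \<Longrightarrow> q \<in> V \<Longrightarrow> u \<in> coord_space J \<Longrightarrow> nu q u \<in> normal_space m M q"
  using inner_coord_space_Compl by (auto simp: normal_space_def nu_inner tangent_space_eq)

text \<open>The transpose of \<open>dPsi (\<Phi> q)\<close>. It inverts \<open>nu q\<close> and so
  recovers the J coordinates of a normal vector.\<close>

definition mu :: "real^'n \<Rightarrow> real^'n \<Rightarrow> real^'n" where
  "mu q v = (\<chi> j. dPsi (\<Phi> q) (axis j 1) \<bullet> v)"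

lemma mu_inner:
  assumes "q \<in> V"
  shows "mu q v \<bullet> z = dPsi (\<Phi> q) z \<bullet> v"
  using assms
  by (subst linear_vec_expand[OF linear_dPsi, of "\<Phi> q" z])
     (auto simp: mu_def inner_vec_def[of "\<chi> j. _ j"] inner_sum_left mult.commute)

lemma linear_mu: "linear (mu q)"
  by (rule linearI) (simp_all add: mu_def vec_eq_iff inner_add_right)

lemma nu_mu:
  assumes q: "q \<in> V"
  shows "nu q (mu q v) = v"
proof -
  have "nu q (mu q v) \<bullet> x = v \<bullet> x" for x
    using nu_inner[OF q, of "mu q v" x] mu_inner[OF q, of v "dPhi q x"]
    by (simp add: inner_commute dPsi_dPhi q)
  then show ?thesis using vector_eq_ldot vector_eq_rdot by blast
qed

lemma mu_nu:
  assumes q: "q \<in> V"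
  shows "mu q (nu q u) = u"
proof -
  have "mu q (nu q u) \<bullet> x = u \<bullet> x" for x
    using nu_inner[OF q, of u "dPsi (\<Phi> q) x"] mu_inner[OF q, of "nu q u" x]
    by (simp add: inner_commute dPhi_dPsi q)
  then show ?thesis using vector_eq_ldot vector_eq_rdot by blast
qed

lemma mu_coord_space:
  assumes q: "q \<in> M" "q \<in> V" and v: "v \<in> normal_space m M q"
  shows "mu q v \<in> coord_space J"
  unfolding coord_space_Compl_iff
proof
  fix x assume "x \<in> coord_space I"
  then have "dPsi (\<Phi> q) x \<in> tangent_space m M q" using tangent_space_image[OF q] by blast
  then show "x \<bullet> mu q v = 0"
    using mu_inner[OF q(2), of v x] tangent_normal_orthogonal[OF v] by (simp add: inner_commute)
qed

lemma sff_matrix_eq: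
  assumes q: "q \<in> M" "q \<in> V" and v: "v \<in> normal_space m M q" and ij: "i < m" "j < m"
  shows "sff_matrix m M q v i j = - (ddPhi q (tangent_onb m M q i) (tangent_onb m M q j) \<bullet> mu q v)"
  using second_fundamental_form_eq[OF q tangent_onb(1)[OF q ij(1)] tangent_onb(1)[OF q ij(2)] mu_coord_space[OF q v]]
  by (simp add: sff_matrix_def nu_mu q)

lemma sff_matrix_scale:
  assumes q: "q \<in> M" "q \<in> V" and v: "v \<in> normal_space m M q" and ij: "i < m" "j < m"
  shows "sff_matrix m M q (a *\<^sub>R v) i j = a * sff_matrix m M q v i j"
proof -
  have "a *\<^sub>R v \<in> normal_space m M q" using v by (simp add: normal_space_def)
  then show ?thesis using sff_matrix_eq[OF q _ ij] v by (simp add: linear_scale[OF linear_mu])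
qed

lemma psi_scale:
  assumes q: "q \<in> M" "q \<in> V" and v: "v \<in> normal_space m M q"
  shows "psi m M q (a *\<^sub>R v) k = a ^ k * psi m M q v k"
proof -
  have "det_coeffs m (sff_matrix m M q (a *\<^sub>R v)) = det_coeffs m (\<lambda>i j. a * sff_matrix m M q v i j)"
    by (rule det_coeffs_cong) (simp add: sff_matrix_scale[OF q v])
  then show ?thesis by (simp add: psi_eq_det_coeffs det_coeffs_scale)
qed

text \<open>The normal exponential map in coordinates: the I part of x gives the base point, the J
  part the fibre coordinate. The fibre is parametrised by \<open>nu\<close>, which depends smoothly
  on the base point, rather than by \<open>frame\<close>.\<close>

definition "tube_map x = \<Psi> (P x) + nu (\<Psi> (P x)) (Q x)"

text \<open>The middle summand is the variation of \<open>nu\<close> with the base point; it is the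
  source of the second fundamental form in the Jacobian.\<close>

definition "dtube x h = dPsi (P x) (P h)
   + (\<chi> j. ddPhi (\<Psi> (P x)) (dPsi (P x) (P h)) (axis j 1) \<bullet> Q x) + nu (\<Psi> (P x)) (Q h)"

definition "dzero y h = dPsi y (P h) + nu (\<Psi> y) (Q h)"

section \<open>The derivative of the tube map and its determinant\<close>

lemma has_derivative_vec_lambda:
  assumes "\<And>i. ((\<lambda>x. f i x) has_derivative f' i) F"
  shows "((\<lambda>x. (\<chi> i. f i x) :: real^'k) has_derivative (\<lambda>h. \<chi> i. f' i h)) F"
proof -
  have "((\<lambda>x. \<Sum>i\<in>UNIV. f i x *\<^sub>R (axis i 1 :: real^'k)) has_derivative (\<lambda>h. \<Sum>i\<in>UNIV. f' i h *\<^sub>R axis i 1)) F"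
    by (intro has_derivative_sum has_derivative_scaleR_left assms)
  moreover have "(\<Sum>i\<in>UNIV. c i *\<^sub>R (axis i 1 :: real^'k)) = (\<chi> i. c i)" for c :: "'k \<Rightarrow> real"
    using vec_sum_axis[of "\<chi> i. c i"] by simp
  ultimately show ?thesis by simp
qed

lemma tube_map_derivative:
  assumes x: "P x \<in> \<Phi> ` V"
  shows "(tube_map has_derivative dtube x) (at x)"
proof -
  have bl: "bounded_linear P" "bounded_linear Q"
    using linear_coord_proj by (auto simp: linear_conv_bounded_linear)
  let ?q = "\<Psi> (P x)"
  have q: "?q \<in> V" using x by (rule \<Psi>_in_V)
  have Q: "(Q has_derivative Q) (at x)" using bl(2) by (rule bounded_linear_imp_has_derivative)
  have \<Psi>: "((\<lambda>x. \<Psi> (P x)) has_derivative (\<lambda>h. dPsi (P x) (P h))) (at x)"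
    using has_derivative_compose[OF bounded_linear_imp_has_derivative[OF bl(1)] dPsi[OF x]] .
  have D: "((\<lambda>x. dPhi (\<Psi> (P x)) (axis j 1)) has_derivative (\<lambda>h. ddPhi ?q (dPsi (P x) (P h)) (axis j 1))) (at x)" for j
    using has_derivative_compose[OF \<Psi> ddPhi[OF q]] .
  have N: "((\<lambda>x. nu (\<Psi> (P x)) (Q x)) has_derivative
     (\<lambda>h. \<chi> j. dPhi ?q (axis j 1) \<bullet> Q h + ddPhi ?q (dPsi (P x) (P h)) (axis j 1) \<bullet> Q x)) (at x)"
    unfolding nu_def by (intro has_derivative_vec_lambda has_derivative_inner D Q)
  have "(tube_map has_derivative (\<lambda>h. dPsi (P x) (P h)
      + (\<chi> j. dPhi ?q (axis j 1) \<bullet> Q h + ddPhi ?q (dPsi (P x) (P h)) (axis j 1) \<bullet> Q x))) (at x)"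
    unfolding tube_map_def[abs_def] by (intro has_derivative_add \<Psi> N)
  moreover have "(\<lambda>h. dPsi (P x) (P h)
      + (\<chi> j. dPhi ?q (axis j 1) \<bullet> Q h + ddPhi ?q (dPsi (P x) (P h)) (axis j 1) \<bullet> Q x)) = dtube x"
    by (auto simp: fun_eq_iff dtube_def nu_def vec_eq_iff)
  ultimately show ?thesis by simp
qed

lemma linear_dzero: "y \<in> \<Phi> ` V \<Longrightarrow> linear (dzero y)"
  unfolding dzero_def[abs_def]
  by (intro linear_compose_add linear_compose[OF linear_coord_proj linear_dPsi, unfolded o_def]
      linear_compose[OF linear_coord_proj linear_nu, unfolded o_def])

lemma base_point:
  assumes "P x \<in> \<Phi> ` V"
  shows "\<Psi> (P x) \<in> M" "\<Psi> (P x) \<in> V" "\<Phi> (\<Psi> (P x)) = P x"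
  using assms \<Psi>_in_M \<Psi>_in_V \<Phi>\<Psi> by auto

text \<open>With z = \<open>dzero (P x) h\<close> one has \<open>dtube x h\<close> = z + K z, where
  K z is the variation of \<open>nu\<close> along the tangential part of z. In the frame, K kills
  the normal axes, so the determinant of id + K reduces to the tangential block, which is Id -
  S.\<close>

lemma det_dtube:
  assumes x: "P x \<in> \<Phi> ` V"
  defines "q \<equiv> \<Psi> (P x)"
  shows "det (matrix (dtube x)) = det (matrix (dzero (P x))) *
    detm m (\<lambda>i j. (if i = j then 1 else 0) - sff_matrix m M q (nu q (Q x)) i j)"
proof -
  have q: "q \<in> M" "q \<in> V" and \<Phi>q: "\<Phi> q = P x" using base_point[OF x] by (simp_all add: q_def)
  let ?R = "frame q" and ?\<sigma> = "coord_enum m I"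
  obtain R' where R': "orthogonal_transformation R'" "\<And>x. R' (?R x) = x" "\<And>x. ?R (R' x) = x"
    using frame_inverse[OF q] by metis
  have linR: "linear ?R" "linear R'" using frame(1)[OF q] R'(1) by (auto simp: orthogonal_transformation_def)
  define K where "K z = (\<chi> j. ddPhi q (?R (P (R' z))) (axis j 1) \<bullet> Q x)" for z
  have linK: "linear K"
  proof -
    have "linear (\<lambda>z. ?R (P (R' z)))"
      using linear_compose[OF linear_compose[OF linR(2) linear_coord_proj[of I]] linR(1)] by (simp add: o_def)
    then have lin: "linear (\<lambda>z. ddPhi q (?R (P (R' z))) (axis j 1))" for j
      using linear_compose[OF _ linear_ddPhi_left[OF q(2)]] by (fastforce simp: o_def)
    show ?thesis
      by (intro linearI) (simp_all add: K_def vec_eq_iff linear_add[OF lin] linear_scale[OF lin] inner_add_left)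
  qed
  have linIK: "linear (\<lambda>z. z + K z)" by (intro linear_compose_add linear_id[unfolded id_def] linK)
  \<comment> \<open>Conjugating P by the frame gives the orthogonal projection onto the tangent
    space: it keeps the first summand of \<open>dzero\<close> and kills the second, which is
    normal.\<close>
  have RPR: "?R (P (R' (dzero (P x) h))) = dPsi (P x) (P h)" for h
  proof -
    have "dPsi (P x) (P h) \<in> ?R ` coord_space I"
      unfolding frame_tangent[OF q] tangent_space_image[OF q] \<Phi>q by simp
    then obtain a where a: "a \<in> coord_space I" "dPsi (P x) (P h) = ?R a" by blast
    have "nu q (Q h) \<in> ?R ` coord_space J"
      unfolding frame_normal[OF q] by (rule nu_normal[OF q]) simp
    then obtain b where b: "b \<in> coord_space J" "nu q (Q h) = ?R b" by blast
    have "P b = 0" using b(1) by (simp add: vec_eq_iff coord_space_iff)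
    then show ?thesis
      using a b by (simp add: dzero_def q_def[symmetric] linear_add[OF linR(2)] R'(2) coord_proj_add coord_proj_space)
  qed
  have "dtube x = (\<lambda>h. dzero (P x) h + K (dzero (P x) h))"
    by (simp add: fun_eq_iff dtube_def K_def RPR) (simp add: dzero_def q_def)
  then have "det (matrix (dtube x)) = det (matrix (\<lambda>z. z + K z)) * det (matrix (dzero (P x)))"
    using det_matrix_comp[OF linIK linear_dzero[OF x]] by simp
  moreover have "det (matrix (\<lambda>z. z + K z)) = det (matrix (\<lambda>z. R' (?R z + K (?R z))))"
  proof -
    have 1: "det (matrix (\<lambda>z. R' (?R z + K (?R z)))) = det (matrix R') * (det (matrix (\<lambda>z. z + K z)) * det (matrix ?R))"
      using det_matrix_comp[OF linR(2) linear_compose[OF linR(1) linIK]] det_matrix_comp[OF linIK linR(1)]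
      by (simp add: o_def)
    have "det (matrix R') * det (matrix ?R) = det (matrix (\<lambda>z. z :: real^'n))"
      using det_matrix_comp[OF linR(2,1)] by (simp add: R'(2))
    also have "\<dots> = 1" by (simp add: matrix_id_mat_1[unfolded id_def])
    finally show ?thesis using 1 by algebra
  qed
  \<comment> \<open>Since K sees only the tangential part, it is the columns outside I that are unit
    columns, hence the transposed order of the indices.\<close>
  moreover have "det (matrix (\<lambda>z. R' (?R z + K (?R z))))
     = detm m (\<lambda>i j. matrix (\<lambda>z. R' (?R z + K (?R z))) $ ?\<sigma> j $ ?\<sigma> i)"
  proof (rule det_transpose_eq_detm)
    show "inj_on ?\<sigma> {..<m}" using coord_enum[OF card_I] by (simp add: bij_betw_def)
    fix a b assume "b \<notin> ?\<sigma> ` {..<m}"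
    then have "b \<notin> I" using coord_enum[OF card_I] by (simp add: bij_betw_def)
    then have P0: "P (axis b 1) = 0" by (simp add: vec_eq_iff axis_def)
    have "K (?R (axis b 1)) = 0"
      by (simp add: K_def R'(2) P0 linear_0[OF linR(1)] linear_0[OF linear_ddPhi_left[OF q(2)]] vec_eq_iff)
    then show "matrix (\<lambda>z. R' (?R z + K (?R z))) $ a $ b = (if a = b then 1 else 0)"
      by (simp add: matrix_def R'(2) axis_def)
  qed
  moreover have "detm m (\<lambda>i j. matrix (\<lambda>z. R' (?R z + K (?R z))) $ ?\<sigma> j $ ?\<sigma> i)
      = detm m (\<lambda>i j. (if i = j then 1 else 0) - sff_matrix m M q (nu q (Q x)) i j)"
  proof (rule detm_cong)
    fix i j assume ij: "i < m" "j < m"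
    let ?e = "tangent_onb m M q"
    have \<sigma>: "?\<sigma> k \<in> I" if "k < m" for k using coord_enum[OF card_I] that by (auto simp: bij_betw_def)
    have inj: "?\<sigma> i = ?\<sigma> j \<longleftrightarrow> i = j" using coord_enum[OF card_I] ij by (auto simp: bij_betw_def inj_on_def)
    have "matrix (\<lambda>z. R' (?R z + K (?R z))) $ ?\<sigma> j $ ?\<sigma> i = R' (?R (axis (?\<sigma> i) 1) + K (?R (axis (?\<sigma> i) 1))) $ ?\<sigma> j"
      by (simp add: matrix_def)
    also have "\<dots> = axis (?\<sigma> i) 1 $ ?\<sigma> j + R' (K (?e i)) \<bullet> axis (?\<sigma> j) 1"
      unfolding linear_add[OF linR(2)] R'(2) by (simp add: frame(2)[OF q ij(1)] inner_axis)
    also have "axis (?\<sigma> i) (1::real) $ ?\<sigma> j = (if i = j then 1 else 0)"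
      using inj by (auto simp: axis_def)
    also have "R' (K (?e i)) \<bullet> axis (?\<sigma> j) 1 = ?R (R' (K (?e i))) \<bullet> ?R (axis (?\<sigma> j) 1)"
      by (simp add: frame_inner[OF q])
    also have "\<dots> = K (?e i) \<bullet> ?e j" by (simp add: R'(3) frame(2)[OF q ij(2)])
    also have "K (?e i) = (\<chi> l. ddPhi q (?e i) (axis l 1) \<bullet> Q x)"
    proof -
      have "?R (P (R' (?R (axis (?\<sigma> i) 1)))) = ?R (axis (?\<sigma> i) 1)"
        using \<sigma>[OF ij(1)] by (simp add: R'(2) coord_proj_space)
      then show ?thesis by (simp add: K_def frame(2)[OF q ij(1)])
    qed
    also have "(\<chi> l. ddPhi q (?e i) (axis l 1) \<bullet> Q x) \<bullet> ?e j = ddPhi q (?e i) (?e j) \<bullet> Q x"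
      by (subst ddPhi_expand_right[OF q(2), of _ "?e j"])
         (simp add: inner_vec_def[of "\<chi> l. _ l"] inner_sum_left mult.commute)
    also have "ddPhi q (?e i) (?e j) \<bullet> Q x = - sff_matrix m M q (nu q (Q x)) i j"
      using sff_matrix_eq[OF q nu_normal[OF q, of "Q x"] ij] by (simp add: mu_nu q)
    finally show "matrix (\<lambda>z. R' (?R z + K (?R z))) $ ?\<sigma> j $ ?\<sigma> i
        = (if i = j then 1 else 0) - sff_matrix m M q (nu q (Q x)) i j" by simp
  qed
  ultimately show ?thesis by simp
qed

section \<open>The Jacobian at the zero section\<close>

text \<open>\<open>dzero\<close> is \<open>dtube\<close> at the zero section; it factors through the isometry \<open>frame q\<close> into \<open>tang_iso q\<close>,
  whose determinant is the Jacobian \<open>jac\<close> of the parametrisation, and \<open>norm_iso q\<close>, which only acts in the fibre.\<close>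
definition "gram y = (\<chi> a b. if a \<in> I \<and> b \<in> I then dPsi y (axis a 1) \<bullet> dPsi y (axis b 1) else if a = b then 1 else 0)"

definition "jac y = sqrt (det (gram y))"

definition "tang_iso q h = dPsi (\<Phi> q) (P h) + frame q (Q h)"
definition "norm_iso q h = frame q (P h) + nu q (Q h)"

lemma linear_tang_iso: "q \<in> M \<Longrightarrow> q \<in> V \<Longrightarrow> linear (tang_iso q)"
  unfolding tang_iso_def[abs_def]
  by (intro linear_compose_add linear_compose[OF linear_coord_proj linear_dPsi, unfolded o_def]
      linear_compose[OF linear_coord_proj linear_frame, unfolded o_def]) auto

lemma linear_norm_iso: "q \<in> M \<Longrightarrow> q \<in> V \<Longrightarrow> linear (norm_iso q)"
  unfolding norm_iso_def[abs_def]
  by (intro linear_compose_add linear_compose[OF linear_coord_proj linear_nu, unfolded o_def]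
      linear_compose[OF linear_coord_proj linear_frame, unfolded o_def]) auto

lemma orthogonal_sum_0: "(v :: 'a::real_inner) \<bullet> w = 0 \<Longrightarrow> v + w = 0 \<Longrightarrow> v = 0 \<and> w = 0"
  by (metis add_cancel_right_left add_eq_0_iff inner_eq_zero_iff inner_minus_right neg_equal_0_iff_equal)

lemma coord_split_0: "P h = 0 \<Longrightarrow> Q h = 0 \<Longrightarrow> h = 0"
  using coord_proj_Compl_add[of I h] by simp

lemma det_tang_iso_nz:
  assumes q: "q \<in> M" "q \<in> V"
  shows "det (matrix (tang_iso q)) \<noteq> 0"
proof -
  have "h = 0" if "tang_iso q h = 0" for h
  proof -
    have "dPsi (\<Phi> q) (P h) \<in> tangent_space m M q" using tangent_space_image[OF q] by simp
    moreover have "frame q (Q h) \<in> normal_space m M q" unfolding frame_normal[OF q, symmetric] by simp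
    ultimately have "dPsi (\<Phi> q) (P h) = 0 \<and> frame q (Q h) = 0"
      using that by (intro orthogonal_sum_0 tangent_normal_orthogonal') (auto simp: tang_iso_def)
    then have "P h = 0" "Q h = 0"
      using dPhi_dPsi[OF q(2), of "P h"] norm_frame[OF q, of "Q h"] linear_0[OF linear_dPhi[OF q(2)]] by auto
    then show "h = 0" by (rule coord_split_0)
  qed
  then show ?thesis using det_nz_iff_inj[OF linear_tang_iso[OF q]] linear_injective_0[OF linear_tang_iso[OF q]] by blast
qed

lemma det_norm_iso_nz:
  assumes q: "q \<in> M" "q \<in> V"
  shows "det (matrix (norm_iso q)) \<noteq> 0"
proof -
  have "h = 0" if "norm_iso q h = 0" for h
  proof -
    have "frame q (P h) \<in> tangent_space m M q" unfolding frame_tangent[OF q, symmetric] by simp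
    moreover have "nu q (Q h) \<in> normal_space m M q" by (rule nu_normal[OF q]) simp
    ultimately have "frame q (P h) = 0 \<and> nu q (Q h) = 0"
      using that by (intro orthogonal_sum_0 tangent_normal_orthogonal') (auto simp: norm_iso_def)
    then have "P h = 0" "Q h = 0"
      using mu_nu[OF q(2), of "Q h"] norm_frame[OF q, of "P h"] linear_0[OF linear_mu] by auto
    then show "h = 0" by (rule coord_split_0)
  qed
  then show ?thesis using det_nz_iff_inj[OF linear_norm_iso[OF q]] linear_injective_0[OF linear_norm_iso[OF q]] by blast
qed

text \<open>For E the matrix of \<open>tang_iso q\<close>, \<open>gram\<close> is the product of the
  transpose of E with E: mixed entries vanish because tangent and normal vectors are orthogonal, and
  the normal block is the identity because the frame is orthonormal. So \<open>jac\<close>, which is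
  continuous by its definition, equals a determinant that involves the chosen frame.\<close>

lemma jac_eq:
  assumes q: "q \<in> M" "q \<in> V"
  shows "jac (\<Phi> q) = \<bar>det (matrix (tang_iso q))\<bar>"
proof -
  let ?E = "matrix (tang_iso q)"
  have col: "tang_iso q (axis a 1) = (if a \<in> I then dPsi (\<Phi> q) (axis a 1) else frame q (axis a 1))" for a
  proof -
    have "P (axis a 1) = (if a \<in> I then axis a 1 else 0)" "Q (axis a 1) = (if a \<in> I then 0 else axis a 1)"
      by (auto simp: vec_eq_iff axis_def)
    then show ?thesis using q linear_0[OF linear_dPsi, of "\<Phi> q"] linear_0[OF linear_frame[OF q]]
      by (simp add: tang_iso_def)
  qed
  have mix: "dPsi (\<Phi> q) (axis a 1) \<bullet> frame q (axis b 1) = 0" if "a \<in> I" "b \<notin> I" for a b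
  proof -
    have "dPsi (\<Phi> q) (axis a 1) \<in> tangent_space m M q" using tangent_space_image[OF q] that by simp
    moreover have "frame q (axis b 1) \<in> normal_space m M q" unfolding frame_normal[OF q, symmetric] using that by simp
    ultimately show ?thesis by (rule tangent_normal_orthogonal')
  qed
  have "(transpose ?E ** ?E) $ a $ b = tang_iso q (axis a 1) \<bullet> tang_iso q (axis b 1)" for a b
    by (simp add: matrix_matrix_mult_def transpose_def matrix_def inner_vec_def)
  moreover have "tang_iso q (axis a 1) \<bullet> tang_iso q (axis b 1) = gram (\<Phi> q) $ a $ b" for a b
    using mix[of a b] mix[of b a]
    by (auto simp: col gram_def frame_inner[OF q] inner_commute inner_axis_axis)
  ultimately have "transpose ?E ** ?E = gram (\<Phi> q)" by (simp add: vec_eq_iff)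
  then have "det (gram (\<Phi> q)) = det ?E * det ?E" by (metis det_mul det_transpose)
  then show ?thesis by (simp add: jac_def real_sqrt_abs2)
qed

lemma jac_pos: "q \<in> M \<Longrightarrow> q \<in> V \<Longrightarrow> jac (\<Phi> q) > 0"
  using jac_eq det_tang_iso_nz by simp

lemma det_dzero:
  assumes q: "q \<in> M" "q \<in> V"
  shows "\<bar>det (matrix (dzero (\<Phi> q)))\<bar> = jac (\<Phi> q) * \<bar>det (matrix (norm_iso q))\<bar>"
proof -
  let ?R = "frame q"
  obtain R' where R': "orthogonal_transformation R'" "\<And>x. R' (?R x) = x" "\<And>x. ?R (R' x) = x"
    using frame_inverse[OF q] by metis
  have linR: "linear R'" using R'(1) by (auto simp: orthogonal_transformation_def)
  have "tang_iso q (R' (norm_iso q h)) = dzero (\<Phi> q) h" for h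
  proof -
    have "nu q (Q h) \<in> ?R ` coord_space J"
      unfolding frame_normal[OF q] by (rule nu_normal[OF q]) simp
    then obtain b where b: "b \<in> coord_space J" "nu q (Q h) = ?R b" by blast
    have "P b = 0" using b(1) by (simp add: vec_eq_iff coord_space_iff)
    then show ?thesis
      using b by (simp add: norm_iso_def tang_iso_def dzero_def linear_add[OF linR] R'(2) \<Psi>\<Phi> q coord_proj_add coord_proj_space)
  qed
  then have "dzero (\<Phi> q) = (\<lambda>h. tang_iso q (R' (norm_iso q h)))" by (simp add: fun_eq_iff)
  then have "det (matrix (dzero (\<Phi> q))) = det (matrix (tang_iso q)) * (det (matrix R') * det (matrix (norm_iso q)))"
    using det_matrix_comp[OF linear_tang_iso[OF q] linear_compose[OF linear_norm_iso[OF q] linR]]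
      det_matrix_comp[OF linR linear_norm_iso[OF q]] by (simp add: o_def)
  then show ?thesis
    using det_orthogonal_transformation[OF R'(1)] by (simp add: abs_mult jac_eq[OF q])
qed

end

section \<open>Integration over the normal bundle\<close>

text \<open>The integral of the absolute value of \<psi>_i over the ball of radius \<epsilon> in the
  normal space at q. No chart occurs in it, so contributions from different charts can be
  added.\<close>

definition normal_ball_integral ::
  "nat \<Rightarrow> (real^'n) set \<Rightarrow> 'n set \<Rightarrow> real \<Rightarrow> nat \<Rightarrow> real^'n \<Rightarrow> ennreal" where
  "normal_ball_integral m M I \<epsilon> i q =
     (\<integral>\<^sup>+w. indicator {z. norm z \<le> \<epsilon>} (coord_proj (-I) w) *
        ennreal \<bar>psi m M q (tangent_frame m M I q (coord_proj (-I) w)) i\<bar> \<partial>coord_measure (-I))"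

text \<open>A set whose projection is a single point has projected diameter 0, so the isodiametric
  inequality in positive dimension makes it null.\<close>

lemma AE_coord_proj_nonzero:
  assumes "I \<noteq> {}"
  shows "AE w in coord_measure I. coord_proj I (w :: real^'n) \<noteq> 0"
proof (rule AE_I[where N="{w. coord_proj I w = 0}"])
  have [measurable]: "{w. coord_proj I (w :: real^'n) = 0} \<in> sets borel" by measurable
  have "card I \<noteq> 0" using assms by (simp add: card_eq_0_iff)
  moreover have "emeasure (coord_measure I) {w. coord_proj I (w :: real^'n) = 0}
      \<le> ennreal (unit_ball_vol (card I) * (0 / 2) ^ card I)"
    by (rule isodiametric_coord) auto
  ultimately show "emeasure (coord_measure I) {w. coord_proj I (w :: real^'n) = 0} = 0"
    by (simp add: power_0_left)
qed auto

context flat_chart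
begin

text \<open>For fixed q the entries of the matrix are linear in the normal vector through
  \<open>mu\<close>, so the determinants are measurable in w, and with them their
  coefficients.\<close>

lemma measurable_psi_linear:
  assumes q: "q \<in> M" "q \<in> V" and i: "i \<le> m" and f: "linear f" and fN: "\<And>w. f w \<in> normal_space m M q"
  shows "(\<lambda>w::real^'n. psi m M q (f w) i) \<in> borel_measurable borel"
proof (rule measurable_polynomial_coeffs[where c="\<lambda>w. psi m M q (f w)" and N=borel, OF _ _ i])
  show "detm m (\<lambda>k j. (if k = j then 1 else 0) - t * sff_matrix m M q (f w) k j) = (\<Sum>i\<le>m. t ^ i * psi m M q (f w) i)"
    for w t by (simp add: psi_eq_det_coeffs det_coeffs(1))
  fix t
  have [measurable]: "(\<lambda>w. mu q (f w)) \<in> borel_measurable borel"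
    using linear_compose[OF f linear_mu] by (intro measurable_linear_borel) (simp add: o_def)
  have "(\<lambda>w. detm m (\<lambda>k j. (if k = j then 1 else 0) - t * sff_matrix m M q (f w) k j))
     = (\<lambda>w. detm m (\<lambda>k j. (if k = j then 1 else 0) + t * (ddPhi q (tangent_onb m M q k) (tangent_onb m M q j) \<bullet> mu q (f w))))"
    by (intro ext detm_cong) (simp add: sff_matrix_eq[OF q fN])
  also have "\<dots> \<in> borel_measurable borel" unfolding detm_def by measurable
  finally show "(\<lambda>w. detm m (\<lambda>k j. (if k = j then 1 else 0) - t * sff_matrix m M q (f w) k j)) \<in> borel_measurable borel" .
qed

lemma linear_frame_Q: "q \<in> M \<Longrightarrow> q \<in> V \<Longrightarrow> linear (\<lambda>w. frame q (Q w))"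
  using linear_compose[OF linear_coord_proj linear_frame] by (simp add: o_def)

lemma frame_Q_normal: "q \<in> M \<Longrightarrow> q \<in> V \<Longrightarrow> frame q (Q w) \<in> normal_space m M q"
  using frame_normal by (metis coord_proj_in_space imageI)

lemma card_J: "card J = CARD('n) - m"
  by (simp add: Compl_eq_Diff_UNIV card_Diff_subset card_I)

text \<open>Polar coordinates in the normal space, using that \<open>psi\<close> is homogeneous of degree \<open>i\<close>.\<close>
lemma normal_ball_integral_le:
  assumes q: "q \<in> M" "q \<in> V" and i: "i \<le> m" and m: "m < CARD('n)" and \<epsilon>: "\<epsilon> > 0"
  shows "normal_ball_integral m M I \<epsilon> i q
    \<le> ennreal (\<epsilon> ^ (CARD('n) - m + i) / real (CARD('n) - m + i)) *
        (\<integral>\<^sup>+v\<in>unit_normal_sphere m M q. ennreal \<bar>psi m M q v i\<bar> \<partial>hausdorff_measure (CARD('n) - m - 1))"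
proof -
  have J0: "J \<noteq> {}" using m card_J by auto
  obtain R' where R': "linear R'" "\<And>x. R' (frame q x) = x" "\<And>x. frame q (R' x) = x"
    using frame_inverse[OF q] by metis
  \<comment> \<open>The map v -> \<open>frame q (Q (R' v))\<close> is the orthogonal projection onto
    the normal space. It makes g Borel on the whole space and leaves normal vectors
    unchanged.\<close>
  define g where "g v = ennreal \<bar>psi m M q (frame q (Q (R' v))) i\<bar>" for v
  have "linear (\<lambda>v. frame q (Q (R' v)))"
    using linear_compose[OF R'(1) linear_frame_Q[OF q]] by (simp add: o_def)
  then have g[measurable]: "g \<in> borel_measurable borel"
    unfolding g_def using measurable_psi_linear[OF q i _ frame_Q_normal[OF q]] by simp
  have "normal_ball_integral m M I \<epsilon> i q
      = (\<integral>\<^sup>+w. indicator {z. z \<noteq> 0 \<and> norm z \<le> \<epsilon>} (Q w) * ennreal (norm (Q w) ^ i) * g (frame q (sgn (Q w))) \<partial>coord_measure J)"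
    unfolding normal_ball_integral_def
  proof (rule nn_integral_cong_AE)
    show "AE w in coord_measure J. indicator {z. norm z \<le> \<epsilon>} (Q w) * ennreal \<bar>psi m M q (frame q (Q w)) i\<bar>
       = indicator {z. z \<noteq> 0 \<and> norm z \<le> \<epsilon>} (Q w) * ennreal (norm (Q w) ^ i) * g (frame q (sgn (Q w)))"
      using AE_coord_proj_nonzero[OF J0]
    proof eventually_elim
      case (elim w)
      have s: "sgn (Q w) = Q (sgn (Q w))" by (simp add: sgn_div_norm coord_proj_scaleR)
      have "Q w = norm (Q w) *\<^sub>R sgn (Q w)" using elim by (simp add: sgn_div_norm)
      then have "frame q (Q w) = norm (Q w) *\<^sub>R frame q (sgn (Q w))"
        by (metis linear_scale[OF linear_frame[OF q]])
      moreover have "frame q (sgn (Q w)) \<in> normal_space m M q"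
        using frame_Q_normal[OF q, of "sgn (Q w)"] s by simp
      ultimately have "psi m M q (frame q (Q w)) i = norm (Q w) ^ i * psi m M q (frame q (sgn (Q w))) i"
        using psi_scale[OF q] by simp
      moreover have "g (frame q (sgn (Q w))) = ennreal \<bar>psi m M q (frame q (sgn (Q w))) i\<bar>"
        using s by (simp add: g_def R'(2))
      ultimately show ?case
        using elim by (simp add: abs_mult ennreal_mult indicator_def)
    qed
  qed
  also have "\<dots> \<le> ennreal (\<epsilon> ^ (card J + i) / real (card J + i)) *
        (\<integral>\<^sup>+v. g v * indicator (frame q ` coord_sphere J) v \<partial>hausdorff_measure (card J - 1))"
    by (rule sphere_integral_le[OF frame(1)[OF q] J0 \<epsilon> g])
  also have "(\<integral>\<^sup>+v. g v * indicator (frame q ` coord_sphere J) v \<partial>hausdorff_measure (card J - 1))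
      = (\<integral>\<^sup>+v\<in>unit_normal_sphere m M q. ennreal \<bar>psi m M q v i\<bar> \<partial>hausdorff_measure (card J - 1))"
  proof (rule nn_integral_cong)
    fix v
    show "g v * indicator (frame q ` coord_sphere J) v
        = ennreal \<bar>psi m M q v i\<bar> * indicator (unit_normal_sphere m M q) v"
      unfolding frame_sphere[OF q, symmetric]
      by (auto simp: indicator_def g_def R'(2) coord_sphere_def)
  qed
  finally show ?thesis by (simp add: card_J)
qed

lemma nu_Q_normal: "q \<in> M \<Longrightarrow> q \<in> V \<Longrightarrow> nu q (Q u) \<in> normal_space m M q"
  by (rule nu_normal) auto

text \<open>The fibre coordinates are changed from those of \<open>frame\<close> to those of
  \<open>nu\<close>. The determinant that enters makes up that of \<open>dzero\<close> together with
  \<open>jac\<close>.\<close>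

lemma normal_ball_integral_nu:
  assumes q: "q \<in> M" "q \<in> V" and i: "i \<le> m"
  shows "normal_ball_integral m M I \<epsilon> i q = ennreal \<bar>det (matrix (norm_iso q))\<bar> *
     (\<integral>\<^sup>+u. indicator {z. norm z \<le> \<epsilon>} (nu q (Q u)) * ennreal \<bar>psi m M q (nu q (Q u)) i\<bar> \<partial>coord_measure J)"
proof -
  obtain R' where R': "orthogonal_transformation R'" "linear R'" "\<And>x. R' (frame q x) = x" "\<And>x. frame q (R' x) = x"
     "\<And>x. norm (R' x) = norm x"
    using frame_inverse[OF q] by metis
  define D where "D h = R' (norm_iso q h)" for h
  define h where "h w = indicator {z. norm z \<le> \<epsilon>} (Q w) * ennreal \<bar>psi m M q (frame q (Q w)) i\<bar>" for w
  have [measurable]: "(\<lambda>w. psi m M q (frame q (Q w)) i) \<in> borel_measurable borel"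
    by (rule measurable_psi_linear[OF q i linear_frame_Q[OF q] frame_Q_normal[OF q]])
  have h[measurable]: "h \<in> borel_measurable borel" unfolding h_def by measurable
  have linD: "linear D" using linear_compose[OF linear_norm_iso[OF q] R'(2)] by (simp add: D_def[abs_def] o_def)
  have detD: "\<bar>det (matrix D)\<bar> = \<bar>det (matrix (norm_iso q))\<bar>"
    using det_matrix_comp[OF R'(2) linear_norm_iso[OF q]] det_orthogonal_transformation[OF R'(1)]
    by (simp add: D_def[abs_def] abs_mult)
  have DQ: "D (Q x) = R' (nu q (Q x))" for x
    by (simp add: D_def norm_iso_def linear_0[OF linear_frame[OF q]])
  have DQ_in: "Q (D (Q x)) = D (Q x)" for x
  proof -
    obtain b where "b \<in> coord_space J" "nu q (Q x) = frame q b"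
      using nu_Q_normal[OF q, of x] unfolding frame_normal[OF q, symmetric] by blast
    then show ?thesis by (simp add: DQ R'(3) coord_proj_space)
  qed
  have DP: "D (coord_proj (- J) x) = coord_proj (- J) x" for x
    by (simp add: D_def norm_iso_def R'(3) linear_0[OF linear_nu])
  have "normal_ball_integral m M I \<epsilon> i q = (\<integral>\<^sup>+w. h w \<partial>coord_measure J)"
    by (simp add: normal_ball_integral_def h_def)
  also have "\<dots> = ennreal \<bar>det (matrix D)\<bar> * (\<integral>\<^sup>+u. h (D (Q u)) \<partial>coord_measure J)"
    by (rule nn_integral_coord_linear[OF linD _ DQ_in DP h]) (use detD det_norm_iso_nz[OF q] in auto)
  finally have 1: "normal_ball_integral m M I \<epsilon> i q = ennreal \<bar>det (matrix D)\<bar> * (\<integral>\<^sup>+u. h (D (Q u)) \<partial>coord_measure J)" .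
  have "h (D (Q u)) = indicator {z. norm z \<le> \<epsilon>} (nu q (Q u)) * ennreal \<bar>psi m M q (nu q (Q u)) i\<bar>" for u
    unfolding h_def DQ_in by (simp add: DQ R' indicator_def)
  then show ?thesis unfolding 1 detD by simp
qed

section \<open>Continuity and measurability over the domain of the chart\<close>

definition "tube_dom = {x. P x \<in> \<Phi> ` V}"

lemma continuous_on_coord_proj: "continuous_on S (coord_proj K :: real^'n \<Rightarrow> real^'n)"
  using linear_continuous_on linear_coord_proj by (auto simp: linear_conv_bounded_linear)

lemma open_dom: "open tube_dom"
proof -
  have "tube_dom = P -` (\<Phi> ` V)" by (auto simp: tube_dom_def)
  then show ?thesis using open_vimage[OF V(4) continuous_on_coord_proj] by simp
qed

lemma dom_measurable [measurable]: "tube_dom \<in> sets borel"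
  using open_dom by simp

lemma dom_base: "x \<in> tube_dom \<Longrightarrow> \<Psi> (P x) \<in> M" "x \<in> tube_dom \<Longrightarrow> \<Psi> (P x) \<in> V" "x \<in> tube_dom \<Longrightarrow> \<Phi> (\<Psi> (P x)) = P x"
  using base_point by (auto simp: tube_dom_def)

lemma continuous_P:
  assumes "continuous_on (\<Phi> ` V) f"
  shows "continuous_on tube_dom (\<lambda>x. f (P x))"
  by (rule continuous_on_compose2[OF assms continuous_on_coord_proj]) (auto simp: tube_dom_def)

lemma continuous_\<Psi>: "continuous_on (\<Phi> ` V) \<Psi>"
  by (rule smooth_on_continuous[OF V(5)])

lemma continuous_base:
  assumes "continuous_on V f"
  shows "continuous_on tube_dom (\<lambda>x. f (\<Psi> (P x)))"
  by (rule continuous_on_compose2[OF assms continuous_P[OF continuous_\<Psi>]]) (auto simp: dom_base)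

lemma continuous_dPsi: "continuous_on (\<Phi> ` V) (\<lambda>y. dPsi y b)"
  by (rule smooth_on_continuous[OF smooth_dPsi])

lemma continuous_dPhi: "continuous_on V (\<lambda>q. dPhi q b)"
  by (rule smooth_on_continuous[OF smooth_dPhi])

lemma continuous_jac: "continuous_on (\<Phi> ` V) jac"
proof -
  have "continuous_on (\<Phi> ` V) (\<lambda>y. gram y $ a $ b)" for a b
  proof (cases "a \<in> I \<and> b \<in> I")
    case True
    then show ?thesis by (simp add: gram_def continuous_on_inner continuous_dPsi)
  next
    case False
    then have "gram y $ a $ b = (if a = b then 1 else 0)" for y by (auto simp: gram_def)
    then show ?thesis by (simp only: continuous_on_const)
  qed
  then show ?thesis unfolding jac_def by (intro continuous_on_real_sqrt continuous_on_det)
qed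

lemma continuous_nu: "continuous_on tube_dom (\<lambda>x. nu (\<Psi> (P x)) (Q x))"
  unfolding nu_def
  by (intro continuous_on_vec_lambda continuous_on_inner continuous_base[OF continuous_dPhi] continuous_on_coord_proj)

lemma continuous_det_dzero: "continuous_on tube_dom (\<lambda>x. det (matrix (dzero (P x))))"
proof (rule continuous_on_det)
  fix a b
  have "continuous_on tube_dom (\<lambda>x. dPsi (P x) (P (axis b 1)) $ a + dPhi (\<Psi> (P x)) (axis a 1) \<bullet> Q (axis b 1))"
    by (intro continuous_intros continuous_P[OF continuous_dPsi] continuous_base[OF continuous_dPhi])
  then show "continuous_on tube_dom (\<lambda>x. matrix (dzero (P x)) $ a $ b)"
    by (simp add: matrix_def dzero_def nu_def)
qed

lemma continuous_det_dtube: "continuous_on tube_dom (\<lambda>x. det (matrix (dtube x)))"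
proof (rule continuous_on_det)
  fix a b
  have "continuous_on tube_dom (\<lambda>x. dPsi (P x) (P (axis b 1)) $ a
      + (\<Sum>l\<in>UNIV. dPsi (P x) (P (axis b 1)) $ l *\<^sub>R ddPhi (\<Psi> (P x)) (axis l 1) (axis a 1)) \<bullet> Q x
      + dPhi (\<Psi> (P x)) (axis a 1) \<bullet> Q (axis b 1))"
    by (intro continuous_intros continuous_P[OF continuous_dPsi] continuous_base[OF continuous_dPhi]
        continuous_base[OF continuous_ddPhi] continuous_on_coord_proj)
  moreover have "matrix (dtube x) $ a $ b = dPsi (P x) (P (axis b 1)) $ a
      + (\<Sum>l\<in>UNIV. dPsi (P x) (P (axis b 1)) $ l *\<^sub>R ddPhi (\<Psi> (P x)) (axis l 1) (axis a 1)) \<bullet> Q x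
      + dPhi (\<Psi> (P x)) (axis a 1) \<bullet> Q (axis b 1)" if "x \<in> tube_dom" for x
    using linear_vec_expand[OF linear_ddPhi_left[OF dom_base(2)[OF that]], of "dPsi (P x) (P (axis b 1))" "axis a 1"]
    by (simp add: matrix_def dtube_def nu_def)
  ultimately show "continuous_on tube_dom (\<lambda>x. matrix (dtube x) $ a $ b)"
    by (simp cong: continuous_on_cong)
qed

lemma det_dzero_dom:
  assumes "x \<in> tube_dom"
  shows "\<bar>det (matrix (dzero (P x)))\<bar> = jac (P x) * \<bar>det (matrix (norm_iso (\<Psi> (P x))))\<bar>"
    and "det (matrix (dzero (P x))) \<noteq> 0" and "jac (P x) > 0"
proof -
  note q = dom_base[OF assms]
  show 1: "\<bar>det (matrix (dzero (P x)))\<bar> = jac (P x) * \<bar>det (matrix (norm_iso (\<Psi> (P x))))\<bar>"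
    using det_dzero[OF q(1,2)] q(3) by simp
  show 2: "jac (P x) > 0" using jac_pos[OF q(1,2)] q(3) by simp
  show "det (matrix (dzero (P x))) \<noteq> 0" using 1 2 det_norm_iso_nz[OF q(1,2)] by auto
qed

lemma det_dtube_dom:
  assumes "x \<in> tube_dom"
  shows "det (matrix (dtube x)) = det (matrix (dzero (P x))) *
     (\<Sum>i\<le>m. psi m M (\<Psi> (P x)) (nu (\<Psi> (P x)) (Q x)) i)"
  using det_dtube[of x] assms det_coeffs(1)[of m 1 "sff_matrix m M (\<Psi> (P x)) (nu (\<Psi> (P x)) (Q x))"]
  by (simp add: tube_dom_def psi_eq_det_coeffs)

text \<open>Along t -> P x + t Q x the quotient of the determinants of \<open>dtube\<close> and
  \<open>dzero\<close> is, by homogeneity, a polynomial in t with coefficients \<psi>_i. For each t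
  it is continuous in x, although the bases inside \<open>psi\<close> are chosen point by
  point.\<close>

lemma measurable_psi_dom:
  assumes i: "i \<le> m"
  shows "(\<lambda>x. psi m M (\<Psi> (P x)) (nu (\<Psi> (P x)) (Q x)) i) \<in> borel_measurable (restrict_space borel tube_dom)"
proof (rule measurable_polynomial_coeffs[where c="\<lambda>x. psi m M (\<Psi> (P x)) (nu (\<Psi> (P x)) (Q x))"
      and P="\<lambda>x t. det (matrix (dtube (P x + t *\<^sub>R Q x))) / det (matrix (dzero (P x)))", OF _ _ i])
  fix x t assume "x \<in> space (restrict_space borel tube_dom)"
  then have x: "x \<in> tube_dom" by (simp add: space_restrict_space)
  note q = dom_base[OF x]
  let ?x = "P x + t *\<^sub>R Q x"
  have P': "P ?x = P x" "Q ?x = t *\<^sub>R Q x" by (simp_all add: coord_proj_add coord_proj_scaleR)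
  then have x': "?x \<in> tube_dom" using x by (simp add: tube_dom_def)
  have "psi m M (\<Psi> (P x)) (nu (\<Psi> (P x)) (t *\<^sub>R Q x)) i = t ^ i * psi m M (\<Psi> (P x)) (nu (\<Psi> (P x)) (Q x)) i" for i
    using psi_scale[OF q(1,2) nu_Q_normal[OF q(1,2)]] by (simp add: linear_scale[OF linear_nu])
  then show "det (matrix (dtube ?x)) / det (matrix (dzero (P x))) = (\<Sum>i\<le>m. t ^ i * psi m M (\<Psi> (P x)) (nu (\<Psi> (P x)) (Q x)) i)"
    using det_dtube_dom[OF x'] det_dzero_dom(2)[OF x] by (simp add: P')
next
  fix t
  have "continuous_on tube_dom (\<lambda>x. P x + t *\<^sub>R Q x)" by (intro continuous_intros continuous_on_coord_proj)
  moreover have "(\<lambda>x. P x + t *\<^sub>R Q x) ` tube_dom \<subseteq> tube_dom"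
    by (simp add: image_subset_iff tube_dom_def coord_proj_add coord_proj_scaleR)
  ultimately have "continuous_on tube_dom (\<lambda>x. det (matrix (dtube (P x + t *\<^sub>R Q x))))"
    by (rule continuous_on_compose2[OF continuous_det_dtube])
  then have "continuous_on tube_dom (\<lambda>x. det (matrix (dtube (P x + t *\<^sub>R Q x))) / det (matrix (dzero (P x))))"
    by (intro continuous_on_divide continuous_det_dzero) (auto simp: det_dzero_dom)
  then show "(\<lambda>x. det (matrix (dtube (P x + t *\<^sub>R Q x))) / det (matrix (dzero (P x)))) \<in> borel_measurable (restrict_space borel tube_dom)"
    by (rule borel_measurable_continuous_on_restrict)
qed

lemma measurable_indicator_dom:
  fixes f :: "real^'n \<Rightarrow> real"
  assumes "f \<in> borel_measurable (restrict_space borel tube_dom)"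
  shows "(\<lambda>x. indicator tube_dom x * f x) \<in> borel_measurable borel"
  using assms borel_measurable_restrict_space_iff[of tube_dom borel f] by simp

lemma measurable_base_dom [measurable]: "(\<lambda>x. if x \<in> tube_dom then \<Psi> (P x) else 0) \<in> borel_measurable borel"
  by (rule borel_measurable_continuous_on_if) (auto intro: continuous_P continuous_\<Psi>)

lemma base_vimage_measurable:
  assumes [measurable]: "A \<in> sets borel"
  shows "{y \<in> tube_dom. \<Psi> (P y) \<in> A} \<in> sets borel"
proof -
  have "{y. (if y \<in> tube_dom then \<Psi> (P y) else 0) \<in> A} \<in> sets borel" by measurable
  then have "{y. (if y \<in> tube_dom then \<Psi> (P y) else 0) \<in> A} \<inter> tube_dom \<in> sets borel" by (rule sets.Int) measurable
  also have "{y. (if y \<in> tube_dom then \<Psi> (P y) else 0) \<in> A} \<inter> tube_dom = {y \<in> tube_dom. \<Psi> (P y) \<in> A}" by auto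
  finally show ?thesis .
qed

section \<open>Fubini over base and fibre\<close>

definition "near_tube \<epsilon> = {x \<in> tube_dom. norm (nu (\<Psi> (P x)) (Q x)) \<le> \<epsilon>}"

definition "psi_fun \<epsilon> i x = indicator (near_tube \<epsilon>) x * ennreal \<bar>psi m M (\<Psi> (P x)) (nu (\<Psi> (P x)) (Q x)) i\<bar>"

definition "over A = {y \<in> tube_dom. \<Psi> (P y) \<in> A}"

definition "base_weight A y = indicator (over A) y * ennreal (jac (P y))"

lemma near_tube_measurable [measurable]: "near_tube \<epsilon> \<in> sets borel"
proof -
  have "(\<lambda>x. norm (nu (\<Psi> (P x)) (Q x))) \<in> borel_measurable (restrict_space borel tube_dom)"
    by (intro borel_measurable_continuous_on_restrict continuous_on_norm continuous_nu)
  from measurable_indicator_dom[OF this]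
  have "{x. indicator tube_dom x * norm (nu (\<Psi> (P x)) (Q x)) \<le> \<epsilon>} \<inter> tube_dom \<in> sets borel" by measurable
  moreover have "{x. indicator tube_dom x * norm (nu (\<Psi> (P x)) (Q x)) \<le> \<epsilon>} \<inter> tube_dom = near_tube \<epsilon>"
    by (auto simp: near_tube_def)
  ultimately show ?thesis by simp
qed

lemma over_measurable [measurable]: "A \<in> sets borel \<Longrightarrow> over A \<in> sets borel"
  unfolding over_def by (rule base_vimage_measurable)

lemma measurable_psi_fun:
  assumes "i \<le> m"
  shows "psi_fun \<epsilon> i \<in> borel_measurable borel"
proof -
  note [measurable] = measurable_indicator_dom[OF measurable_psi_dom[OF assms]]
  have "psi_fun \<epsilon> i = (\<lambda>x. indicator (near_tube \<epsilon>) x * ennreal \<bar>indicator tube_dom x * psi m M (\<Psi> (P x)) (nu (\<Psi> (P x)) (Q x)) i\<bar>)"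
    by (auto simp: psi_fun_def near_tube_def indicator_def fun_eq_iff)
  then show ?thesis by simp
qed

lemma coord_proj_split [simp]: "P (P y + Q u) = P y" "Q (P y + Q u) = Q u"
  by (simp_all add: coord_proj_add)

lemma tube_dom_split [simp]: "P y + Q u \<in> tube_dom \<longleftrightarrow> y \<in> tube_dom"
  by (simp add: tube_dom_def)

lemma measurable_continuous_dom:
  fixes f :: "real^'n \<Rightarrow> real"
  shows "continuous_on tube_dom f \<Longrightarrow> (\<lambda>x. indicator tube_dom x * f x) \<in> borel_measurable borel"
  by (intro measurable_indicator_dom borel_measurable_continuous_on_restrict)

text \<open>\<open>jac\<close> times the determinant of \<open>norm_iso\<close> is that of
  \<open>dzero\<close>, up to sign. The resulting form contains only functions whose measurability
  is already known.\<close>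

lemma base_weight_normal_ball_integral:
  assumes i: "i \<le> m"
  shows "base_weight A y * normal_ball_integral m M I \<epsilon> i (\<Psi> (P y))
    = indicator (over A) y * (ennreal \<bar>det (matrix (dzero (P y)))\<bar> * (\<integral>\<^sup>+u. psi_fun \<epsilon> i (P y + Q u) \<partial>coord_measure J))"
proof (cases "y \<in> over A")
  case True
  then have y: "y \<in> tube_dom" by (simp add: over_def)
  note q = dom_base[OF y]
  have "psi_fun \<epsilon> i (P y + Q u) = indicator {z. norm z \<le> \<epsilon>} (nu (\<Psi> (P y)) (Q u)) * ennreal \<bar>psi m M (\<Psi> (P y)) (nu (\<Psi> (P y)) (Q u)) i\<bar>" for u
    using y by (simp add: psi_fun_def near_tube_def indicator_def)
  then show ?thesis
    unfolding normal_ball_integral_nu[OF q(1,2) i] base_weight_def det_dzero_dom(1)[OF y]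
    using det_dzero_dom(3)[OF y] by (simp add: ennreal_mult mult.assoc)
qed (simp add: base_weight_def)

lemma measurable_base_weight_normal_ball_integral:
  assumes i: "i \<le> m" and [measurable]: "A \<in> sets borel"
  shows "(\<lambda>y. base_weight A y * normal_ball_integral m M I \<epsilon> i (\<Psi> (P y))) \<in> borel_measurable borel"
proof -
  note [measurable] = measurable_psi_fun[OF i] measurable_continuous_dom[OF continuous_det_dzero]
  have [measurable]: "(\<lambda>y. \<integral>\<^sup>+u. psi_fun \<epsilon> i (P y + Q u) \<partial>coord_measure J) \<in> borel_measurable borel"
    by (rule borel_measurable_nn_integral_coord) measurable
  have "(\<lambda>y. base_weight A y * normal_ball_integral m M I \<epsilon> i (\<Psi> (P y)))
     = (\<lambda>y. indicator (over A) y * (ennreal \<bar>indicator tube_dom y * det (matrix (dzero (P y)))\<bar> * (\<integral>\<^sup>+u. psi_fun \<epsilon> i (P y + Q u) \<partial>coord_measure J)))"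
    unfolding base_weight_normal_ball_integral[OF i] by (auto simp: fun_eq_iff over_def indicator_def)
  also have "\<dots> \<in> borel_measurable borel" by measurable
  finally show ?thesis .
qed

lemma measurable_base_weight:
  assumes [measurable]: "A \<in> sets borel"
  shows "base_weight A \<in> borel_measurable borel"
proof -
  note [measurable] = measurable_continuous_dom[OF continuous_P[OF continuous_jac]]
  have "base_weight A = (\<lambda>y. indicator (over A) y * ennreal (indicator tube_dom y * jac (P y)))"
    by (auto simp: base_weight_def over_def indicator_def fun_eq_iff)
  then show ?thesis by simp
qed

lemma nn_integral_tube_jacobian:
  assumes [measurable]: "A \<in> sets borel"
  shows "(\<integral>\<^sup>+x. ennreal (indicator (over A \<inter> near_tube \<epsilon>) x * \<bar>det (matrix (dtube x))\<bar>) \<partial>lborel)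
     \<le> (\<Sum>i\<le>m. \<integral>\<^sup>+y. base_weight A y * normal_ball_integral m M I \<epsilon> i (\<Psi> (P y)) \<partial>coord_measure I)"
proof -
  define F where "F x = ennreal (indicator (over A \<inter> near_tube \<epsilon>) x * \<bar>det (matrix (dtube x))\<bar>)" for x
  note [measurable] = measurable_continuous_dom[OF continuous_det_dtube] measurable_psi_fun
    measurable_base_weight_normal_ball_integral
  have "F = (\<lambda>x. ennreal (indicator (over A \<inter> near_tube \<epsilon>) x * \<bar>indicator tube_dom x * det (matrix (dtube x))\<bar>))"
    by (auto simp: F_def over_def indicator_def fun_eq_iff)
  then have F[measurable]: "F \<in> borel_measurable borel" by simp
  have inner: "(\<integral>\<^sup>+u. F (P y + Q u) \<partial>coord_measure J)
      \<le> (\<Sum>i\<le>m. base_weight A y * normal_ball_integral m M I \<epsilon> i (\<Psi> (P y)))" for y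
  proof -
    have "F (P y + Q u) \<le> (\<Sum>i\<le>m. indicator (over A) y * (ennreal \<bar>det (matrix (dzero (P y)))\<bar> * psi_fun \<epsilon> i (P y + Q u)))" for u
    proof (cases "y \<in> over A \<and> P y + Q u \<in> near_tube \<epsilon>")
      case True
      then have y: "y \<in> tube_dom" by (simp add: over_def)
      let ?\<psi> = "\<lambda>i. psi m M (\<Psi> (P y)) (nu (\<Psi> (P y)) (Q u)) i"
      have "\<bar>det (matrix (dtube (P y + Q u)))\<bar> = \<bar>det (matrix (dzero (P y)))\<bar> * \<bar>\<Sum>i\<le>m. ?\<psi> i\<bar>"
        using det_dtube_dom[of "P y + Q u"] y by (simp add: abs_mult)
      also have "\<dots> \<le> \<bar>det (matrix (dzero (P y)))\<bar> * (\<Sum>i\<le>m. \<bar>?\<psi> i\<bar>)"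
        by (intro mult_left_mono sum_abs) simp
      also have "\<dots> = (\<Sum>i\<le>m. \<bar>det (matrix (dzero (P y)))\<bar> * \<bar>?\<psi> i\<bar>)" by (rule sum_distrib_left)
      finally have "ennreal \<bar>det (matrix (dtube (P y + Q u)))\<bar> \<le> ennreal (\<Sum>i\<le>m. \<bar>det (matrix (dzero (P y)))\<bar> * \<bar>?\<psi> i\<bar>)"
        by (rule ennreal_leI)
      also have "\<dots> = (\<Sum>i\<le>m. ennreal \<bar>det (matrix (dzero (P y)))\<bar> * ennreal \<bar>?\<psi> i\<bar>)"
        by (simp add: ennreal_mult flip: sum_ennreal)
      finally show ?thesis
        using True y by (simp add: F_def psi_fun_def over_def indicator_def)
    next
      case False
      then have "P y + Q u \<notin> over A \<inter> near_tube \<epsilon>" by (auto simp: over_def)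
      then show ?thesis by (simp add: F_def)
    qed
    then have "(\<integral>\<^sup>+u. F (P y + Q u) \<partial>coord_measure J)
       \<le> (\<integral>\<^sup>+u. (\<Sum>i\<le>m. indicator (over A) y * (ennreal \<bar>det (matrix (dzero (P y)))\<bar> * psi_fun \<epsilon> i (P y + Q u))) \<partial>coord_measure J)"
      by (intro nn_integral_mono)
    also have "\<dots> = (\<Sum>i\<le>m. \<integral>\<^sup>+u. indicator (over A) y * (ennreal \<bar>det (matrix (dzero (P y)))\<bar> * psi_fun \<epsilon> i (P y + Q u)) \<partial>coord_measure J)"
      by (intro nn_integral_sum) measurable
    also have "\<dots> = (\<Sum>i\<le>m. indicator (over A) y * (ennreal \<bar>det (matrix (dzero (P y)))\<bar> * (\<integral>\<^sup>+u. psi_fun \<epsilon> i (P y + Q u) \<partial>coord_measure J)))"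
      by (intro sum.cong refl) (simp add: nn_integral_cmult)
    also have "\<dots> = (\<Sum>i\<le>m. base_weight A y * normal_ball_integral m M I \<epsilon> i (\<Psi> (P y)))"
      by (intro sum.cong refl) (simp add: base_weight_normal_ball_integral)
    finally show ?thesis .
  qed
  have "(\<integral>\<^sup>+x. F x \<partial>lborel) = (\<integral>\<^sup>+y. \<integral>\<^sup>+u. F (P y + Q u) \<partial>coord_measure J \<partial>coord_measure I)"
    by (rule nn_integral_lborel_coord[OF F])
  also have "\<dots> \<le> (\<integral>\<^sup>+y. (\<Sum>i\<le>m. base_weight A y * normal_ball_integral m M I \<epsilon> i (\<Psi> (P y))) \<partial>coord_measure I)"
    by (intro nn_integral_mono inner)
  also have "\<dots> = (\<Sum>i\<le>m. \<integral>\<^sup>+y. base_weight A y * normal_ball_integral m M I \<epsilon> i (\<Psi> (P y)) \<partial>coord_measure I)"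
    by (intro nn_integral_sum) measurable
  finally show ?thesis by (simp add: F_def)
qed

text \<open>The chart pulls the question back to coordinates: \<open>base_weight\<close> times the
  fibre integral is measurable there, and dividing by the positive \<open>jac\<close> at \<Phi> q
  recovers the fibre integral at q.\<close>

lemma measurable_normal_ball_integral:
  assumes i: "i \<le> m" and A[measurable]: "A \<in> sets borel" and sub: "A \<subseteq> M \<inter> V"
  shows "(\<lambda>q. normal_ball_integral m M I \<epsilon> i q * indicator A q) \<in> borel_measurable borel"
proof -
  define K where "K y = base_weight A y * normal_ball_integral m M I \<epsilon> i (\<Psi> (P y)) * ennreal (1 / (indicator tube_dom y * jac (P y)))" for y
  note [measurable] = measurable_base_weight_normal_ball_integral[OF i A] measurable_continuous_dom[OF continuous_P[OF continuous_jac]]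
  have [measurable]: "K \<in> borel_measurable borel" unfolding K_def by measurable
  have [measurable]: "(\<lambda>q. if q \<in> V then \<Phi> q else 0) \<in> borel_measurable borel"
    by (rule borel_measurable_continuous_on_if) (use V(1) smooth_on_continuous[OF V(2)] in auto)
  have "normal_ball_integral m M I \<epsilon> i q * indicator A q = K (if q \<in> V then \<Phi> q else 0) * indicator A q" for q
  proof (cases "q \<in> A")
    case True
    then have q: "q \<in> M" "q \<in> V" using sub by auto
    have P\<Phi>: "P (\<Phi> q) = \<Phi> q" using \<Phi>_in_space[OF q] by (rule coord_proj_space)
    have dom: "\<Phi> q \<in> tube_dom" using q by (simp add: tube_dom_def P\<Phi>)
    then have "\<Phi> q \<in> over A" using True q by (simp add: over_def P\<Phi> \<Psi>\<Phi>)
    then have "K (\<Phi> q) = ennreal (jac (\<Phi> q)) * normal_ball_integral m M I \<epsilon> i q * ennreal (1 / jac (\<Phi> q))"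
      using dom by (simp add: K_def base_weight_def P\<Phi> \<Psi>\<Phi> q)
    also have "\<dots> = (ennreal (jac (\<Phi> q)) * ennreal (1 / jac (\<Phi> q))) * normal_ball_integral m M I \<epsilon> i q"
      by (simp only: mult_ac)
    also have "\<dots> = normal_ball_integral m M I \<epsilon> i q"
      using jac_pos[OF q] by (simp flip: ennreal_mult)
    finally show ?thesis using q by simp
  qed simp
  then show ?thesis by simp
qed

section \<open>Comparison of the base measure with Hausdorff measure on M\<close>

lemma chart_almost_isometric:
  assumes q0: "q0 \<in> V" and \<eta>: "\<eta> > 0"
  shows "\<exists>r>0. ball q0 r \<subseteq> V \<and> (\<forall>q1\<in>ball q0 r. \<forall>q2\<in>ball q0 r.
     norm (dPsi (\<Phi> q0) (\<Phi> q1 - \<Phi> q2)) \<le> (1 + \<eta>) * dist q1 q2)"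
proof -
  let ?E = "dPsi (\<Phi> q0)"
  have linE: "linear ?E" using q0 by (intro linear_dPsi) simp
  then have blE: "bounded_linear ?E" by (simp add: linear_conv_bounded_linear)
  \<comment> \<open>A continuous bound for the operator norm of h ->
    \<open>?E (dPhi p h) - h\<close>, with value 0 at q0.\<close>
  define s where "s p = (\<Sum>b\<in>UNIV. norm (?E (dPhi p (axis b 1)) - axis b 1))" for p
  have s0: "s q0 = 0" by (simp add: s_def dPsi_dPhi[OF q0])
  have "continuous_on V s"
    unfolding s_def
    by (intro continuous_intros continuous_on_compose2[OF linear_continuous_on[OF blE] continuous_dPhi]) auto
  then have "isCont s q0" using q0 V(1) by (simp add: continuous_on_eq_continuous_at)
  then obtain r1 where r1: "r1 > 0" "\<And>p. dist p q0 < r1 \<Longrightarrow> dist (s p) (s q0) < \<eta>"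
    using \<eta> unfolding continuous_at by (metis continuous_at continuous_at_eps_delta)
  obtain r2 where r2: "r2 > 0" "ball q0 r2 \<subseteq> V" using V(1) q0 by (meson openE)
  define r where "r = min r1 r2"
  have r: "r > 0" "ball q0 r \<subseteq> V" using r1(1) r2 by (auto simp: r_def)
  have s_le: "s p \<le> \<eta>" if "p \<in> ball q0 r" for p
  proof -
    have "dist p q0 < r1" using that by (simp add: r_def dist_commute)
    from r1(2)[OF this] show ?thesis using s0 by (simp add: dist_real_def)
  qed
  \<comment> \<open>The derivative of f is small near q0, so f has Lipschitz constant \<eta> there
    by the mean value inequality, and \<Phi> followed by \<open>?E\<close> is the identity plus
    f.\<close>
  define f where "f p = ?E (\<Phi> p) - p" for p
  have f: "(f has_derivative (\<lambda>h. ?E (dPhi p h) - h)) (at p within ball q0 r)" if "p \<in> ball q0 r" for p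
  proof -
    have "p \<in> V" using r(2) that by blast
    then have "((\<lambda>p. ?E (\<Phi> p)) has_derivative (\<lambda>h. ?E (dPhi p h))) (at p)"
      by (intro bounded_linear.has_derivative[OF blE] dPhi)
    from has_derivative_diff[OF this has_derivative_ident]
    show ?thesis unfolding f_def by (rule has_derivative_at_withinI)
  qed
  have on: "onorm (\<lambda>h. ?E (dPhi p h) - h) \<le> \<eta>" if p: "p \<in> ball q0 r" for p
  proof (rule onorm_le)
    fix h :: "real^'n"
    have linp: "linear (dPhi p)" using p r(2) by (intro linear_dPhi) auto
    have "linear (\<lambda>h. ?E (dPhi p h) - h)"
      by (intro linear_compose_sub linear_compose[OF linp linE, unfolded o_def] linear_id[unfolded id_def])
    from linear_vec_expand[OF this, of h]
    have "norm (?E (dPhi p h) - h) = norm (\<Sum>b\<in>UNIV. h $ b *\<^sub>R (?E (dPhi p (axis b 1)) - axis b 1))" by simp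
    also have "\<dots> \<le> (\<Sum>b\<in>UNIV. norm (h $ b *\<^sub>R (?E (dPhi p (axis b 1)) - axis b 1)))" by (rule norm_sum)
    also have "\<dots> \<le> (\<Sum>b\<in>UNIV. norm h * norm (?E (dPhi p (axis b 1)) - axis b 1))"
      using component_le_norm_cart[of h] by (intro sum_mono) (auto intro: mult_right_mono)
    also have "\<dots> = s p * norm h" by (simp add: s_def sum_distrib_left mult.commute)
    also have "\<dots> \<le> \<eta> * norm h" using s_le[OF p] by (rule mult_right_mono) simp
    finally show "norm (?E (dPhi p h) - h) \<le> \<eta> * norm h" .
  qed
  have "norm (?E (\<Phi> q1 - \<Phi> q2)) \<le> (1 + \<eta>) * dist q1 q2" if q: "q1 \<in> ball q0 r" "q2 \<in> ball q0 r" for q1 q2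
  proof -
    have "norm (f q1 - f q2) \<le> \<eta> * norm (q1 - q2)"
      by (rule differentiable_bound[OF convex_ball f on q])
    moreover have eq: "?E (\<Phi> q1 - \<Phi> q2) = (f q1 - f q2) + (q1 - q2)"
      by (simp add: f_def linear_diff[OF linE])
    have "norm (?E (\<Phi> q1 - \<Phi> q2)) \<le> norm (f q1 - f q2) + norm (q1 - q2)"
      unfolding eq by (rule norm_triangle_ineq)
    ultimately show ?thesis by (simp add: dist_norm distrib_right)
  qed
  then show ?thesis using r by blast
qed

text \<open>D is \<open>tang_iso q\<close> followed by the inverse frame: the linearised
  parametrisation turned back into the coordinate subspace of I, where
  \<open>nn_integral_coord_linear\<close> and the isodiametric inequality apply.\<close>

lemma tangent_iso_split:
  assumes q: "q \<in> M" "q \<in> V"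
  obtains D where "linear D" "inj D" "\<bar>det (matrix D)\<bar> = jac (\<Phi> q)"
    "\<And>x. P (D (P x)) = D (P x)" "\<And>x. D (Q x) = Q x" "\<And>x. norm (D (P x)) = norm (dPsi (\<Phi> q) (P x))"
proof -
  obtain R' where R': "orthogonal_transformation R'" "linear R'" "\<And>x. R' (frame q x) = x" "\<And>x. frame q (R' x) = x"
     "\<And>x. norm (R' x) = norm x"
    using frame_inverse[OF q] by metis
  define D where "D h = R' (tang_iso q h)" for h
  have linD: "linear D" using linear_compose[OF linear_tang_iso[OF q] R'(2)] by (simp add: D_def[abs_def] o_def)
  have detD: "\<bar>det (matrix D)\<bar> = jac (\<Phi> q)"
    using det_matrix_comp[OF R'(2) linear_tang_iso[OF q]] det_orthogonal_transformation[OF R'(1)]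
    by (simp add: D_def[abs_def] abs_mult jac_eq[OF q])
  have "det (matrix D) \<noteq> 0" using detD jac_pos[OF q] by auto
  then have injD: "inj D" using det_nz_iff_inj[OF linD] by simp
  have DP: "D (P x) = R' (dPsi (\<Phi> q) (P x))" for x
    by (simp add: D_def tang_iso_def linear_0[OF linear_frame[OF q]])
  have 1: "P (D (P x)) = D (P x)" for x
  proof -
    have "dPsi (\<Phi> q) (P x) \<in> frame q ` coord_space I"
      unfolding frame_tangent[OF q] tangent_space_image[OF q] by simp
    then obtain b where "b \<in> coord_space I" "dPsi (\<Phi> q) (P x) = frame q b" by blast
    then show ?thesis by (simp add: DP R'(3) coord_proj_space)
  qed
  have 2: "D (Q x) = Q x" for x
    using q by (simp add: D_def tang_iso_def R'(3) linear_0[OF linear_dPsi])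
  show ?thesis by (rule that[OF linD injD detD 1 2]) (simp add: DP R'(5))
qed

text \<open>Near q0 the density \<open>jac\<close> is at most 1 + \<eta> times its value there, and
  p -> D (\<Phi> p) stretches distances by at most 1 + \<eta>. The value of \<open>jac\<close> at q0
  is absorbed by the change of variables with D, and the isodiametric inequality is applied to the
  image of C under this map.\<close>

lemma base_measure_local:
  assumes q0: "q0 \<in> A" and A: "A \<in> sets borel" and sub: "A \<subseteq> M \<inter> V" and e: "e > 1"
  shows "\<exists>r>0. \<forall>C. C \<in> sets borel \<longrightarrow> C \<noteq> {} \<longrightarrow> C \<subseteq> A \<inter> ball q0 r \<longrightarrow>
    (\<integral>\<^sup>+y. base_weight C y \<partial>coord_measure I) \<le> ennreal (e * (unit_ball_vol m * (diameter C / 2) ^ m))"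
proof -
  have q: "q0 \<in> M" "q0 \<in> V" using q0 sub by auto
  \<comment> \<open>One factor 1 + \<eta> is for the density and m factors for the m-th power of the
    diameter.\<close>
  have "((\<lambda>\<eta>::real. (1 + \<eta>) ^ Suc m) \<longlongrightarrow> (1 + 0) ^ Suc m) (at_right 0)" by (intro tendsto_intros)
  then have "eventually (\<lambda>\<eta>::real. (1 + \<eta>) ^ Suc m < e) (at_right 0)" using e by (intro order_tendstoD) auto
  moreover have "eventually (\<lambda>\<eta>::real. \<eta> > 0) (at_right 0)" by (rule eventually_at_right_less)
  ultimately have "eventually (\<lambda>\<eta>::real. (1 + \<eta>) ^ Suc m < e \<and> \<eta> > 0) (at_right 0)" by (rule eventually_conj)
  then obtain \<eta> :: real where \<eta>: "(1 + \<eta>) ^ Suc m < e" "\<eta> > 0"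
    using eventually_happens'[OF trivial_limit_at_right_real] by blast
  obtain r1 where r1: "r1 > 0" "ball q0 r1 \<subseteq> V"
    "\<And>q1 q2. q1 \<in> ball q0 r1 \<Longrightarrow> q2 \<in> ball q0 r1 \<Longrightarrow> norm (dPsi (\<Phi> q0) (\<Phi> q1 - \<Phi> q2)) \<le> (1 + \<eta>) * dist q1 q2"
    using chart_almost_isometric[OF q(2) \<eta>(2)] by blast
  define j0 where "j0 = jac (\<Phi> q0)"
  have j0: "j0 > 0" using jac_pos[OF q] by (simp add: j0_def)
  have "continuous_on V (\<lambda>p. jac (\<Phi> p))"
    by (rule continuous_on_compose2[OF continuous_jac smooth_on_continuous[OF V(2)]]) auto
  then have "isCont (\<lambda>p. jac (\<Phi> p)) q0" using q(2) V(1) by (simp add: continuous_on_eq_continuous_at)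
  then obtain r2 where r2: "r2 > 0" "\<And>p. dist p q0 < r2 \<Longrightarrow> dist (jac (\<Phi> p)) j0 < \<eta> * j0"
    using \<eta>(2) j0 unfolding j0_def by (metis continuous_at_eps_delta mult_pos_pos)
  define r where "r = min r1 r2"
  have r: "r > 0" using r1(1) r2(1) by (simp add: r_def)
  obtain D where D: "linear D" "inj D" "\<bar>det (matrix D)\<bar> = j0"
    "\<And>x. P (D (P x)) = D (P x)" "\<And>x. D (Q x) = Q x" "\<And>x. norm (D (P x)) = norm (dPsi (\<Phi> q0) (P x))"
    unfolding j0_def using tangent_iso_split[OF q] by metis
  obtain D' where D': "linear D'" "\<And>x. D' (D x) = x" "\<And>x. D (D' x) = x"
    using linear_injective_isomorphism[OF D(1,2)] by blast
  note [measurable] = measurable_linear_borel[OF D'(1)]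
  have "(\<integral>\<^sup>+y. base_weight C y \<partial>coord_measure I) \<le> ennreal (e * (unit_ball_vol m * (diameter C / 2) ^ m))"
    if C[measurable]: "C \<in> sets borel" and ne: "C \<noteq> {}" and CA: "C \<subseteq> A \<inter> ball q0 r" for C
  proof -
    have bd: "bounded C" using CA by (meson bounded_ball bounded_subset inf.boundedE)
    define S where "S = D' -` over C"
    have S[measurable]: "S \<in> sets borel"
      unfolding S_def using measurable_sets_borel[of D' borel "over C"] by simp
    have in_C: "\<Psi> (P y) \<in> C" "y \<in> tube_dom" if "y \<in> over C" for y using that by (auto simp: over_def)
    have S_D: "indicator S (D (P y)) = (indicator (over C) y :: ennreal)" for y
      by (simp add: S_def indicator_def D'(2) over_def tube_dom_def)
    have "(\<integral>\<^sup>+y. base_weight C y \<partial>coord_measure I) \<le> (\<integral>\<^sup>+y. ennreal (1 + \<eta>) * (ennreal j0 * indicator S (D (P y))) \<partial>coord_measure I)"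
    proof (rule nn_integral_mono)
      fix y
      show "base_weight C y \<le> ennreal (1 + \<eta>) * (ennreal j0 * indicator S (D (P y)))"
      proof (cases "y \<in> over C")
        case True
        have "dist (\<Psi> (P y)) q0 < r2" using in_C(1)[OF True] CA by (auto simp: r_def dist_commute)
        from r2(2)[OF this] have "jac (P y) \<le> (1 + \<eta>) * j0"
          using dom_base(3)[OF in_C(2)[OF True]] by (simp add: dist_real_def algebra_simps)
        then have "ennreal (jac (P y)) \<le> ennreal ((1 + \<eta>) * j0)" by (rule ennreal_leI)
        then show ?thesis using True \<eta>(2) j0 S_D[of y] by (simp add: base_weight_def ennreal_mult)
      qed (simp add: base_weight_def)
    qed
    also have "\<dots> = ennreal (1 + \<eta>) * (ennreal \<bar>det (matrix D)\<bar> * (\<integral>\<^sup>+y. indicator S (D (P y)) \<partial>coord_measure I))"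
      unfolding D(3) S_D by (simp add: nn_integral_cmult)
    also have "ennreal \<bar>det (matrix D)\<bar> * (\<integral>\<^sup>+y. indicator S (D (P y)) \<partial>coord_measure I) = (\<integral>\<^sup>+y. indicator S y \<partial>coord_measure I)"
      by (rule nn_integral_coord_linear[OF D(1) _ D(4,5), symmetric]) (use D(3) j0 in auto)
    also have "\<dots> = emeasure (coord_measure I) S" by simp
    also have "\<dots> \<le> ennreal (unit_ball_vol (card I) * (((1 + \<eta>) * diameter C) / 2) ^ card I)"
    proof (rule isodiametric_coord[OF S])
      show "0 \<le> (1 + \<eta>) * diameter C" using \<eta>(2) diameter_ge_0[OF bd] by simp
      fix z1 z2 assume z: "z1 \<in> S" "z2 \<in> S"
      have PD: "P z = D (P (D' z))" for z
      proof -
        have "z = D (P (D' z) + Q (D' z))" by (simp add: coord_proj_Compl_add D'(3))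
        also have "\<dots> = D (P (D' z)) + Q (D' z)" by (simp add: linear_add[OF D(1)] D(5))
        finally have "P z = P (D (P (D' z)) + Q (D' z))" by simp
        then show ?thesis by (simp add: coord_proj_add D(4))
      qed
      define q1 q2 where "q1 = \<Psi> (P (D' z1))" and "q2 = \<Psi> (P (D' z2))"
      have o: "D' z1 \<in> over C" "D' z2 \<in> over C" using z by (auto simp: S_def)
      have qC: "q1 \<in> C" "q2 \<in> C" using in_C(1) o by (auto simp: q1_def q2_def)
      have \<Phi>q: "\<Phi> q1 = P (D' z1)" "\<Phi> q2 = P (D' z2)" using dom_base(3)[OF in_C(2)] o by (auto simp: q1_def q2_def)
      have "P z1 - P z2 = D (P (D' z1 - D' z2))"
        unfolding PD[of z1] PD[of z2] by (simp add: linear_diff[OF D(1)] coord_proj_diff)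
      then have "dist (P z1) (P z2) = norm (dPsi (\<Phi> q0) (\<Phi> q1 - \<Phi> q2))"
        by (simp only: dist_norm D(6)) (simp only: \<Phi>q coord_proj_diff)
      also have "\<dots> \<le> (1 + \<eta>) * dist q1 q2" using qC CA by (intro r1(3)) (auto simp: r_def)
      also have "\<dots> \<le> (1 + \<eta>) * diameter C"
        using qC \<eta>(2) by (intro mult_left_mono diameter_bounded_bound bd) auto
      finally show "dist (P z1) (P z2) \<le> (1 + \<eta>) * diameter C" .
    qed
    finally have "(\<integral>\<^sup>+y. base_weight C y \<partial>coord_measure I)
        \<le> ennreal (1 + \<eta>) * ennreal (unit_ball_vol m * (((1 + \<eta>) * diameter C) / 2) ^ m)"
      by (simp add: card_I mult_left_mono)
    also have "\<dots> = ennreal ((1 + \<eta>) ^ Suc m * (unit_ball_vol m * (diameter C / 2) ^ m))"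
      using \<eta>(2) by (subst ennreal_mult'[symmetric]) (simp_all add: power_mult_distrib power_divide mult_ac)
    also have "\<dots> \<le> ennreal (e * (unit_ball_vol m * (diameter C / 2) ^ m))"
      using \<eta>(1) diameter_ge_0[OF bd] by (intro ennreal_leI mult_right_mono) auto
    finally show ?thesis .
  qed
  then show ?thesis using r by blast
qed

text \<open>The image \<nu> of the density \<open>base_weight A\<close> under \<Psi> is bounded by
  Hausdorff measure set by set, using \<open>base_measure_local\<close>; the inequality of measures
  then passes to integrals.\<close>

lemma nn_integral_base_le:
  assumes A[measurable]: "A \<in> sets borel" and sub: "A \<subseteq> M \<inter> V"
    and h[measurable]: "(\<lambda>q. h q * indicator A q) \<in> borel_measurable borel"
  shows "(\<integral>\<^sup>+y. base_weight A y * h (\<Psi> (P y)) \<partial>coord_measure I) \<le> (\<integral>\<^sup>+q. h q * indicator A q \<partial>hausdorff_measure m)"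
proof -
  let ?H = "hausdorff_measure m :: (real^'n) measure"
  \<comment> \<open>Off \<open>tube_dom\<close> the density \<open>base_weight A\<close> is 0, so
    the default value of the map there never enters an integral.\<close>
  let ?T = "\<lambda>y. if y \<in> tube_dom then \<Psi> (P y) else 0"
  note [measurable] = measurable_base_weight
  define \<nu> where "\<nu> = distr (density (coord_measure I) (base_weight A)) borel ?T"
  have sets\<nu>: "sets \<nu> = sets borel" by (simp add: \<nu>_def)
  have int\<nu>: "(\<integral>\<^sup>+q. g q \<partial>\<nu>) = (\<integral>\<^sup>+y. base_weight A y * g (\<Psi> (P y)) \<partial>coord_measure I)"
    if [measurable]: "g \<in> borel_measurable borel" for g
  proof -
    have "(\<integral>\<^sup>+q. g q \<partial>\<nu>) = (\<integral>\<^sup>+y. base_weight A y * g (?T y) \<partial>coord_measure I)"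
      unfolding \<nu>_def by (subst nn_integral_distr) (simp_all add: nn_integral_density)
    also have "\<dots> = (\<integral>\<^sup>+y. base_weight A y * g (\<Psi> (P y)) \<partial>coord_measure I)"
      by (intro nn_integral_cong) (simp add: base_weight_def over_def)
    finally show ?thesis .
  qed
  have em\<nu>: "emeasure \<nu> C = (\<integral>\<^sup>+y. base_weight (C \<inter> A) y \<partial>coord_measure I)" if "C \<in> sets borel" for C
  proof -
    have "emeasure \<nu> C = (\<integral>\<^sup>+y. base_weight A y * indicator C (\<Psi> (P y)) \<partial>coord_measure I)"
      using int\<nu>[of "indicator C"] that by (simp add: sets\<nu>)
    also have "\<dots> = (\<integral>\<^sup>+y. base_weight (C \<inter> A) y \<partial>coord_measure I)"
      by (intro nn_integral_cong) (auto simp: base_weight_def over_def indicator_def)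
    finally show ?thesis .
  qed
  have le: "emeasure \<nu> C \<le> emeasure ?H C" if C[measurable]: "C \<in> sets borel" for C
  proof -
    have "emeasure \<nu> C = emeasure \<nu> (C \<inter> A)" by (simp add: em\<nu> Int_assoc)
    also have "\<dots> \<le> emeasure ?H (C \<inter> A)"
    proof (rule emeasure_le_hausdorff_measure[OF sets\<nu>])
      fix x e assume x: "x \<in> C \<inter> A" and e: "(e::real) > 1"
      obtain r where r: "r > 0" "\<And>B. B \<in> sets borel \<Longrightarrow> B \<noteq> {} \<Longrightarrow> B \<subseteq> A \<inter> ball x r \<Longrightarrow>
         (\<integral>\<^sup>+y. base_weight B y \<partial>coord_measure I) \<le> ennreal (e * (unit_ball_vol m * (diameter B / 2) ^ m))"
        using base_measure_local[OF _ A sub e, of x] x by blast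
      have "emeasure \<nu> B \<le> ennreal (e * (unit_ball_vol m * (diameter B / 2) ^ m))"
        if B: "B \<in> sets borel" "B \<noteq> {}" "B \<subseteq> C \<inter> A \<inter> ball x r" for B
      proof -
        have "B \<inter> A = B" using B(3) by auto
        then show ?thesis using r(2)[OF B(1,2)] B by (simp add: em\<nu>)
      qed
      then show "\<exists>r>0. \<forall>B. B \<in> sets borel \<longrightarrow> B \<noteq> {} \<longrightarrow> B \<subseteq> C \<inter> A \<inter> ball x r \<longrightarrow>
          emeasure \<nu> B \<le> ennreal (e * (unit_ball_vol m * (diameter B / 2) ^ m))"
        using r(1) by blast
    qed measurable
    also have "\<dots> \<le> emeasure ?H C" by (rule emeasure_mono) auto
    finally show ?thesis .
  qed
  have "\<nu> \<le> ?H"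
    using le by (subst le_measure) (auto simp: le_fun_def sets\<nu>)
  then have "(\<integral>\<^sup>+q. h q * indicator A q \<partial>\<nu>) \<le> (\<integral>\<^sup>+q. h q * indicator A q \<partial>?H)"
    by (intro nn_integral_mono_measure) (simp_all add: sets\<nu>)
  moreover have "(\<integral>\<^sup>+q. h q * indicator A q \<partial>\<nu>) = (\<integral>\<^sup>+y. base_weight A y * h (\<Psi> (P y)) \<partial>coord_measure I)"
    unfolding int\<nu>[OF h] by (intro nn_integral_cong) (simp add: base_weight_def over_def indicator_def)
  ultimately show ?thesis by simp
qed

theorem local_tube_bound:
  assumes A[measurable]: "A \<in> sets borel" and sub: "A \<subseteq> M \<inter> V"
  shows "\<exists>N\<in>sets borel. tube m M A \<epsilon> \<subseteq> N \<and>
    emeasure lborel N \<le> (\<Sum>i\<le>m. \<integral>\<^sup>+q. normal_ball_integral m M I \<epsilon> i q * indicator A q \<partial>hausdorff_measure m)"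
proof -
  let ?S = "over A \<inter> near_tube \<epsilon>"
  have tube: "tube m M A \<epsilon> \<subseteq> tube_map ` ?S"
  proof
    fix x assume "x \<in> tube m M A \<epsilon>"
    then obtain q v t where qv: "q \<in> A" "v \<in> normal_space m M q" "norm v = 1" "0 \<le> t" "t \<le> \<epsilon>" "x = q + t *\<^sub>R v"
      by (auto simp: tube_def unit_normal_sphere_def)
    have q: "q \<in> M" "q \<in> V" using qv(1) sub by auto
    \<comment> \<open>The fibre coordinate of the tube point: \<open>nu q u\<close> is the
      displacement t v.\<close>
    define u where "u = mu q (t *\<^sub>R v)"
    have "t *\<^sub>R v \<in> normal_space m M q" using qv(2) by (simp add: normal_space_def)
    then have u: "u \<in> coord_space J" unfolding u_def by (rule mu_coord_space[OF q])
    have nu: "nu q u = t *\<^sub>R v" by (simp add: u_def nu_mu q)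
    have P\<Phi>: "P (\<Phi> q) = \<Phi> q" using \<Phi>_in_space[OF q] by (rule coord_proj_space)
    have Qu: "Q u = u" using u by (rule coord_proj_space)
    define z where "z = P (\<Phi> q) + Q u"
    have Pz: "P z = \<Phi> q" "Q z = u" unfolding z_def coord_proj_split by (simp_all add: P\<Phi> Qu)
    have "z \<in> ?S"
      using q qv by (simp add: over_def near_tube_def tube_dom_def Pz \<Psi>\<Phi> nu)
    moreover have "tube_map z = x" by (simp add: tube_map_def Pz \<Psi>\<Phi> q nu qv(6))
    ultimately show "x \<in> tube_map ` ?S" by blast
  qed
  have S[measurable]: "?S \<in> sets borel" by measurable
  have "\<exists>N\<in>sets borel. tube_map ` ?S \<subseteq> N \<and>
     emeasure lborel N \<le> (\<integral>\<^sup>+x. ennreal (indicator ?S x * \<bar>det (matrix (dtube x))\<bar>) \<partial>lborel)"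
  proof (rule differentiable_image_cover[OF S])
    show "(tube_map has_derivative dtube x) (at x within ?S)" if "x \<in> ?S" for x
      by (rule has_derivative_at_withinI, rule tube_map_derivative) (use that in \<open>simp add: over_def tube_dom_def\<close>)
    note [measurable] = measurable_continuous_dom[OF continuous_det_dtube]
    have "(\<lambda>x. indicator ?S x * \<bar>det (matrix (dtube x))\<bar>) = (\<lambda>x. indicator ?S x * \<bar>indicator tube_dom x * det (matrix (dtube x))\<bar>)"
      by (auto simp: over_def indicator_def fun_eq_iff)
    then show "(\<lambda>x. indicator ?S x * \<bar>det (matrix (dtube x))\<bar>) \<in> borel_measurable borel" by simp
  qed
  then obtain N where N: "N \<in> sets borel" "tube_map ` ?S \<subseteq> N"
     "emeasure lborel N \<le> (\<integral>\<^sup>+x. ennreal (indicator ?S x * \<bar>det (matrix (dtube x))\<bar>) \<partial>lborel)" by blast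
  have "emeasure lborel N \<le> (\<Sum>i\<le>m. \<integral>\<^sup>+y. base_weight A y * normal_ball_integral m M I \<epsilon> i (\<Psi> (P y)) \<partial>coord_measure I)"
    using N(3) nn_integral_tube_jacobian[OF A] by (rule order_trans)
  also have "\<dots> \<le> (\<Sum>i\<le>m. \<integral>\<^sup>+q. normal_ball_integral m M I \<epsilon> i q * indicator A q \<partial>hausdorff_measure m)"
    by (intro sum_mono nn_integral_base_le A sub measurable_normal_ball_integral) auto
  finally have "emeasure lborel N
      \<le> (\<Sum>i\<le>m. \<integral>\<^sup>+q. normal_ball_integral m M I \<epsilon> i q * indicator A q \<partial>hausdorff_measure m)" .
  moreover have "tube m M A \<epsilon> \<subseteq> N" using tube N(2) by (rule order_trans)
  ultimately show ?thesis by (intro bexI[OF _ N(1)] conjI)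
qed

end

section \<open>The tube bound\<close>

theorem theorem3p1:
  fixes M U :: "(real^'n) set" and m :: nat and \<epsilon> :: real
  assumes "submanifold m M"
    and "oriented m M"
    and "compact M"
    and "m < CARD('n)"
    and "openin (top_of_set M) U"
    and "U \<subseteq> sm_interior m M"
    and "\<epsilon> > 0"
  shows "emeasure lebesgue (tube m M U \<epsilon>)
           \<le> (\<Sum>i\<le>m. ennreal (\<epsilon> ^ (CARD('n) - m) * (1 / real (CARD('n) - m + i)) * \<epsilon> ^ i)
                       * abs_curv m M i U)"
proof (cases "U = {}")
  case True
  then show ?thesis by (simp add: tube_def)
next
  case False
  let ?H = "hausdorff_measure m :: (real^'n) measure"
  obtain I :: "'n set" where I: "card I = m"
    using obtain_subset_with_card_n[of m "UNIV :: 'n set"] assms(4) by auto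
  have UM: "U \<subseteq> M" using assms(5) by (rule openin_imp_subset)
  have U[measurable]: "U \<in> sets borel"
  proof -
    obtain T where "open T" "U = M \<inter> T" using assms(5) by (auto simp: openin_open)
    then show ?thesis using compact_imp_closed[OF assms(3)] by simp
  qed
  have "\<exists>V \<Phi>. p \<in> V \<and> flat_chart m M V \<Phi> I" if p: "p \<in> U" for p
  proof -
    obtain V \<Phi> L where "sm_chart m M p V \<Phi> L 0" using assms(6) p by (auto simp: sm_interior_def)
    then obtain \<Phi>' where ch: "sm_chart m M p V \<Phi>' (coord_space I) 0" using straighten_chart[OF _ I] by blast
    then have "p \<in> V" by (rule sm_chartD(2))
    moreover have "flat_chart m M V \<Phi>' I"
      by unfold_locales (use sm_chart_change_point[OF ch] \<open>p \<in> V\<close> I in auto)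
    ultimately show ?thesis by blast
  qed
  then obtain V \<Phi> where V: "\<And>p. p \<in> U \<Longrightarrow> p \<in> V p" "\<And>p. p \<in> U \<Longrightarrow> flat_chart m M (V p) (\<Phi> p) I"
    by metis
  have openV: "open (V p)" if "p \<in> U" for p using flat_chart.V(1)[OF V(2)[OF that]] .
  obtain \<F> where \<F>: "\<F> \<subseteq> V ` U" "countable \<F>" "\<Union>\<F> = \<Union>(V ` U)"
    by (rule Lindelof[of "V ` U"]) (use openV in auto)
  have ne: "\<F> \<noteq> {}" using \<F>(3) False V(1) by auto
  define B where "B = from_nat_into \<F>"
  have B: "B n \<in> \<F>" for n unfolding B_def by (rule from_nat_into[OF ne])
  have rB: "range B = \<F>" unfolding B_def by (rule range_from_nat_into[OF ne \<F>(2)])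
  \<comment> \<open>Disjoint pieces, each inside one chart, keep the base integrals additive; the
    tubes over them may overlap.\<close>
  define A where "A n = U \<inter> disjointed B n" for n
  have openB: "open (B n)" for n using B[of n] \<F>(1) openV by auto
  have A[measurable]: "A n \<in> sets borel" for n
    unfolding A_def using openB by (auto simp: disjointed_def intro!: sets.Int sets.Diff sets.finite_UN)
  have disj: "disjoint_family A"
    using disjoint_family_disjointed[of B] by (auto simp: A_def disjoint_family_on_def)
  have UN: "(\<Union>n. A n) = U"
    using \<F>(3) rB V(1) by (auto simp: A_def UN_disjointed_eq simp flip: Int_UN_distrib)
  have loc: "\<exists>V \<Phi>. flat_chart m M V \<Phi> I \<and> A n \<subseteq> M \<inter> V" for n
  proof -
    obtain p where "p \<in> U" "B n = V p" using B[of n] \<F>(1) by auto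
    then show ?thesis using V(2)[of p] disjointed_subset[of B n] UM by (auto simp: A_def)
  qed
  define k where "k i q = normal_ball_integral m M I \<epsilon> i q" for i q
  have k_meas: "(\<lambda>q. k i q * indicator (A n) q) \<in> borel_measurable borel" if "i \<le> m" for i n
    using loc[of n] flat_chart.measurable_normal_ball_integral[OF _ that A] by (auto simp: k_def)
  have k_sum: "(\<Sum>n. k i q * indicator (A n) q) = k i q * indicator U q" for i q
    unfolding UN[symmetric] ennreal_suminf_cmult by (simp add: suminf_indicator disj)
  have kU_meas: "(\<lambda>q. k i q * indicator U q) \<in> borel_measurable borel" if "i \<le> m" for i
    unfolding k_sum[symmetric] by (rule borel_measurable_suminf_order) (rule k_meas[OF that])
  have "\<forall>n. \<exists>N. N \<in> sets borel \<and> tube m M (A n) \<epsilon> \<subseteq> N \<and>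
      emeasure lborel N \<le> (\<Sum>i\<le>m. \<integral>\<^sup>+q. k i q * indicator (A n) q \<partial>?H)"
  proof
    fix n
    obtain V \<Phi> where fc: "flat_chart m M V \<Phi> I" and sub: "A n \<subseteq> M \<inter> V" using loc by blast
    show "\<exists>N. N \<in> sets borel \<and> tube m M (A n) \<epsilon> \<subseteq> N \<and>
        emeasure lborel N \<le> (\<Sum>i\<le>m. \<integral>\<^sup>+q. k i q * indicator (A n) q \<partial>?H)"
      using flat_chart.local_tube_bound[OF fc A sub, of \<epsilon>] unfolding k_def Bex_def .
  qed
  from choice[OF this] obtain N where "\<forall>n. N n \<in> sets borel \<and> tube m M (A n) \<epsilon> \<subseteq> N n \<and>
      emeasure lborel (N n) \<le> (\<Sum>i\<le>m. \<integral>\<^sup>+q. k i q * indicator (A n) q \<partial>?H)" ..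
  then have N: "\<And>n. N n \<in> sets borel" "\<And>n. tube m M (A n) \<epsilon> \<subseteq> N n"
      "\<And>n. emeasure lborel (N n) \<le> (\<Sum>i\<le>m. \<integral>\<^sup>+q. k i q * indicator (A n) q \<partial>?H)"
    by simp_all
  have tube: "tube m M U \<epsilon> \<subseteq> (\<Union>n. N n)"
  proof -
    have "tube m M U \<epsilon> \<subseteq> (\<Union>n. tube m M (A n) \<epsilon>)" unfolding UN[symmetric] tube_def by blast
    then show ?thesis using N(2) by blast
  qed
  have k_le: "(\<integral>\<^sup>+q. k i q * indicator U q \<partial>?H)
      \<le> ennreal (\<epsilon> ^ (CARD('n) - m) * (1 / real (CARD('n) - m + i)) * \<epsilon> ^ i) * abs_curv m M i U"
    if i: "i \<le> m" for i
  proof -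
    define c where "c = \<epsilon> ^ (CARD('n) - m + i) / real (CARD('n) - m + i)"
    have c: "c > 0" using assms(4,7) by (simp add: c_def)
    have cc: "ennreal c * ennreal (1 / c) = 1" using c by (simp flip: ennreal_mult)
    let ?\<kappa> = "\<lambda>q. \<integral>\<^sup>+v\<in>unit_normal_sphere m M q. ennreal \<bar>psi m M q v i\<bar> \<partial>hausdorff_measure (CARD('n) - m - 1)"
    \<comment> \<open>The factor 1/c is put on the side of k, which is measurable and allows it to
      be pulled out; \<open>?\<kappa>\<close> is only compared pointwise, as its measurability in q
      is not established.\<close>
    have "ennreal (1 / c) * (k i q * indicator U q) \<le> ?\<kappa> q * indicator U q" for q
    proof (cases "q \<in> U")
      case True
      then have "q \<in> M" using UM by blast
      then have "k i q \<le> ennreal c * ?\<kappa> q"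
        using flat_chart.normal_ball_integral_le[OF V(2)[OF True] _ V(1)[OF True] i assms(4,7)]
        by (simp add: k_def c_def)
      then have "ennreal (1 / c) * k i q \<le> ennreal (1 / c) * (ennreal c * ?\<kappa> q)" by (rule mult_left_mono) simp
      also have "\<dots> = ?\<kappa> q" using cc by (simp add: mult.assoc[symmetric] mult.commute)
      finally show ?thesis using True by simp
    qed simp
    then have "(\<integral>\<^sup>+q. ennreal (1 / c) * (k i q * indicator U q) \<partial>?H) \<le> abs_curv m M i U"
      unfolding abs_curv_def by (intro nn_integral_mono)
    moreover have "(\<integral>\<^sup>+q. ennreal (1 / c) * (k i q * indicator U q) \<partial>?H) = ennreal (1 / c) * (\<integral>\<^sup>+q. k i q * indicator U q \<partial>?H)"
      using kU_meas[OF i] by (intro nn_integral_cmult) (simp cong: measurable_cong_sets)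
    ultimately have "ennreal c * (ennreal (1 / c) * (\<integral>\<^sup>+q. k i q * indicator U q \<partial>?H)) \<le> ennreal c * abs_curv m M i U"
      by (intro mult_left_mono) simp_all
    then have "(\<integral>\<^sup>+q. k i q * indicator U q \<partial>?H) \<le> ennreal c * abs_curv m M i U"
      using cc by (simp add: mult.assoc[symmetric])
    moreover have "c = \<epsilon> ^ (CARD('n) - m) * (1 / real (CARD('n) - m + i)) * \<epsilon> ^ i"
      by (simp add: c_def power_add)
    ultimately show ?thesis by simp
  qed
  \<comment> \<open>Monotonicity asks for measurability of the larger set only, so it applies to the
    tube as it is.\<close>
  have "emeasure lebesgue (tube m M U \<epsilon>) \<le> emeasure lebesgue (\<Union>n. N n)"
    using tube by (rule emeasure_mono) (use N(1) in auto)
  also have "\<dots> = emeasure lborel (\<Union>n. N n)"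
  proof -
    have "(\<Union>n. N n) \<in> sets lborel" using N(1) by auto
    then show ?thesis by simp
  qed
  also have "\<dots> \<le> (\<Sum>n. emeasure lborel (N n))"
    by (rule emeasure_subadditive_countably) (use N(1) in auto)
  also have "\<dots> \<le> (\<Sum>n. \<Sum>i\<le>m. \<integral>\<^sup>+q. k i q * indicator (A n) q \<partial>?H)"
    by (intro suminf_le N(3)) auto
  also have "\<dots> = (\<Sum>i\<le>m. \<Sum>n. \<integral>\<^sup>+q. k i q * indicator (A n) q \<partial>?H)"
    by (rule suminf_sum) simp
  also have "\<dots> = (\<Sum>i\<le>m. \<integral>\<^sup>+q. k i q * indicator U q \<partial>?H)"
  proof (intro sum.cong refl)
    fix i assume "i \<in> {..m}"
    then have "(\<Sum>n. \<integral>\<^sup>+q. k i q * indicator (A n) q \<partial>?H) = (\<integral>\<^sup>+q. (\<Sum>n. k i q * indicator (A n) q) \<partial>?H)"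
      using k_meas by (intro nn_integral_suminf[symmetric]) (simp cong: measurable_cong_sets)
    then show "(\<Sum>n. \<integral>\<^sup>+q. k i q * indicator (A n) q \<partial>?H) = (\<integral>\<^sup>+q. k i q * indicator U q \<partial>?H)"
      unfolding k_sum .
  qed
  also have "\<dots> \<le> (\<Sum>i\<le>m. ennreal (\<epsilon> ^ (CARD('n) - m) * (1 / real (CARD('n) - m + i)) * \<epsilon> ^ i) * abs_curv m M i U)"
    by (intro sum_mono k_le) simp
  finally show ?thesis .
qed

end
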